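(* Let $0<v\le x<v+a$ and $i\in E$, and let the process start from $X(0)=x$, $\underline X_0=v$, $J(0)=i$. Then $$M_t=e^{-w(t\wedge\tau_a)}\,e_{J(t\wedge\tau_a)}\,F_a\big(X(t\wedge\tau_a),\underline X_{t\wedge\tau_a}\big),\qquad t\ge0,$$ is a bounded row-vector-valued martingale (with respect to the filtration $\mathbb F$).
   Context: Model. Let $E=\{1,\dots,m\}$; for each $i\in E$ let $c_i>0$, $\lambda_i>0$, $p_i\in(0,1)$, and let $Q=(q_{ij})_{i,j\in E}$ be a stochastic matrix. $(X,J)$ is the Markov process on $[0,\infty)\times E$ with the following dynamics: while the phase $J$ equals $i$, the level $X$ increases linearly with slope $1/c_i$ and the next jump occurs at rate $\lambda_i$; at a jump from $(x,i)$ the process moves to $(p_i x,j)$ with probability $q_{ij}$ ($j=i$ is allowed). $\mathbb F=(\mathcal F_t)_{t\ge0}$ is the completed right-continuous natural filtration of $(X,J)$. $e_i$ is the $i$-th canonical row vector. Fix $w>0$ and $a>0$. Given an initial running minimum $v>0$, let $\underline X_t=v\wedge\inf_{0\le s\le t}X(s)$, $Y_t=X(t)-\underline X_t$, $\tau_a=\inf\{t\ge0:Y_t\ge a\}$. $\mathbb E_{(x,v),i}$ denotes expectation given $X(0)=x$, $\underline X_0=v$, $J(0)=i$. For $v>0$ define the matrix $$(H_a(v))_{ij}=\mathbb E_{(v,v),i}\big[e^{-w\tau_a};\tau_a<\infty,\ J(\tau_a)=j\big].$$ For $v>0$, $F_a(\cdot,v)$ denotes the unique bounded, absolutely continuous matrix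 function on $[v,v+a]$ with $F_a(v+a,v)=I$ which satisfies, for a.e. $x\in(v,v+a)$ and each $i\in E$, $$\frac1{c_i}\partial_x(e_iF_a(x,v))-(w+\lambda_i)e_iF_a(x,v)+\lambda_i\sum_kq_{ik}e_kH_a(p_ix)=0\quad\text{if }p_ix<v,$$ $$\frac1{c_i}\partial_x(e_iF_a(x,v))-(w+\lambda_i)e_iF_a(x,v)+\lambda_i\sum_kq_{ik}e_kF_a(p_ix,v)=0\quad\text{if }p_ix\ge v.$$ *)

theory Defs
  imports "HOL-Probability.Probability"
begin

section \<open>The level-phase process\<close>

text \<open>The phase space \<open>E = {1,...,m}\<close> is an arbitrary finite type \<open>'e\<close>. Vectors and matrices indexed
by \<open>E\<close> are elements of \<open>real^'e\<close> and \<open>real^'e^'e\<close>; the row vector \<open>e_i A\<close> is \<open>row i A\<close>.\<close>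

definition stochastic_matrix :: "real^'e^'e \<Rightarrow> bool" where
  "stochastic_matrix Q \<longleftrightarrow> (\<forall>i j. 0 \<le> Q $ i $ j) \<and> (\<forall>i. (\<Sum>j\<in>UNIV. Q $ i $ j) = 1)"

text \<open>Level just after the \<open>n\<close>-th jump, when the initial level is \<open>x\<close>, the successive phases are
\<open>z 0, z 1, ...\<close> and the successive holding times are \<open>s 0, s 1, ...\<close>.\<close>

primrec post_jump_level ::
  "real^'e \<Rightarrow> real^'e \<Rightarrow> real \<Rightarrow> (nat \<Rightarrow> 'e) \<Rightarrow> (nat \<Rightarrow> real) \<Rightarrow> nat \<Rightarrow> real" where
  "post_jump_level c p x z s 0 = x"
| "post_jump_level c p x z s (Suc n) = p $ z n * (post_jump_level c p x z s n + s n / c $ z n)"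

text \<open>\<open>(X, J)\<close> under \<open>M\<close> is the process started in \<open>(x, i)\<close>, described through its jumps: \<open>Z n\<close> is the
phase after the \<open>n\<close>-th jump, \<open>S n\<close> the time spent between the \<open>n\<close>-th and the \<open>(n+1)\<close>-st jump. Given
the past up to the \<open>n\<close>-th jump, \<open>S n\<close> is exponential with rate \<open>\<lambda>\<close> of the current phase and \<open>Z (n+1)\<close>
is independently drawn from the corresponding row of \<open>Q\<close>; the product formula states this for
the joint law of \<open>(Z 0, S 0, Z 1, ..., S (n-1), Z n)\<close>. Positivity of the holding times and
non-explosion hold almost surely as a consequence, so they are not required.\<close>

definition level_phase_process ::
  "real^'e \<Rightarrow> real^'e \<Rightarrow> real^'e \<Rightarrow> real^'e^'e \<Rightarrow>
   'w measure \<Rightarrow> (real \<Rightarrow> 'w \<Rightarrow> real) \<Rightarrow> (real \<Rightarrow> 'w \<Rightarrow> 'e::finite) \<Rightarrow> real \<Rightarrow> 'e \<Rightarrow> bool" where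
  "level_phase_process c lam p Q M X J x i \<longleftrightarrow>
     prob_space M \<and>
     (\<forall>t\<ge>0. X t \<in> borel_measurable M) \<and>
     (\<forall>t\<ge>0. J t \<in> measurable M (count_space UNIV)) \<and>
     (\<exists>Z S. (\<forall>n. Z n \<in> measurable M (count_space UNIV)) \<and>
        (\<forall>n. S n \<in> borel_measurable M) \<and>
        (\<forall>n z s. (\<forall>k<n. 0 \<le> s k) \<longrightarrow>
           measure M {\<omega> \<in> space M. Z 0 \<omega> = z 0 \<and> (\<forall>k<n. s k < S k \<omega> \<and> Z (Suc k) \<omega> = z (Suc k))}
           = (if z 0 = i
              then \<Prod>k<n. exp (- (lam $ z k) * s k) * Q $ z k $ z (Suc k)
              else 0)) \<and>
        (AE \<omega> in M. \<forall>n t. (\<Sum>k<n. S k \<omega>) \<le> t \<and> t < (\<Sum>k<Suc n. S k \<omega>) \<longrightarrow>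
           J t \<omega> = Z n \<omega> \<and>
           X t \<omega> = post_jump_level c p x (\<lambda>k. Z k \<omega>) (\<lambda>k. S k \<omega>) n
                     + (t - (\<Sum>k<n. S k \<omega>)) / c $ Z n \<omega>))"

text \<open>\<open>P x i\<close> is the law under which the process starts in \<open>(x, i)\<close>.\<close>

locale level_phase_model =
  fixes c lam p :: "real^'e::finite"
    and Q :: "real^'e^'e"
    and P :: "real \<Rightarrow> 'e \<Rightarrow> 'w measure"
    and X :: "real \<Rightarrow> 'w \<Rightarrow> real"
    and J :: "real \<Rightarrow> 'w \<Rightarrow> 'e"
  assumes c_pos: "\<And>i. 0 < c $ i"
    and lam_pos: "\<And>i. 0 < lam $ i"
    and p_range: "\<And>i. 0 < p $ i \<and> p $ i < 1"
    and Q_stochastic: "stochastic_matrix Q"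
    and process: "\<And>x i. 0 \<le> x \<Longrightarrow> level_phase_process c lam p Q (P x i) X J x i"


section \<open>Running minimum and drawup time\<close>

definition run_min :: "(real \<Rightarrow> 'w \<Rightarrow> real) \<Rightarrow> real \<Rightarrow> real \<Rightarrow> 'w \<Rightarrow> real" where
  "run_min X v t \<omega> = min v (INF s\<in>{0..t}. X s \<omega>)"

text \<open>An extended real; \<open>\<infinity>\<close> if the drawup never reaches \<open>a\<close>.\<close>

definition drawup_time :: "(real \<Rightarrow> 'w \<Rightarrow> real) \<Rightarrow> real \<Rightarrow> real \<Rightarrow> 'w \<Rightarrow> ereal" where
  "drawup_time X v a \<omega> = Inf (ereal ` {t. 0 \<le> t \<and> a \<le> X t \<omega> - run_min X v t \<omega>})"

definition stopped_at :: "(real \<Rightarrow> 'w \<Rightarrow> real) \<Rightarrow> real \<Rightarrow> real \<Rightarrow> real \<Rightarrow> 'w \<Rightarrow> real" where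
  "stopped_at X v a t \<omega> = real_of_ereal (min (ereal t) (drawup_time X v a \<omega>))"

text \<open>Only almost every path is prescribed, so infima over time are measurable with respect to the
completed measure; expectations are therefore taken under \<open>completion (P v i)\<close>.\<close>

definition H_mat ::
  "(real \<Rightarrow> 'e \<Rightarrow> 'w measure) \<Rightarrow> (real \<Rightarrow> 'w \<Rightarrow> real) \<Rightarrow> (real \<Rightarrow> 'w \<Rightarrow> 'e::finite) \<Rightarrow>
   real \<Rightarrow> real \<Rightarrow> real \<Rightarrow> real^'e^'e" where
  "H_mat P X J w a v = (\<chi> i j.
     \<integral>\<omega>. (let \<tau> = drawup_time X v a \<omega> in
           if \<tau> < \<infinity> \<and> J (real_of_ereal \<tau>) \<omega> = j then exp (- w * real_of_ereal \<tau>) else 0)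
     \<partial>completion (P v i))"


section \<open>The boundary value problem\<close>

definition absolutely_continuous_between :: "real \<Rightarrow> real \<Rightarrow> (real \<Rightarrow> 'b::real_normed_vector) \<Rightarrow> bool" where
  "absolutely_continuous_between \<alpha> \<beta> f \<longleftrightarrow>
     (\<forall>\<epsilon>>0. \<exists>\<delta>>0. \<forall>(n::nat) l r.
        (\<forall>k<n. \<alpha> \<le> l k \<and> l k \<le> r k \<and> r k \<le> \<beta>) \<and>
        disjoint_family_on (\<lambda>k. {l k<..<r k}) {..<n} \<and>
        (\<Sum>k<n. r k - l k) < \<delta> \<longrightarrow>
        (\<Sum>k<n. norm (f (r k) - f (l k))) < \<epsilon>)"

definition solves_bvp ::
  "real^'e \<Rightarrow> real^'e \<Rightarrow> real^'e \<Rightarrow> real^'e^'e \<Rightarrow> real \<Rightarrow> real \<Rightarrow>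
   (real \<Rightarrow> real^'e^'e) \<Rightarrow> real \<Rightarrow> (real \<Rightarrow> real^'e^'e::finite) \<Rightarrow> bool" where
  "solves_bvp c lam p Q w a H v f \<longleftrightarrow>
     bounded (f ` {v..v+a}) \<and>
     absolutely_continuous_between v (v + a) f \<and>
     f (v + a) = mat 1 \<and>
     (AE x in lborel. v < x \<and> x < v + a \<longrightarrow> (\<forall>i. \<exists>D.
        ((\<lambda>y. row i (f y)) has_vector_derivative D) (at x) \<and>
        (1 / c $ i) *\<^sub>R D - (w + lam $ i) *\<^sub>R row i (f x)
          + lam $ i *\<^sub>R (\<Sum>k\<in>UNIV. Q $ i $ k *\<^sub>R
              row k (if p $ i * x < v then H (p $ i * x) else f (p $ i * x))) = 0))"


section \<open>Filtration and martingales\<close>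

text \<open>The natural filtration of \<open>(X, J)\<close>, enlarged by all subsets of \<open>M\<close>-null sets and made
right-continuous.\<close>

definition augmented_filtration ::
  "'w measure \<Rightarrow> (real \<Rightarrow> 'w \<Rightarrow> real) \<Rightarrow> (real \<Rightarrow> 'w \<Rightarrow> 'e) \<Rightarrow> real \<Rightarrow> 'w measure" where
  "augmented_filtration M X J t = sigma (space M)
     (\<Inter>u\<in>{t<..}. sigma_sets (space M)
        ((\<Union>s\<in>{0..u}. sets (vimage_algebra (space M) (\<lambda>\<omega>. (X s \<omega>, J s \<omega>))
                              (borel \<Otimes>\<^sub>M count_space UNIV)))
         \<union> null_sets (completion M)))"

text \<open>Vector-valued martingales in continuous time \<open>t \<ge> 0\<close>; the conditional expectation is taken
componentwise.\<close>

definition vector_martingale ::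
  "'w measure \<Rightarrow> (real \<Rightarrow> 'w measure) \<Rightarrow> (real \<Rightarrow> 'w \<Rightarrow> real^'e::finite) \<Rightarrow> bool" where
  "vector_martingale M F Y \<longleftrightarrow>
     filtration (space M) F \<and>
     (\<forall>t\<ge>0. subalgebra M (F t)) \<and>
     (\<forall>t\<ge>0. Y t \<in> borel_measurable (F t) \<and> integrable M (Y t)) \<and>
     (\<forall>s t. 0 \<le> s \<and> s \<le> t \<longrightarrow>
        (\<forall>j. AE \<omega> in M. real_cond_exp M (F s) (\<lambda>\<omega>. Y t \<omega> $ j) \<omega> = Y s \<omega> $ j))"

end

theory Submission
  imports Defs
begin

text \<open>Write \<open>\<xi> = exp (- w \<tau>\<^sub>a) 1{J(\<tau>\<^sub>a) = j}\<close> and let \<open>G(x, v)\<close> be its expectation for a process started in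
level \<open>x\<close> with running minimum \<open>v\<close>. Conditioning on the first jump gives an integral equation for \<open>G\<close>.
Integrating the boundary value problem, in which \<open>H\<^sub>a(u) = G(u, u)\<close>, gives the same equation for \<open>F\<close> up to
the terms with post-jump level above the minimum; there the two equations differ by an operator of sup norm
at most \<open>max\<^sub>i \<lambda>\<^sub>i / (w + \<lambda>\<^sub>i) < 1\<close>, so \<open>F = G\<close>. By the Markov property at time \<open>t\<close>, \<open>M\<^sub>t\<close> is then the conditional
expectation of \<open>\<xi>\<close> given \<open>F\<^sub>t\<close>. That property only has to be checked on the event of exactly \<open>n\<close> jumps up
to \<open>t\<close>, where an event of \<open>F\<^sub>t\<close> is an event of the first \<open>n\<close> jumps; peeling off the jumps one by one reduces it to
\<open>n = 0\<close>, which is memorylessness of the holding time.\<close>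

section \<open>Integrating absolutely continuous functions\<close>

text \<open>The given probability spaces are arbitrary and prescribe only almost every path, so all
  computation takes place on the canonical space of jump sequences and is carried back by a
  coupling. The boundary value problem is posed separately for each minimum, hence nothing is known
  about \<open>F\<close> as a function of its second argument; that \<open>M_t\<close> is measurable
  in the random minimum comes only from the identification with the jointly measurable
  \<open>G\<close>. The level moves up continuously, so the drawup equals \<open>a\<close> exactly
  at its hitting time, and there the boundary value \<open>I\<close> of \<open>F\<close> turns the
  stopped process into \<xi>. Two features of the filtration need care: adaptedness forces infima
  over all times to be rewritten with countably many times, and right-continuity lets events look
  slightly beyond \<open>t\<close>.\<close>

lemma absolutely_continuous_between_finite:
  assumes ac: "absolutely_continuous_between \<alpha> \<beta> f" and "0 < \<epsilon>"
  shows "\<exists>\<delta>>0. \<forall>(I :: 'c set) l r. finite I \<and> (\<forall>k\<in>I. \<alpha> \<le> l k \<and> l k \<le> r k \<and> r k \<le> \<beta>) \<and>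
        disjoint_family_on (\<lambda>k. {l k<..<r k}) I \<and> (\<Sum>k\<in>I. r k - l k) < \<delta>
      \<longrightarrow> (\<Sum>k\<in>I. norm (f (r k) - f (l k))) < \<epsilon>"
proof -
  obtain \<delta> where \<delta>: "0 < \<delta>" and d: "\<And>(n::nat) l r. 
        (\<forall>k<n. \<alpha> \<le> l k \<and> l k \<le> r k \<and> r k \<le> \<beta>) \<and>
        disjoint_family_on (\<lambda>k. {l k<..<r k}) {..<n} \<and>
        (\<Sum>k<n. r k - l k) < \<delta> \<Longrightarrow>
        (\<Sum>k<n. norm (f (r k) - f (l k))) < \<epsilon>"
    using assms unfolding absolutely_continuous_between_def by meson
  show ?thesis
  proof (intro exI[of _ \<delta>] conjI \<delta> allI impI)
    fix I :: "'c set" and l r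
    assume "finite I \<and> (\<forall>k\<in>I. \<alpha> \<le> l k \<and> l k \<le> r k \<and> r k \<le> \<beta>) \<and>
        disjoint_family_on (\<lambda>k. {l k<..<r k}) I \<and> (\<Sum>k\<in>I. r k - l k) < \<delta>"
    then have I: "finite I" "\<And>k. k \<in> I \<Longrightarrow> \<alpha> \<le> l k \<and> l k \<le> r k \<and> r k \<le> \<beta>"
      "disjoint_family_on (\<lambda>k. {l k<..<r k}) I" "(\<Sum>k\<in>I. r k - l k) < \<delta>"
      by auto
    \<comment> \<open>The definition enumerates intervals by an initial segment of the naturals,
      whereas a tagged division is a set of pairs; an enumeration bridges the two.\<close>
    obtain h where h: "bij_betw h {..<card I} I"
      using ex_bij_betw_nat_finite[OF I(1)] by (auto simp: atLeast0LessThan)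
    then have hI: "h k \<in> I" if "k < card I" for k
      using that by (auto simp: bij_betw_def)
    have "disjoint_family_on (\<lambda>k. {l (h k)<..<r (h k)}) {..<card I}"
      using I(3) h unfolding disjoint_family_on_def bij_betw_def inj_on_def
      by (metis hI lessThan_iff)
    moreover have "(\<Sum>k<card I. r (h k) - l (h k)) < \<delta>"
      using I(4) sum.reindex_bij_betw[OF h, of "\<lambda>k. r k - l k"] by simp
    ultimately have "(\<Sum>k<card I. norm (f (r (h k)) - f (l (h k)))) < \<epsilon>"
      using I(2) hI by (intro d) blast
    then show "(\<Sum>k\<in>I. norm (f (r k) - f (l k))) < \<epsilon>"
      using sum.reindex_bij_betw[OF h, of "\<lambda>k. norm (f (r k) - f (l k))"] by simp
  qed
qed

lemma absolutely_continuous_between_subset: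
  assumes "absolutely_continuous_between \<alpha> \<beta> f" "\<alpha> \<le> \<alpha>'" "\<beta>' \<le> \<beta>"
  shows "absolutely_continuous_between \<alpha>' \<beta>' f"
  unfolding absolutely_continuous_between_def
proof (intro allI impI)
  fix \<epsilon> :: real assume "0 < \<epsilon>"
  then obtain \<delta> where \<delta>: "0 < \<delta>" and d: "\<And>(n::nat) l r. 
        (\<forall>k<n. \<alpha> \<le> l k \<and> l k \<le> r k \<and> r k \<le> \<beta>) \<and>
        disjoint_family_on (\<lambda>k. {l k<..<r k}) {..<n} \<and>
        (\<Sum>k<n. r k - l k) < \<delta> \<Longrightarrow>
        (\<Sum>k<n. norm (f (r k) - f (l k))) < \<epsilon>"
    using assms unfolding absolutely_continuous_between_def by meson
  show "\<exists>\<delta>>0. \<forall>(n::nat) l r.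
        (\<forall>k<n. \<alpha>' \<le> l k \<and> l k \<le> r k \<and> r k \<le> \<beta>') \<and>
        disjoint_family_on (\<lambda>k. {l k<..<r k}) {..<n} \<and>
        (\<Sum>k<n. r k - l k) < \<delta> \<longrightarrow>
        (\<Sum>k<n. norm (f (r k) - f (l k))) < \<epsilon>"
  proof (intro exI[of _ \<delta>] conjI allI impI \<delta>)
    fix n :: nat and l r
    assume *: "(\<forall>k<n. \<alpha>' \<le> l k \<and> l k \<le> r k \<and> r k \<le> \<beta>') \<and>
        disjoint_family_on (\<lambda>k. {l k<..<r k}) {..<n} \<and>
        (\<Sum>k<n. r k - l k) < \<delta>"
    then have "\<forall>k<n. \<alpha> \<le> l k \<and> l k \<le> r k \<and> r k \<le> \<beta>"
      using assms(2,3) by (meson order_trans)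
    with * show "(\<Sum>k<n. norm (f (r k) - f (l k))) < \<epsilon>" by (intro d) blast
  qed
qed

text \<open>Made for the product of a solution with a smooth weight: the weight contributes the
  Lipschitz term, the solution a multiple of its own increments.\<close>

lemma absolutely_continuous_between_dominated:
  fixes f :: "real \<Rightarrow> 'b::real_normed_vector" and g :: "real \<Rightarrow> 'c::real_normed_vector"
  assumes ac: "absolutely_continuous_between \<alpha> \<beta> f" and "0 \<le> C" "0 \<le> K"
    and le: "\<And>x y. \<alpha> \<le> x \<Longrightarrow> x \<le> y \<Longrightarrow> y \<le> \<beta> \<Longrightarrow>
      norm (g y - g x) \<le> C * norm (f y - f x) + K * (y - x)"
  shows "absolutely_continuous_between \<alpha> \<beta> g"
  unfolding absolutely_continuous_between_def
proof (intro allI impI)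
  fix \<epsilon> :: real assume e: "0 < \<epsilon>"
  \<comment> \<open>Half of \<epsilon> goes to each of the two terms; the added 1 avoids division by
    zero and makes both estimates strict.\<close>
  then have "0 < \<epsilon> / (2 * (C + 1))" using assms by simp
  then obtain \<delta> where \<delta>: "0 < \<delta>" and d: "\<And>(n::nat) l r. 
        (\<forall>k<n. \<alpha> \<le> l k \<and> l k \<le> r k \<and> r k \<le> \<beta>) \<and>
        disjoint_family_on (\<lambda>k. {l k<..<r k}) {..<n} \<and>
        (\<Sum>k<n. r k - l k) < \<delta> \<Longrightarrow>
        (\<Sum>k<n. norm (f (r k) - f (l k))) < \<epsilon> / (2 * (C + 1))"
    using ac unfolding absolutely_continuous_between_def by meson
  show "\<exists>\<delta>>0. \<forall>(n::nat) l r.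
        (\<forall>k<n. \<alpha> \<le> l k \<and> l k \<le> r k \<and> r k \<le> \<beta>) \<and>
        disjoint_family_on (\<lambda>k. {l k<..<r k}) {..<n} \<and>
        (\<Sum>k<n. r k - l k) < \<delta> \<longrightarrow>
        (\<Sum>k<n. norm (g (r k) - g (l k))) < \<epsilon>"
  proof (intro exI[of _ "min \<delta> (\<epsilon> / (2 * (K + 1)))"] conjI allI impI)
    show "0 < min \<delta> (\<epsilon> / (2 * (K + 1)))" using \<delta> e assms by simp
    fix n :: nat and l r
    assume *: "(\<forall>k<n. \<alpha> \<le> l k \<and> l k \<le> r k \<and> r k \<le> \<beta>) \<and>
        disjoint_family_on (\<lambda>k. {l k<..<r k}) {..<n} \<and>
        (\<Sum>k<n. r k - l k) < min \<delta> (\<epsilon> / (2 * (K + 1)))"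
    have "(\<Sum>k<n. norm (g (r k) - g (l k)))
        \<le> (\<Sum>k<n. C * norm (f (r k) - f (l k)) + K * (r k - l k))"
      using * by (intro sum_mono le) auto
    also have "\<dots> = C * (\<Sum>k<n. norm (f (r k) - f (l k))) + K * (\<Sum>k<n. r k - l k)"
      by (simp add: sum.distrib sum_distrib_left)
    also have "\<dots> \<le> C * (\<epsilon> / (2 * (C + 1))) + K * (\<epsilon> / (2 * (K + 1)))"
      using d[of n l r] * assms by (intro add_mono mult_left_mono) auto
    also have "\<dots> < \<epsilon> / 2 + \<epsilon> / 2"
      using assms e by (intro add_strict_mono) (simp_all add: field_simps)
    finally show "(\<Sum>k<n. norm (g (r k) - g (l k))) < \<epsilon>" by simp
  qed
qed

text \<open>Tags in the exceptional set only see intervals inside an open set of small measure, where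
absolute continuity controls the increments of \<open>f\<close>; elsewhere the usual gauge works.\<close>

lemma absolutely_continuous_has_integral:
  fixes f :: "real \<Rightarrow> 'b::banach"
  assumes ab: "\<alpha> \<le> \<beta>" and ac: "absolutely_continuous_between \<alpha> \<beta> f"
    and neg: "negligible N"
    and deriv: "\<And>x. \<alpha> < x \<Longrightarrow> x < \<beta> \<Longrightarrow> x \<notin> N \<Longrightarrow> (f has_vector_derivative g x) (at x)"
  shows "(g has_integral f \<beta> - f \<alpha>) {\<alpha>..\<beta>}"
proof (cases "\<alpha> = \<beta>")
  case True then show ?thesis by (simp add: has_integral_refl(2) flip: cbox_interval)
next
  case False
  with ab have ab': "\<alpha> < \<beta>" by simp
  \<comment> \<open>The endpoints join the exceptional set because no derivative is assumed there.
    With the integrand set to 0 on that set, tags in it contribute only increments of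
    \<open>f\<close>.\<close>
  define N' where "N' = N \<union> {\<alpha>, \<beta>}"
  define g' where "g' x = (if x \<in> N' then 0 else g x)" for x
  have negN': "negligible N'" unfolding N'_def using neg by (intro negligible_Un) auto
  have "(g' has_integral f \<beta> - f \<alpha>) {\<alpha>..\<beta>}"
    unfolding has_integral_factor_content_real
  proof (intro allI impI)
    fix e :: real assume e: "0 < e"
    have e2: "0 < e * (\<beta> - \<alpha>) / 2" using e ab' by simp
    obtain \<delta> where \<delta>: "0 < \<delta>" and d: "\<forall>(I :: (real \<times> real set) set) l r.
        finite I \<and> (\<forall>k\<in>I. \<alpha> \<le> l k \<and> l k \<le> r k \<and> r k \<le> \<beta>) \<and>
        disjoint_family_on (\<lambda>k. {l k<..<r k}) I \<and> (\<Sum>k\<in>I. r k - l k) < \<delta>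
      \<longrightarrow> (\<Sum>k\<in>I. norm (f (r k) - f (l k))) < e * (\<beta> - \<alpha>) / 2"
      using absolutely_continuous_between_finite[OF ac e2] by blast
    have nullN: "N' \<in> null_sets lebesgue" using negN' by (simp add: negligible_iff_null_sets)
    obtain U where U: "open U" "N' \<subseteq> U" "U - N' \<in> lmeasurable" "emeasure lebesgue (U - N') < ennreal \<delta>"
      using sets_lebesgue_outer_open[of N' \<delta>] nullN \<delta> by (metis null_setsD2)
    have emU: "emeasure lebesgue U < ennreal \<delta>"
      using emeasure_Diff_null_set[OF nullN, of U] U by auto
    have "\<exists>r>0. \<forall>y. norm (y - x) < r \<longrightarrow> norm (f y - f x - (y - x) *\<^sub>R g x) \<le> e / 2 * norm (y - x)"
      if "x \<in> {\<alpha>..\<beta>} - N'" for x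
    proof -
      have "\<alpha> < x" "x < \<beta>" "x \<notin> N" using that unfolding N'_def by auto
      from deriv[OF this] show ?thesis
        using half_gt_zero[OF e] unfolding has_vector_derivative_def has_derivative_at_alt by blast
    qed
    then obtain \<rho> where \<rho>: "\<And>x. x \<in> {\<alpha>..\<beta>} - N' \<Longrightarrow> 0 < \<rho> x"
      "\<And>x y. x \<in> {\<alpha>..\<beta>} - N' \<Longrightarrow> norm (y - x) < \<rho> x \<Longrightarrow>
         norm (f y - f x - (y - x) *\<^sub>R g x) \<le> e / 2 * norm (y - x)"
      by metis
    define D where "D x = (if x \<in> N' then U else if x \<in> {\<alpha>..\<beta>} then ball x (\<rho> x) else ball x 1)" for x
    have gD: "gauge D"
      using U \<rho>(1) by (auto simp: gauge_def D_def)
    show "\<exists>d. gauge d \<and> (\<forall>p. p tagged_division_of {\<alpha>..\<beta>} \<and> d fine p \<longrightarrow>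
        norm ((\<Sum>(x, k)\<in>p. measure lborel k *\<^sub>R g' x) - (f \<beta> - f \<alpha>)) \<le> e * measure lborel {\<alpha>..\<beta>})"
    proof (intro exI[of _ D] conjI gD allI impI)
      fix p assume p: "p tagged_division_of {\<alpha>..\<beta>} \<and> D fine p"
      then have pt: "p tagged_division_of {\<alpha>..\<beta>}" and fine: "D fine p" by auto
      have fin: "finite p" using pt by auto
      have K: "\<exists>u v. K = {u..v} \<and> u \<le> v \<and> x \<in> {u..v} \<and> \<alpha> \<le> u \<and> v \<le> \<beta>" if "(x, K) \<in> p" for x K
      proof -
        have "x \<in> K" "K \<subseteq> {\<alpha>..\<beta>}" "\<exists>u v. K = cbox u v"
          using tagged_division_ofD[OF pt] that by blast+
        then show ?thesis by fastforce
      qed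
      have sum1: "f \<beta> - f \<alpha> = (\<Sum>(x, K)\<in>p. f (Sup K) - f (Inf K))"
        using additive_tagged_division_1[OF ab pt, of f] by simp
      have sum2: "\<beta> - \<alpha> = (\<Sum>(x, K)\<in>p. Sup K - Inf K)"
        using additive_tagged_division_1[OF ab pt, of "\<lambda>x. x"] by simp
      define p1 where "p1 = {z \<in> p. fst z \<in> N'}"
      define h where "h = (\<lambda>(x, K). measure lborel K *\<^sub>R g' x - (f (Sup K) - f (Inf K)))"
      have "norm (sum h p1) \<le> (\<Sum>z\<in>p1. norm (f (Sup (snd z)) - f (Inf (snd z))))"
        by (rule sum_norm_le) (auto simp: p1_def h_def g'_def norm_minus_commute split: prod.splits)
      also have "\<dots> \<le> e * (\<beta> - \<alpha>) / 2"
      proof (rule less_imp_le, rule d[THEN spec, THEN spec, THEN spec, THEN mp], intro conjI)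
        show "finite p1" using fin by (simp add: p1_def)
        show "\<forall>z\<in>p1. \<alpha> \<le> Inf (snd z) \<and> Inf (snd z) \<le> Sup (snd z) \<and> Sup (snd z) \<le> \<beta>"
        proof
          fix z assume "z \<in> p1"
          then show "\<alpha> \<le> Inf (snd z) \<and> Inf (snd z) \<le> Sup (snd z) \<and> Sup (snd z) \<le> \<beta>"
            using K[of "fst z" "snd z"] by (auto simp: p1_def)
        qed
        show disj: "disjoint_family_on (\<lambda>z. {Inf (snd z)<..<Sup (snd z)}) p1"
          unfolding disjoint_family_on_def
        proof (intro ballI impI)
          fix z y assume zy: "z \<in> p1" "y \<in> p1" "z \<noteq> y"
          have "interior (snd z) \<inter> interior (snd y) = {}"
            using tagged_division_ofD(5)[OF pt, of "fst z" "snd z" "fst y" "snd y"] zy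
            by (auto simp: p1_def)
          then show "{Inf (snd z)<..<Sup (snd z)} \<inter> {Inf (snd y)<..<Sup (snd y)} = {}"
            using K[of "fst z" "snd z"] K[of "fst y" "snd y"] zy by (auto simp: p1_def)
        qed
        have nonneg: "0 \<le> Sup (snd z) - Inf (snd z)"
          and em: "ennreal (Sup (snd z) - Inf (snd z)) = emeasure lebesgue {Inf (snd z)<..<Sup (snd z)}"
          if "z \<in> p1" for z
          using that K[of "fst z" "snd z"] by (auto simp: p1_def)
        have "ennreal (\<Sum>z\<in>p1. Sup (snd z) - Inf (snd z))
            = (\<Sum>z\<in>p1. ennreal (Sup (snd z) - Inf (snd z)))"
          by (rule sum_ennreal[symmetric]) (rule nonneg)
        also have "\<dots> = (\<Sum>z\<in>p1. emeasure lebesgue {Inf (snd z)<..<Sup (snd z)})"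
          by (rule sum.cong[OF refl]) (rule em)
        also have "\<dots> = emeasure lebesgue (\<Union>z\<in>p1. {Inf (snd z)<..<Sup (snd z)})"
          using disj fin by (intro sum_emeasure) (auto simp: p1_def)
        also have "\<dots> \<le> emeasure lebesgue U"
        proof (rule emeasure_mono)
          have "{Inf (snd z)<..<Sup (snd z)} \<subseteq> U" if "z \<in> p1" for z
            using that K[of "fst z" "snd z"] fineD[OF fine, of "fst z" "snd z"]
            by (auto simp: p1_def D_def)
          then show "(\<Union>z\<in>p1. {Inf (snd z)<..<Sup (snd z)}) \<subseteq> U" by blast
        qed (use U(1) in auto)
        also have "\<dots> < ennreal \<delta>" by (rule emU)
        finally have "ennreal (\<Sum>z\<in>p1. Sup (snd z) - Inf (snd z)) < ennreal \<delta>" .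
        moreover have "0 \<le> (\<Sum>z\<in>p1. Sup (snd z) - Inf (snd z))"
          by (rule sum_nonneg) (use nonneg in blast)
        ultimately show "(\<Sum>z\<in>p1. Sup (snd z) - Inf (snd z)) < \<delta>"
          by (simp add: ennreal_less_iff)
      qed
      finally have B1: "norm (sum h p1) \<le> e * (\<beta> - \<alpha>) / 2" .
      have "norm (sum h (p - p1)) \<le> (\<Sum>z\<in>p - p1. e / 2 * (Sup (snd z) - Inf (snd z)))"
      proof (rule sum_norm_le)
        fix z assume z: "z \<in> p - p1"
        obtain x K' where zx: "z = (x, K')" by force
        obtain u v where uv: "K' = {u..v}" "u \<le> v" "x \<in> {u..v}" "\<alpha> \<le> u" "v \<le> \<beta>"
          using K[of x K'] z zx by blast
        have x: "x \<in> {\<alpha>..\<beta>} - N'" using z zx uv by (auto simp: p1_def)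
        have "{u..v} \<subseteq> ball x (\<rho> x)"
          using fineD[OF fine, of x K'] z zx uv x by (auto simp: D_def)
        then have "u \<in> ball x (\<rho> x)" "v \<in> ball x (\<rho> x)"
          using uv(2) by auto
        then have "norm (u - x) < \<rho> x" "norm (v - x) < \<rho> x"
          by (auto simp: dist_norm norm_minus_commute)
        then have *: "norm (f u - f x - (u - x) *\<^sub>R g x) \<le> e / 2 * (x - u)"
          "norm (f v - f x - (v - x) *\<^sub>R g x) \<le> e / 2 * (v - x)"
          using \<rho>(2)[OF x, of u] \<rho>(2)[OF x, of v] uv by auto
        \<comment> \<open>Straddling: the increment over \<open>{u..v}\<close> is split at the tag,
          so that both differences start at the point of differentiability.\<close>
        have "h z = (f u - f x - (u - x) *\<^sub>R g x) - (f v - f x - (v - x) *\<^sub>R g x)"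
          using uv x by (simp add: h_def zx g'_def algebra_simps)
        then have "norm (h z) \<le> norm (f u - f x - (u - x) *\<^sub>R g x) + norm (f v - f x - (v - x) *\<^sub>R g x)"
          by (simp only: norm_triangle_ineq4)
        with * have "norm (h z) \<le> e / 2 * (x - u) + e / 2 * (v - x)" by linarith
        then show "norm (h z) \<le> e / 2 * (Sup (snd z) - Inf (snd z))"
          using uv by (simp add: zx field_simps)
      qed
      also have "\<dots> \<le> (\<Sum>z\<in>p. e / 2 * (Sup (snd z) - Inf (snd z)))"
      proof (rule sum_mono2[OF fin])
        fix z assume "z \<in> p - (p - p1)"
        then show "0 \<le> e / 2 * (Sup (snd z) - Inf (snd z))"
          using K[of "fst z" "snd z"] e by (auto simp: p1_def)
      qed auto
      also have "\<dots> = e / 2 * (\<beta> - \<alpha>)"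
        unfolding sum2 sum_distrib_left by (simp add: split_def)
      finally have B2: "norm (sum h (p - p1)) \<le> e / 2 * (\<beta> - \<alpha>)" .
      have "(\<Sum>(x, k)\<in>p. measure lborel k *\<^sub>R g' x) - (f \<beta> - f \<alpha>) = sum h p"
        unfolding sum1 h_def by (simp add: split_def sum_subtractf)
      also have "\<dots> = sum h p1 + sum h (p - p1)"
        using fin by (subst sum.subset_diff[of p1 p]) (auto simp: p1_def)
      finally have eq: "(\<Sum>(x, k)\<in>p. measure lborel k *\<^sub>R g' x) - (f \<beta> - f \<alpha>) = sum h p1 + sum h (p - p1)" .
      have "norm (sum h p1 + sum h (p - p1)) \<le> e * (\<beta> - \<alpha>) / 2 + e / 2 * (\<beta> - \<alpha>)"
        using norm_triangle_ineq[of "sum h p1" "sum h (p - p1)"] B1 B2 by linarith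
      then show "norm ((\<Sum>(x, k)\<in>p. measure lborel k *\<^sub>R g' x) - (f \<beta> - f \<alpha>)) \<le> e * measure lborel {\<alpha>..\<beta>}"
        unfolding eq using ab by (simp add: field_simps)
    qed
  qed
  then show ?thesis
    by (rule has_integral_spike[OF negN', rotated]) (simp add: g'_def)
qed

section \<open>The law of the jump chain\<close>

text \<open>The \<open>n\<close>-th coordinate is the phase after the \<open>n\<close>-th jump, paired with the holding time in it.\<close>

definition seqM :: "(nat \<Rightarrow> 'e::finite \<times> real) measure" where
  "seqM = PiM UNIV (\<lambda>_. count_space UNIV \<Otimes>\<^sub>M borel)"

lemma space_seqM [simp]: "space seqM = UNIV"
  by (simp add: seqM_def space_PiM space_pair_measure)

lemma measurable_seqM_component [measurable]:
  "(\<lambda>\<omega>. \<omega> n) \<in> measurable seqM (count_space UNIV \<Otimes>\<^sub>M borel)"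
  unfolding seqM_def by simp

lemma measurable_seqM_fst [measurable]:
  "(\<lambda>\<omega>. fst (\<omega> n)) \<in> measurable seqM (count_space UNIV)"
  by (rule measurable_compose[OF measurable_seqM_component measurable_fst])

lemma measurable_seqM_snd [measurable]:
  "(\<lambda>\<omega>. snd (\<omega> n)) \<in> borel_measurable seqM"
  by (rule measurable_compose[OF measurable_seqM_component measurable_snd])

lemma measurable_into_seqM:
  assumes "\<And>n. (\<lambda>x. f x n) \<in> measurable M (count_space UNIV \<Otimes>\<^sub>M borel)"
  shows "f \<in> measurable M seqM"
  unfolding seqM_def using assms by (intro measurable_PiM_single') (auto simp: space_pair_measure)

text \<open>Prepending \<open>(i, s)\<close> inverts the removal of the first jump. First-jump
  decompositions push measures forward along this map, which requires joint measurability in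
  \<open>s\<close> and the remaining sequence.\<close>

lemma measurable_case_nat_seqM [measurable]:
  "(\<lambda>(s, \<omega>). case_nat (i, s) \<omega>) \<in> measurable (borel \<Otimes>\<^sub>M seqM) seqM"
proof (rule measurable_into_seqM)
  fix n
  show "(\<lambda>x. (case x of (s, \<omega>) \<Rightarrow> case_nat (i, s) \<omega>) n)
      \<in> borel \<Otimes>\<^sub>M seqM \<rightarrow>\<^sub>M count_space UNIV \<Otimes>\<^sub>M borel"
    by (cases n) (simp_all add: split_def)
qed

section \<open>Cylinder events and the measures they determine\<close>

definition cyl :: "nat \<Rightarrow> (nat \<Rightarrow> 'e) \<Rightarrow> (nat \<Rightarrow> real) \<Rightarrow> (nat \<Rightarrow> 'e::finite \<times> real) set" where
  "cyl n z s = {\<omega>. fst (\<omega> 0) = z 0 \<and> (\<forall>k<n. s k < snd (\<omega> k) \<and> fst (\<omega> (Suc k)) = z (Suc k))}"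

lemma sets_cyl [measurable]: "cyl n z s \<in> sets seqM"
proof -
  have "{\<omega> \<in> space seqM. fst (\<omega> 0) = z 0 \<and> (\<forall>k<n. s k < snd (\<omega> k) \<and> fst (\<omega> (Suc k)) = z (Suc k))} \<in> sets seqM"
    by measurable
  then show ?thesis by (simp add: cyl_def)
qed

lemma fst_cyl: "\<omega> \<in> cyl n z s \<Longrightarrow> k \<le> n \<Longrightarrow> fst (\<omega> k) = z k"
  by (cases k) (auto simp: cyl_def)

text \<open>Two lower bounds on one holding time merge into their maximum. With the lengths ordered,
  the longer word describes the intersection, provided it extends the shorter one.\<close>

lemma cyl_Int:
  assumes "n \<le> m"
  shows "cyl n z s \<inter> cyl m z' s' =
    (if \<forall>k\<le>n. z k = z' k then cyl m z' (\<lambda>k. if k < n then max (s k) (s' k) else s' k) else {})"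
proof (cases "\<forall>k\<le>n. z k = z' k")
  case True
  then have "z 0 = z' 0" "\<And>k. k < n \<Longrightarrow> z (Suc k) = z' (Suc k)" by auto
  with assms True show ?thesis by (auto simp: cyl_def split: if_splits)
next
  case False
  then show ?thesis using assms fst_cyl[of _ n z s] fst_cyl[of _ m z' s']
    by (auto simp: disjoint_iff) (metis order_trans)
qed

lemma Int_stable_cyl: "Int_stable (insert {} (range (\<lambda>(n, z, s). cyl n z s)))"
proof (rule Int_stableI)
  fix a b :: "(nat \<Rightarrow> 'a \<times> real) set"
  assume ab: "a \<in> insert {} (range (\<lambda>(n, z, s). cyl n z s))" "b \<in> insert {} (range (\<lambda>(n, z, s). cyl n z s))"
  have *: "cyl n z s \<inter> cyl m z' s' \<in> insert {} (range (\<lambda>(n, z, s). cyl n z s))" if "n \<le> m"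
    for n m :: nat and z z' :: "nat \<Rightarrow> 'a" and s s'
    unfolding cyl_Int[OF that] by (auto split: if_splits)
  show "a \<inter> b \<in> insert {} (range (\<lambda>(n, z, s). cyl n z s))"
  proof (cases "a = {} \<or> b = {}")
    case False
    obtain n z s where "a = cyl n z s" using ab(1) False by (auto split: prod.splits)
    moreover obtain m z' s' where "b = cyl m z' s'" using ab(2) False by (auto split: prod.splits)
    ultimately show ?thesis using *[of n m z s z' s'] *[of m n z' s' z s]
      by (metis Int_commute nat_le_linear)
  qed auto
qed

text \<open>The coordinates are recovered from countable unions of cylinders: finite phase words
  range over a countable set, and an unconstrained holding time is captured by letting its threshold
  run through the nonpositive integers.\<close>

lemma sets_seqM_eq_cyl:
  "sets (seqM :: (nat \<Rightarrow> 'e::finite \<times> real) measure)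
    = sigma_sets UNIV (insert {} (range (\<lambda>(n, z, s). cyl n z s)))"
    (is "_ = sigma_sets UNIV ?E")
proof
  show "sigma_sets UNIV ?E \<subseteq> sets (seqM :: (nat \<Rightarrow> 'e \<times> real) measure)"
  proof -
    have "?E \<subseteq> sets (seqM :: (nat \<Rightarrow> 'e \<times> real) measure)" by auto
    then show ?thesis by (metis space_seqM sets.sigma_sets_subset)
  qed
  let ?S = "sigma UNIV ?E"
  have cylS: "cyl n z s \<in> sets ?S" for n z s
    by auto
  have bd: "\<exists>m::nat. \<forall>k<n. - real m < snd (\<omega> k)" for n and \<omega> :: "nat \<Rightarrow> 'e \<times> real"
  proof -
    obtain m :: nat where m: "(\<Sum>k<n. \<bar>snd (\<omega> k)\<bar>) < m" using reals_Archimedean2 by blast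
    have "- real m < snd (\<omega> k)" if "k < n" for k
    proof -
      have "\<bar>snd (\<omega> k)\<bar> \<le> (\<Sum>k<n. \<bar>snd (\<omega> k)\<bar>)"
        using that by (intro member_le_sum) auto
      with m show ?thesis by linarith
    qed
    then show ?thesis by blast
  qed
  \<comment> \<open>Lists code the phase words so that the union over them is countable.\<close>
  have ex: "\<exists>l. \<forall>k\<le>n. l ! k = fst (\<omega> k)" for n and \<omega> :: "nat \<Rightarrow> 'e \<times> real"
    by (rule exI[of _ "map (\<lambda>k. fst (\<omega> k)) [0..<Suc n]"]) (simp del: upt_Suc)
  have "(\<lambda>\<omega>. \<omega>) \<in> measurable ?S (seqM :: (nat \<Rightarrow> 'e \<times> real) measure)"
  proof (rule measurable_into_seqM)
    fix n
    have "(\<lambda>\<omega>. fst (\<omega> n)) \<in> measurable ?S (count_space UNIV)"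
    proof (subst measurable_count_space_eq2_countable, intro conjI ballI)
      show "(\<lambda>\<omega>. fst (\<omega> n)) \<in> space ?S \<rightarrow> UNIV" by auto
      fix e :: 'e
      have "(\<lambda>\<omega>. fst (\<omega> n)) -` {e} \<inter> space ?S
          = (\<Union>l\<in>{l. l ! n = e}. \<Union>m::nat. cyl n (nth l) (\<lambda>_. - real m))"
      proof safe
        fix \<omega> :: "nat \<Rightarrow> 'e \<times> real"
        obtain l where "\<forall>k\<le>n. l ! k = fst (\<omega> k)" using ex by blast
        moreover obtain m :: nat where "\<forall>k<n. - real m < snd (\<omega> k)" using bd by blast
        ultimately show "\<omega> \<in> (\<Union>l\<in>{l. l ! n = fst (\<omega> n)}. \<Union>m::nat. cyl n (nth l) (\<lambda>_. - real m))"
          by (auto simp: cyl_def intro!: exI[of _ l] exI[of _ m])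
      qed (auto dest: fst_cyl)
      also have "\<dots> \<in> sets ?S"
        by (intro sets.countable_UN'' countableI_type cylS)
      finally show "(\<lambda>\<omega>. fst (\<omega> n)) -` {e} \<inter> space ?S \<in> sets ?S" .
    qed
    moreover have "(\<lambda>\<omega>. snd (\<omega> n)) \<in> borel_measurable ?S"
    proof (subst borel_measurable_iff_greater, intro allI)
      fix r :: real
      have "{\<omega> \<in> space ?S. r < snd (\<omega> n)}
          = (\<Union>l. \<Union>m::nat. cyl (Suc n) (nth l) (\<lambda>k. if k = n then r else - real m))"
      proof safe
        fix \<omega> :: "nat \<Rightarrow> 'e \<times> real" assume r: "r < snd (\<omega> n)"
        obtain l where "\<forall>k\<le>Suc n. l ! k = fst (\<omega> k)" using ex by blast
        moreover obtain m :: nat where "\<forall>k<n. - real m < snd (\<omega> k)" using bd by blast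
        ultimately show "\<omega> \<in> (\<Union>l. \<Union>m::nat. cyl (Suc n) (nth l) (\<lambda>k. if k = n then r else - real m))"
          using r by (auto simp: cyl_def less_Suc_eq intro!: exI[of _ l] exI[of _ m])
      qed (auto simp: cyl_def)
      also have "\<dots> \<in> sets ?S"
        by (intro sets.countable_UN'' countableI_type cylS)
      finally show "{\<omega> \<in> space ?S. r < snd (\<omega> n)} \<in> sets ?S" .
    qed
    ultimately have "(\<lambda>\<omega>. (fst (\<omega> n), snd (\<omega> n))) \<in> measurable ?S (count_space UNIV \<Otimes>\<^sub>M borel)"
      by (rule measurable_Pair)
    then show "(\<lambda>\<omega>. \<omega> n) \<in> measurable ?S (count_space UNIV \<Otimes>\<^sub>M borel)"
      unfolding prod.collapse .
  qed
  then have "(\<lambda>\<omega>. \<omega>) -` A \<inter> space ?S \<in> sets ?S" if "A \<in> sets (seqM :: (nat \<Rightarrow> 'e \<times> real) measure)" for A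
    using that by (rule measurable_sets)
  then show "sets (seqM :: (nat \<Rightarrow> 'e \<times> real) measure) \<subseteq> sigma_sets UNIV ?E"
    by auto
qed

lemma measure_eqI_cyl:
  fixes \<mu> \<nu> :: "(nat \<Rightarrow> 'e::finite \<times> real) measure"
  assumes \<mu>: "sets \<mu> = sets seqM" "finite_measure \<mu>" and \<nu>: "sets \<nu> = sets seqM"
    and eq: "\<And>n z s. emeasure \<mu> (cyl n z s) = emeasure \<nu> (cyl n z s)"
  shows "\<mu> = \<nu>"
proof (rule measure_eqI_generator_eq_countable[OF Int_stable_cyl])
  show "range (\<lambda>e. cyl 0 (\<lambda>_. e) (\<lambda>_. 0)) \<subseteq> insert {} (range (\<lambda>(n, z, s). cyl n z s))"
    by (auto simp: image_iff)
  show "\<Union> (range (\<lambda>e. cyl 0 (\<lambda>_. e) (\<lambda>_. 0))) = UNIV"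
    by (auto simp: cyl_def)
  show "countable (range (\<lambda>e::'e. cyl 0 (\<lambda>_. e) (\<lambda>_. 0)))" by (rule countable_finite) simp
  show "emeasure \<mu> a \<noteq> \<infinity>" for a
    using finite_measure.emeasure_finite[OF \<mu>(2)] by simp
qed (use assms eq sets_seqM_eq_cyl in auto)

text \<open>Thresholds \<open>s k < 0\<close> are no constraint, since holding times are positive almost surely; they are
admitted because only cylinders with arbitrary real thresholds generate the whole sigma-algebra.\<close>

definition chain_weight :: "real^'e \<Rightarrow> real^'e^'e \<Rightarrow> nat \<Rightarrow> (nat \<Rightarrow> 'e::finite) \<Rightarrow> (nat \<Rightarrow> real) \<Rightarrow> real" where
  "chain_weight lam Q n z s = (\<Prod>k<n. exp (- (lam $ z k) * max 0 (s k)) * Q $ z k $ z (Suc k))"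

definition chain_law :: "real^'e \<Rightarrow> real^'e^'e \<Rightarrow> 'e::finite \<Rightarrow> (nat \<Rightarrow> 'e \<times> real) measure \<Rightarrow> bool" where
  "chain_law lam Q i \<mu> \<longleftrightarrow> prob_space \<mu> \<and> sets \<mu> = sets seqM \<and>
     (\<forall>n z s. measure \<mu> (cyl n z s) = (if z 0 = i then chain_weight lam Q n z s else 0))"

section \<open>Uniqueness of the chain law and positivity of the holding times\<close>

lemma chain_law_unique:
  assumes "chain_law lam Q i \<mu>" "chain_law lam Q i \<nu>"
  shows "\<mu> = \<nu>"
proof -
  interpret \<mu>: prob_space \<mu> using assms by (simp add: chain_law_def)
  interpret \<nu>: prob_space \<nu> using assms by (simp add: chain_law_def)
  show ?thesis
    by (rule measure_eqI_cyl)
      (use assms in \<open>auto simp: chain_law_def \<mu>.emeasure_eq_measure \<nu>.emeasure_eq_measure intro: \<mu>.finite_measure\<close>)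
qed

text \<open>Adding the threshold 0 for the next holding time and summing over the next phase does
  not change the probability of a cylinder, because the rows of \<open>Q\<close> sum to 1. Hence
  each holding time is almost surely positive once its predecessors are.\<close>

lemma cylinder_formula_pos:
  assumes \<mu>: "prob_space \<mu>" "sets \<mu> = sets seqM" and Q: "stochastic_matrix Q"
    and eq: "\<And>n z s. (\<And>k. k < n \<Longrightarrow> 0 \<le> s k) \<Longrightarrow>
      measure \<mu> (cyl n z s) = (if z 0 = i then chain_weight lam Q n z s else 0)"
  shows "AE \<omega> in \<mu>. \<forall>n. 0 < snd (\<omega> n)"
proof -
  interpret prob_space \<mu> by fact
  note [measurable_cong] = \<mu>(2)
  have sp[simp]: "space \<mu> = UNIV" using sets_eq_imp_space_eq[OF \<mu>(2)] by simp
  \<comment> \<open>Quantifying over lists of phases keeps the number of null sets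
    countable.\<close>
  have "AE \<omega> in \<mu>. \<forall>n. \<forall>l. \<omega> \<in> cyl n (nth l) (\<lambda>_. 0) \<longrightarrow> 0 < snd (\<omega> n)"
    unfolding AE_all_countable
  proof (intro allI)
    fix n and l :: "'a list"
    let ?z = "\<lambda>e. (nth l)(Suc n := e)"
    let ?C = "cyl n (nth l) (\<lambda>_. 0)" and ?B = "\<Union>e. cyl (Suc n) (?z e) (\<lambda>_. 0)"
    have meas: "?C \<in> sets \<mu>" "?B \<in> sets \<mu>" using \<mu>(2) by auto
    have "fst (\<omega> (Suc n)) = e" if "\<omega> \<in> cyl (Suc n) (?z e) (\<lambda>_. 0)" for \<omega> e
      using fst_cyl[OF that, of "Suc n"] by simp
    then have "disjoint_family (\<lambda>e. cyl (Suc n) (?z e) (\<lambda>_. 0))"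
      unfolding disjoint_family_on_def by blast
    then have "measure \<mu> ?B = (\<Sum>e\<in>UNIV. measure \<mu> (cyl (Suc n) (?z e) (\<lambda>_. 0)))"
      by (intro finite_measure_finite_Union) (simp_all add: \<mu>(2) image_subset_iff)
    also have "\<dots> = (\<Sum>e\<in>UNIV. measure \<mu> ?C * Q $ (l ! n) $ e)"
    proof (rule sum.cong[OF refl])
      fix e
      have "chain_weight lam Q n (?z e) (\<lambda>_. 0) = chain_weight lam Q n (nth l) (\<lambda>_. 0)"
        unfolding chain_weight_def by (intro prod.cong) auto
      then have "chain_weight lam Q (Suc n) (?z e) (\<lambda>_. 0) = chain_weight lam Q n (nth l) (\<lambda>_. 0) * Q $ (l ! n) $ e"
        by (simp add: chain_weight_def)
      then show "measure \<mu> (cyl (Suc n) (?z e) (\<lambda>_. 0)) = measure \<mu> ?C * Q $ (l ! n) $ e"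
        by (simp add: eq)
    qed
    also have "\<dots> = measure \<mu> ?C"
      using Q by (simp add: stochastic_matrix_def flip: sum_distrib_left)
    finally have m: "measure \<mu> ?B = measure \<mu> ?C" .
    have sub: "?B \<subseteq> ?C" "\<And>\<omega>. \<omega> \<in> ?B \<Longrightarrow> 0 < snd (\<omega> n)"
      by (auto simp: cyl_def less_Suc_eq)
    have "measure \<mu> (?C - ?B) = 0"
      using finite_measure_Diff[OF meas sub(1)] m by simp
    then have "?C - ?B \<in> null_sets \<mu>"
      using meas by (simp add: null_sets_def emeasure_eq_measure)
    from AE_not_in[OF this] show "AE \<omega> in \<mu>. \<omega> \<in> ?C \<longrightarrow> 0 < snd (\<omega> n)"
      by eventually_elim (use sub(2) in blast)
  qed
  then show ?thesis
  proof eventually_elim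
    case (elim \<omega>)
    show ?case
    proof
      \<comment> \<open>The cylinder of length \<open>n\<close> already demands positive earlier
        holding times, which strong induction supplies.\<close>
      fix n show "0 < snd (\<omega> n)"
      proof (induction n rule: less_induct)
        case (less n)
        let ?l = "map (\<lambda>k. fst (\<omega> k)) [0..<Suc n]"
        have l: "?l ! k = fst (\<omega> k)" if "k \<le> n" for k
          using that nth_map_upt[of k "Suc n" 0 "\<lambda>k. fst (\<omega> k)"] by (simp del: upt_Suc)
        then have "\<omega> \<in> cyl n (nth ?l) (\<lambda>_. 0)"
          using less.IH by (auto simp: cyl_def simp del: upt_Suc)
        then show ?case using elim by blast
      qed
    qed
  qed
qed

text \<open>Almost sure positivity allows each threshold \<open>s k\<close> to be replaced by
  \<open>max 0 (s k)\<close>, which extends the formula from nonnegative to arbitrary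
  thresholds.\<close>

lemma chain_lawI:
  assumes \<mu>: "prob_space \<mu>" "sets \<mu> = sets seqM" and Q: "stochastic_matrix Q"
    and eq: "\<And>n z s. (\<And>k. k < n \<Longrightarrow> 0 \<le> s k) \<Longrightarrow>
      measure \<mu> (cyl n z s) = (if z 0 = i then \<Prod>k<n. exp (- lam $ z k * s k) * Q $ z k $ z (Suc k) else 0)"
  shows "chain_law lam Q i \<mu>"
  unfolding chain_law_def
proof (intro conjI allI \<mu>)
  fix n z s
  interpret prob_space \<mu> by fact
  have eq': "measure \<mu> (cyl n z s) = (if z 0 = i then chain_weight lam Q n z s else 0)"
    if "\<And>k. k < n \<Longrightarrow> 0 \<le> s k" for n z s
    using that by (subst eq) (auto simp: chain_weight_def max_def intro!: prod.cong)
  have "AE \<omega> in \<mu>. \<forall>n. 0 < snd (\<omega> n)"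
    by (rule cylinder_formula_pos[OF \<mu> Q eq'])
  then have "AE \<omega> in \<mu>. \<omega> \<in> cyl n z s \<longleftrightarrow> \<omega> \<in> cyl n z (\<lambda>k. max 0 (s k))"
    by eventually_elim (auto simp: cyl_def)
  then have "measure \<mu> (cyl n z s) = measure \<mu> (cyl n z (\<lambda>k. max 0 (s k)))"
    using \<mu>(2) by (intro finite_measure_eq_AE) auto
  also have "\<dots> = (if z 0 = i then chain_weight lam Q n z s else 0)"
    by (subst eq') (auto simp: chain_weight_def max_def intro!: prod.cong)
  finally show "measure \<mu> (cyl n z s) = (if z 0 = i then chain_weight lam Q n z s else 0)" .
qed

lemma exponential_tail:
  assumes "0 < l"
  shows "emeasure (density lborel (exponential_density l)) {r<..} = ennreal (exp (- l * max 0 r))"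
proof -
  interpret E: prob_space "density lborel (exponential_density l)"
    by (rule prob_space_exponential_density[OF assms])
  have "distributed (density lborel (exponential_density l)) lborel (\<lambda>x. x) (exponential_density l)"
    by (auto simp: distributed_def distr_id2)
  note D = E.exponential_distributedD_gt[OF this _ assms]
  have pos: "emeasure (density lborel (exponential_density l)) {r<..} = ennreal (exp (- l * r))" if "0 \<le> r" for r
    using D[OF that] by (simp add: E.emeasure_eq_measure greaterThan_def mult.commute)
  show ?thesis
  proof (cases "0 \<le> r")
    case True then show ?thesis using pos by simp
  next
    case False
    then have "emeasure (density lborel (exponential_density l)) {0<..} \<le> emeasure (density lborel (exponential_density l)) {r<..}"
      by (intro emeasure_mono) auto
    with pos[of 0] False E.emeasure_le_1 show ?thesis by (auto intro: antisym)
  qed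
qed

section \<open>Conditioning on the first jump\<close>

locale phase_chain =
  fixes lam :: "real^'e::finite" and Q :: "real^'e^'e"
    and mu :: "'e \<Rightarrow> (nat \<Rightarrow> 'e \<times> real) measure"
  assumes lam_pos: "\<And>i. 0 < lam $ i"
    and Q_stoch: "stochastic_matrix Q"
    and law: "\<And>i. chain_law lam Q i (mu i)"
begin

lemma prob_mu: "prob_space (mu i)" and sets_mu [measurable_cong]: "sets (mu i) = sets seqM"
  and measure_cyl: "measure (mu i) (cyl n z s) = (if z 0 = i then chain_weight lam Q n z s else 0)"
  using law[of i] by (auto simp: chain_law_def)

lemma space_mu [simp]: "space (mu i) = UNIV"
  using sets_eq_imp_space_eq[OF sets_mu] by simp

lemma Q_nonneg: "0 \<le> Q $ i $ j" and Q_sum: "(\<Sum>j\<in>UNIV. Q $ i $ j) = 1"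
  using Q_stoch by (auto simp: stochastic_matrix_def)

lemma AE_mu_pos: "AE \<omega> in mu i. \<forall>n. 0 < snd (\<omega> n)"
  by (rule cylinder_formula_pos[OF prob_mu sets_mu Q_stoch measure_cyl])

lemma AE_mu_start: "AE \<omega> in mu i. fst (\<omega> 0) = i"
proof -
  interpret prob_space "mu i" by (rule prob_mu)
  have "measure (mu i) (cyl 0 (\<lambda>_. i) (\<lambda>_. 0)) = 1"
    by (simp add: measure_cyl chain_weight_def)
  then have "AE \<omega> in mu i. \<omega> \<in> cyl 0 (\<lambda>_. i) (\<lambda>_. 0)"
    by (subst (asm) prob_eq_1) (auto simp: sets_mu)
  then show ?thesis by (simp add: cyl_def)
qed

definition hold :: "'e \<Rightarrow> real measure" where
  "hold i = density lborel (exponential_density (lam $ i))"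

lemma sets_hold [measurable_cong, simp]: "sets (hold i) = sets borel"
  by (simp add: hold_def)

lemma prob_hold: "prob_space (hold i)"
  unfolding hold_def by (rule prob_space_exponential_density[OF lam_pos])

lemma AE_hold: "AE s in hold i. 0 < s"
proof -
  have "AE s in lborel. s \<noteq> (0::real)" by (rule AE_lborel_singleton)
  then show ?thesis
    unfolding hold_def by (subst AE_density) (auto simp: exponential_density_def)
qed

text \<open>The Markov property at the first jump, left unnormalised so that
  \<open>Q $ i $ k = 0\<close> needs no exception: restricted to the next phase \<open>k\<close>,
  the chain is an exponential holding time in \<open>i\<close> followed by an independent chain from
  \<open>k\<close>. Both sides factor in the same way on cylinders.\<close>

lemma density_first_jump:
  "density (mu i) (indicator {\<omega>. fst (\<omega> 1) = k})
    = density (distr (hold i \<Otimes>\<^sub>M mu k) seqM (\<lambda>(s, \<omega>). case_nat (i, s) \<omega>)) (\<lambda>_. ennreal (Q $ i $ k))"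
    (is "?L = ?R")
proof (rule measure_eqI_cyl)
  interpret I: prob_space "mu i" by (rule prob_mu)
  interpret K: prob_space "mu k" by (rule prob_mu)
  interpret H: prob_space "hold i" by (rule prob_hold)
  have mk: "{\<omega>. fst (\<omega> 1) = k} \<in> sets seqM"
    using measurable_sets[OF measurable_seqM_fst, of "{k}" 1] by (simp add: vimage_def)
  note [measurable] = mk
  show "sets ?L = sets seqM" by (simp add: sets_mu)
  show "sets ?R = sets seqM" by simp
  have emL: "emeasure ?L A = emeasure (mu i) (A \<inter> {\<omega>. fst (\<omega> 1) = k})" if "A \<in> sets seqM" for A
    using that mk by (subst emeasure_density)
      (auto simp: sets_mu nn_integral_indicator[symmetric] indicator_inter_arith mult.commute simp del: nn_integral_indicator intro!: nn_integral_cong)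
  show "finite_measure ?L"
    by (rule finite_measureI) (use emL[of UNIV] sets.top[of "seqM :: (nat \<Rightarrow> 'e \<times> real) measure"] I.emeasure_finite in \<open>auto simp: top_unique\<close>)
  fix n z s
  have jm: "(\<lambda>(s, \<omega>). case_nat (i, s) \<omega>) \<in> hold i \<Otimes>\<^sub>M mu k \<rightarrow>\<^sub>M seqM"
    using measurable_case_nat_seqM by (simp cong: measurable_cong_sets add: sets_mu)
  have emR: "emeasure ?R A = ennreal (Q $ i $ k) * emeasure (hold i \<Otimes>\<^sub>M mu k) ((\<lambda>(s, \<omega>). case_nat (i, s) \<omega>) -` A)"
    if "A \<in> sets seqM" for A
    using that by (subst emeasure_density, simp, simp, subst nn_integral_cmult_indicator, simp)
      (subst emeasure_distr[OF jm], auto simp: space_pair_measure hold_def)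
  have main: "emeasure ?L (cyl (Suc m) z s) = emeasure ?R (cyl (Suc m) z s)" for m z s
  proof -
    have v: "(\<lambda>(s, \<omega>). case_nat (i, s) \<omega>) -` (cyl (Suc m) z s)
        = (if z 0 = i then {s 0<..} \<times> cyl m (\<lambda>k. z (Suc k)) (\<lambda>k. s (Suc k)) else {})"
      by (auto simp: cyl_def All_less_Suc2)
    have L: "cyl (Suc m) z s \<inter> {\<omega>. fst (\<omega> 1) = k} = (if z 1 = k then cyl (Suc m) z s else {})"
      by (auto simp: cyl_def)
    have "measure (mu i) (cyl (Suc m) z s) = (if z 0 = i then exp (- lam $ i * max 0 (s 0)) *
       Q $ i $ z 1 * chain_weight lam Q m (\<lambda>k. z (Suc k)) (\<lambda>k. s (Suc k)) else 0)"
      by (simp add: measure_cyl chain_weight_def prod.lessThan_Suc_shift del: prod.lessThan_Suc)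
    then show ?thesis
      using Q_nonneg[of i k] lam_pos[of i]
      unfolding emL[OF sets_cyl] emR[OF sets_cyl] v L
      by (simp add: I.emeasure_eq_measure K.emeasure_pair_measure_Times sets_mu)
        (simp add: hold_def exponential_tail K.emeasure_eq_measure measure_cyl ennreal_mult'[symmetric] mult_ac)
  qed
  show "emeasure ?L (cyl n z s) = emeasure ?R (cyl n z s)"
  proof (cases n)
    case (Suc m) then show ?thesis using main by simp
  next
    case 0
    \<comment> \<open>A cylinder of length 0 does not see the second phase. Under the restriction it
      agrees almost surely with the cylinder of length 1 that ends in \<open>k\<close> and has
      threshold 0.\<close>
    let ?C = "\<lambda>e. cyl (Suc 0) (z(1 := e)) (\<lambda>_. 0)"
    let ?z = "z(1 := k)"
    have L: "emeasure ?L (cyl 0 z s) = emeasure ?L (?C k)"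
      unfolding emL[OF sets_cyl]
      by (rule emeasure_eq_AE) (use AE_mu_pos[of i] in eventually_elim, auto simp: cyl_def sets_mu)
    have "(\<lambda>(s, \<omega>). case_nat (i, s) \<omega>) -` (cyl 0 z s) = (if z 0 = i then UNIV \<times> UNIV else {})"
      by (auto simp: cyl_def)
    moreover have "emeasure (hold i \<Otimes>\<^sub>M mu k) (UNIV \<times> UNIV) = emeasure (hold i) UNIV * emeasure (mu k) UNIV"
      by (rule K.emeasure_pair_measure_Times) (auto simp: sets_mu, metis sets.top space_seqM)
    ultimately have "emeasure ?R (cyl 0 z s) = (if z 0 = i then ennreal (Q $ i $ k) else 0)"
      using H.emeasure_space_1 K.emeasure_space_1 unfolding emR[OF sets_cyl] by (simp add: hold_def)
    moreover have "emeasure ?L (?C k) = (if z 0 = i then ennreal (Q $ i $ k) else 0)"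
    proof -
      have "?C k \<inter> {\<omega>. fst (\<omega> 1) = k} = ?C k" by (auto simp: cyl_def)
      then show ?thesis unfolding emL[OF sets_cyl]
        by (simp add: I.emeasure_eq_measure measure_cyl chain_weight_def)
    qed
    ultimately show ?thesis using 0 L by simp
  qed
qed

text \<open>The bound is asked for only on paths with positive holding times; functionals such as
  \<open>xi\<close> are bounded there but need not be bounded on the whole sequence space.\<close>

lemma integrable_mu_bounded:
  fixes f :: "(nat \<Rightarrow> 'e \<times> real) \<Rightarrow> real"
  assumes "f \<in> borel_measurable seqM" "\<And>\<omega>. (\<And>n. 0 < snd (\<omega> n)) \<Longrightarrow> \<bar>f \<omega>\<bar> \<le> B"
  shows "integrable (mu i) f"
proof -
  interpret prob_space "mu i" by (rule prob_mu)
  have "AE \<omega> in mu i. norm (f \<omega>) \<le> B"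
    using AE_mu_pos[of i] by eventually_elim (use assms(2) in auto)
  then show ?thesis using assms(1) by (intro integrable_const_bound) (auto simp: sets_mu cong: measurable_cong_sets)
qed

lemma measurable_one_step [measurable]:
  fixes f :: "(nat \<Rightarrow> 'e \<times> real) \<Rightarrow> real"
  assumes [measurable]: "f \<in> borel_measurable seqM"
  shows "(\<lambda>s. \<integral>\<omega>. f (case_nat (i, s) \<omega>) \<partial>mu k) \<in> borel_measurable borel"
proof -
  interpret prob_space "mu k" by (rule prob_mu)
  have "(\<lambda>x. f (case x of (s, \<omega>) \<Rightarrow> case_nat (i, s) \<omega>)) \<in> borel_measurable (borel \<Otimes>\<^sub>M seqM)"
    by measurable
  then have "(\<lambda>x. f (case x of (s, \<omega>) \<Rightarrow> case_nat (i, s) \<omega>)) \<in> borel_measurable (borel \<Otimes>\<^sub>M mu k)"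
    by (simp cong: measurable_cong_sets add: sets_mu)
  then show ?thesis
    by (intro borel_measurable_lebesgue_integral) (simp add: split_def)
qed

text \<open>The expectation is split by the second phase, \<open>density_first_jump\<close> is
  applied to each part, and Fubini separates the holding time from the rest of the chain.\<close>

lemma one_step:
  fixes f :: "(nat \<Rightarrow> 'e \<times> real) \<Rightarrow> real"
  assumes f [measurable]: "f \<in> borel_measurable seqM"
    and B: "\<forall>\<omega>. (\<forall>n. 0 < snd (\<omega> n)) \<longrightarrow> \<bar>f \<omega>\<bar> \<le> B"
  shows "(\<integral>\<omega>. f \<omega> \<partial>mu i) = (\<integral>s. exponential_density (lam $ i) s *
           (\<Sum>k\<in>UNIV. Q $ i $ k * (\<integral>\<omega>. f (case_nat (i, s) \<omega>) \<partial>mu k)) \<partial>lborel)" (is "_ = ?R")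
    and "integrable lborel (\<lambda>s. exponential_density (lam $ i) s *
           (\<Sum>k\<in>UNIV. Q $ i $ k * (\<integral>\<omega>. f (case_nat (i, s) \<omega>) \<partial>mu k)))"
proof -
  have mk: "{\<omega>. fst (\<omega> 1) = k} \<in> sets (seqM :: (nat \<Rightarrow> 'e \<times> real) measure)" for k
    using measurable_sets[OF measurable_seqM_fst, of "{k}" 1] by (simp add: vimage_def)
  have fm: "f \<in> borel_measurable (mu i)" for i
    using f by (simp cong: measurable_cong_sets add: sets_mu)
  have fi: "integrable (mu i) f" by (rule integrable_mu_bounded[OF f]) (use B in blast)
  let ?ind = "\<lambda>k \<omega>. indicat_real {\<omega>. fst (\<omega> 1) = k} \<omega>"
  have jm: "(\<lambda>(s, \<omega>). case_nat (i, s) \<omega>) \<in> hold i \<Otimes>\<^sub>M mu k \<rightarrow>\<^sub>M seqM" for k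
    using measurable_case_nat_seqM by (simp cong: measurable_cong_sets add: sets_mu)
  have ip: "integrable (hold i \<Otimes>\<^sub>M mu k) (\<lambda>(s, \<omega>). f (case_nat (i, s) \<omega>))" for k
  proof -
    interpret K: prob_space "mu k" by (rule prob_mu)
    interpret H: prob_space "hold i" by (rule prob_hold)
    interpret HK: pair_prob_space "hold i" "mu k" ..
    have m: "(\<lambda>(s, \<omega>). f (case_nat (i, s) \<omega>)) \<in> borel_measurable (hold i \<Otimes>\<^sub>M mu k)"
      using measurable_compose[OF jm f] by (simp add: split_def)
    have "AE s in hold i. AE \<omega> in mu k. \<bar>f (case_nat (i, s) \<omega>)\<bar> \<le> B"
      using AE_hold[of i]
    proof eventually_elim
      case (elim s)
      from AE_mu_pos[of k] show ?case
      proof eventually_elim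
        case (elim \<omega>)
        show ?case by (rule B[rule_format]) (use elim \<open>0 < s\<close> in \<open>auto split: nat.split\<close>)
      qed
    qed
    then have "AE x in hold i \<Otimes>\<^sub>M mu k. norm (case x of (s, \<omega>) \<Rightarrow> f (case_nat (i, s) \<omega>)) \<le> B"
    proof (intro HK.AE_pair_measure)
      show "{x \<in> space (hold i \<Otimes>\<^sub>M mu k). norm (case x of (s, \<omega>) \<Rightarrow> f (case_nat (i, s) \<omega>)) \<le> B}
          \<in> sets (hold i \<Otimes>\<^sub>M mu k)"
        using m by (intro borel_measurable_le borel_measurable_norm) auto
    qed auto
    then show ?thesis using m by (rule HK.integrable_const_bound)
  qed
  have inner: "integrable (hold i) (\<lambda>s. \<integral>\<omega>. f (case_nat (i, s) \<omega>) \<partial>mu k)"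
    "(\<integral>s. (\<integral>\<omega>. f (case_nat (i, s) \<omega>) \<partial>mu k) \<partial>hold i) = (\<integral>x. f (case x of (s, \<omega>) \<Rightarrow> case_nat (i, s) \<omega>) \<partial>(hold i \<Otimes>\<^sub>M mu k))" for k
  proof -
    interpret K: prob_space "mu k" by (rule prob_mu)
    interpret H: prob_space "hold i" by (rule prob_hold)
    interpret HK: pair_prob_space "hold i" "mu k" ..
    show "integrable (hold i) (\<lambda>s. \<integral>\<omega>. f (case_nat (i, s) \<omega>) \<partial>mu k)"
      using HK.integrable_fst[OF ip[of k]] by simp
    show "(\<integral>s. (\<integral>\<omega>. f (case_nat (i, s) \<omega>) \<partial>mu k) \<partial>hold i) = (\<integral>x. f (case x of (s, \<omega>) \<Rightarrow> case_nat (i, s) \<omega>) \<partial>(hold i \<Otimes>\<^sub>M mu k))"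
      using HK.integral_fst[OF ip[of k]] by (simp add: split_def)
  qed
  have "(\<integral>\<omega>. f \<omega> \<partial>mu i) = (\<integral>\<omega>. (\<Sum>k\<in>UNIV. ?ind k \<omega> * f \<omega>) \<partial>mu i)"
  proof (rule Bochner_Integration.integral_cong[OF refl])
    fix \<omega> :: "nat \<Rightarrow> 'e \<times> real"
    have "(\<Sum>k\<in>UNIV. ?ind k \<omega> * f \<omega>) = (\<Sum>k\<in>UNIV. if fst (\<omega> 1) = k then f \<omega> else 0)"
      by (rule sum.cong) (auto simp: indicator_def)
    then show "f \<omega> = (\<Sum>k\<in>UNIV. ?ind k \<omega> * f \<omega>)" by simp
  qed
  also have "\<dots> = (\<Sum>k\<in>UNIV. \<integral>\<omega>. ?ind k \<omega> * f \<omega> \<partial>mu i)"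
    by (rule Bochner_Integration.integral_sum) (use fi mk in \<open>auto simp: sets_mu mult.commute[of "indicator _ _"] intro!: integrable_mult_indicator integrable_real_mult_indicator\<close>)
  also have "\<dots> = (\<Sum>k\<in>UNIV. Q $ i $ k * (\<integral>s. (\<integral>\<omega>. f (case_nat (i, s) \<omega>) \<partial>mu k) \<partial>hold i))"
  proof (rule sum.cong[OF refl])
    fix k
    have "(\<integral>\<omega>. ?ind k \<omega> * f \<omega> \<partial>mu i) = (\<integral>\<omega>. f \<omega> \<partial>density (mu i) (indicator {\<omega>. fst (\<omega> 1) = k}))"
      using mk[of k] fm by (subst integral_density[symmetric, where 'b = real, simplified]) (auto simp: sets_mu ennreal_indicator)
    also have "\<dots> = Q $ i $ k * (\<integral>\<omega>. f \<omega> \<partial>distr (hold i \<Otimes>\<^sub>M mu k) seqM (\<lambda>(s, \<omega>). case_nat (i, s) \<omega>))"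
      unfolding density_first_jump by (subst integral_density) (auto simp: Q_nonneg)
    also have "\<dots> = Q $ i $ k * (\<integral>s. (\<integral>\<omega>. f (case_nat (i, s) \<omega>) \<partial>mu k) \<partial>hold i)"
      unfolding inner by (subst integral_distr[OF jm f]) simp
    finally show "(\<integral>\<omega>. ?ind k \<omega> * f \<omega> \<partial>mu i) = Q $ i $ k * (\<integral>s. (\<integral>\<omega>. f (case_nat (i, s) \<omega>) \<partial>mu k) \<partial>hold i)" .
  qed
  also have "\<dots> = (\<integral>s. (\<Sum>k\<in>UNIV. Q $ i $ k * (\<integral>\<omega>. f (case_nat (i, s) \<omega>) \<partial>mu k)) \<partial>hold i)"
    using inner(1) by (subst Bochner_Integration.integral_sum) auto
  also have "\<dots> = ?R"
    unfolding hold_def using lam_pos[of i]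
    by (subst integral_density) (auto intro!: exponential_density_nonneg)
  finally show "(\<integral>\<omega>. f \<omega> \<partial>mu i) = ?R" .
  have "integrable (hold i) (\<lambda>s. \<Sum>k\<in>UNIV. Q $ i $ k * (\<integral>\<omega>. f (case_nat (i, s) \<omega>) \<partial>mu k))"
    using inner(1) by auto
  then show "integrable lborel (\<lambda>s. exponential_density (lam $ i) s *
           (\<Sum>k\<in>UNIV. Q $ i $ k * (\<integral>\<omega>. f (case_nat (i, s) \<omega>) \<partial>mu k)))"
    unfolding hold_def using lam_pos[of i]
    by (subst (asm) integrable_density) (auto intro!: exponential_density_nonneg)
qed

end

section \<open>Exponential holding times and non-explosion\<close>

lemma integrable_exponential_density:
  assumes "0 < l"
  shows "integrable lborel (exponential_density l)" "(\<integral>s. exponential_density l s \<partial>lborel) = 1"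
proof -
  interpret E: prob_space "density lborel (exponential_density l)"
    by (rule prob_space_exponential_density[OF assms])
  have "integrable (density lborel (exponential_density l)) (\<lambda>_. 1::real)" by simp
  then show "integrable lborel (exponential_density l)"
    by (subst (asm) integrable_density) (auto intro!: exponential_density_nonneg assms)
  have "(\<integral>s. 1 \<partial>density lborel (exponential_density l)) = (1::real)"
    using E.prob_space by simp
  then show "(\<integral>s. exponential_density l s \<partial>lborel) = 1"
    by (subst (asm) integral_density) (auto intro!: exponential_density_nonneg assms)
qed

lemma integral_exponential_tail:
  assumes "0 < l" "0 \<le> d"
  shows "(\<integral>s. indicator {d<..} s * exponential_density l s \<partial>lborel) = exp (- l * d)"
proof -
  have "(\<integral>s. indicator {d<..} s \<partial>density lborel (exponential_density l))
      = measure (density lborel (exponential_density l)) {d<..}"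
    by simp
  also have "\<dots> = exp (- l * d)"
    using exponential_tail[OF assms(1), of d] assms(2) by (simp add: measure_def)
  finally show ?thesis
    by (subst (asm) integral_density) (auto intro!: exponential_density_nonneg assms simp: mult.commute)
qed

definition jump_time :: "(nat \<Rightarrow> 'e::finite \<times> real) \<Rightarrow> nat \<Rightarrow> real" where
  "jump_time \<omega> n = (\<Sum>k<n. snd (\<omega> k))"

lemma jump_time_0 [simp]: "jump_time \<omega> 0 = 0"
  by (simp add: jump_time_def)

lemma jump_time_Suc: "jump_time \<omega> (Suc n) = jump_time \<omega> n + snd (\<omega> n)"
  by (simp add: jump_time_def)

lemma jump_time_shift: "jump_time (case_nat (i, s) \<omega>) (Suc n) = s + jump_time \<omega> n"
  by (simp add: jump_time_def sum.lessThan_Suc_shift del: sum.lessThan_Suc)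

lemma jump_time_nonneg: "(\<And>n. 0 < snd (\<omega> n)) \<Longrightarrow> 0 \<le> jump_time \<omega> n"
  unfolding jump_time_def by (intro sum_nonneg less_imp_le)

lemma measurable_jump_time [measurable]: "(\<lambda>\<omega>. jump_time \<omega> n) \<in> borel_measurable seqM"
  unfolding jump_time_def by measurable

context phase_chain
begin

text \<open>Each jump contributes a factor of at most \<rho> < 1 to the mean of
  \<open>exp (- jump_time \<omega> n)\<close>. By the argument of Markov's inequality, the
  probability that all jump times stay below \<open>m\<close> is at most
  \<open>exp (real m) * \<rho> ^ n\<close> for every \<open>n\<close>.\<close>

lemma AE_mu_unbounded: "AE \<omega> in mu i. \<forall>t. \<exists>n. t < jump_time \<omega> n"
proof -
  \<comment> \<open>\<open>lam $ i / (1 + lam $ i)\<close> is the Laplace transform at 1 of the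
    holding time in phase \<open>i\<close>.\<close>
  define \<rho> where "\<rho> = Max (range (\<lambda>i. lam $ i / (1 + lam $ i)))"
  have \<rho>: "lam $ i / (1 + lam $ i) \<le> \<rho>" for i
    unfolding \<rho>_def by (rule Max_ge) auto
  have "\<rho> \<in> range (\<lambda>i. lam $ i / (1 + lam $ i))"
    unfolding \<rho>_def by (rule Max_in) auto
  then have \<rho>1: "0 \<le> \<rho>" "\<rho> < 1" using lam_pos by (auto simp: less_imp_le add_pos_pos divide_simps)
  have Emean: "(\<integral>\<omega>. exp (- jump_time \<omega> n) \<partial>mu i) \<le> \<rho> ^ n" for n i
  proof (induction n arbitrary: i)
    case 0
    interpret prob_space "mu i" by (rule prob_mu)
    show ?case using prob_space by simp
  next
    case (Suc n)
    let ?l = "lam $ i"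
    have pos: "0 < ?l" "0 < 1 + ?l" using lam_pos[of i] by auto
    have m: "(\<lambda>\<omega>. exp (- jump_time \<omega> (Suc n))) \<in> borel_measurable (seqM :: (nat \<Rightarrow> 'e \<times> real) measure)" by measurable
    have b: "\<forall>\<omega> :: nat \<Rightarrow> 'e \<times> real. (\<forall>n. 0 < snd (\<omega> n)) \<longrightarrow> \<bar>exp (- jump_time \<omega> (Suc n))\<bar> \<le> 1"
      by (auto intro!: jump_time_nonneg)
    note os = one_step[where i = i, OF m b]
    have "(\<integral>\<omega>. exp (- jump_time \<omega> (Suc n)) \<partial>mu i)
        \<le> (\<integral>s. ?l / (1 + ?l) * \<rho> ^ n * exponential_density (1 + ?l) s \<partial>lborel)"
      unfolding os(1)
    proof (rule integral_mono[OF os(2)])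
      show "integrable lborel (\<lambda>s. ?l / (1 + ?l) * \<rho> ^ n * exponential_density (1 + ?l) s)"
        using integrable_exponential_density(1)[OF pos(2)] by simp
      fix s :: real
      have "(\<Sum>k\<in>UNIV. Q $ i $ k * (\<integral>\<omega>. exp (- jump_time (case_nat (i, s) \<omega>) (Suc n)) \<partial>mu k))
          = exp (- s) * (\<Sum>k\<in>UNIV. Q $ i $ k * (\<integral>\<omega>. exp (- jump_time \<omega> n) \<partial>mu k))"
        by (simp add: jump_time_shift exp_diff exp_minus sum_distrib_left divide_inverse mult_ac exp_add)
      also have "\<dots> \<le> exp (- s) * (\<Sum>k\<in>UNIV. Q $ i $ k * \<rho> ^ n)"
        by (intro mult_left_mono sum_mono Suc) (auto simp: Q_nonneg)
      also have "\<dots> = exp (- s) * \<rho> ^ n"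
        by (simp add: Q_sum flip: sum_distrib_right)
      finally have "exponential_density ?l s * (\<Sum>k\<in>UNIV. Q $ i $ k * (\<integral>\<omega>. exp (- jump_time (case_nat (i, s) \<omega>) (Suc n)) \<partial>mu k))
          \<le> exponential_density ?l s * (exp (- s) * \<rho> ^ n)"
        by (rule mult_left_mono) (rule exponential_density_nonneg[OF pos(1)])
      \<comment> \<open>Discounting the exponential density by \<open>exp (- s)\<close> raises its
        rate by 1, at the price of the factor \<open>?l / (1 + ?l)\<close>.\<close>
      also have "\<dots> = ?l / (1 + ?l) * \<rho> ^ n * exponential_density (1 + ?l) s"
      proof -
        have "exp (- s * (1 + ?l)) = exp (- s * ?l) * exp (- s)"
          by (simp add: exp_add[symmetric] algebra_simps)
        then have "exponential_density (1 + ?l) s = (1 + ?l) / ?l * (exponential_density ?l s * exp (- s))"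
          using pos by (simp add: exponential_density_def)
        then show ?thesis using pos by simp
      qed
      finally show "exponential_density ?l s * (\<Sum>k\<in>UNIV. Q $ i $ k * (\<integral>\<omega>. exp (- jump_time (case_nat (i, s) \<omega>) (Suc n)) \<partial>mu k))
         \<le> ?l / (1 + ?l) * \<rho> ^ n * exponential_density (1 + ?l) s" .
    qed
    also have "\<dots> = ?l / (1 + ?l) * \<rho> ^ n"
      using integrable_exponential_density(2)[OF pos(2)] by simp
    also have "\<dots> \<le> \<rho> ^ Suc n"
      using mult_right_mono[OF \<rho>[of i], of "\<rho> ^ n"] \<rho>1 by simp
    finally show ?case .
  qed
  interpret prob_space "mu i" by (rule prob_mu)
  have "AE \<omega> in mu i. \<forall>m::nat. \<exists>n. real m < jump_time \<omega> n"
    unfolding AE_all_countable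
  proof
    fix m :: nat
    let ?N = "{\<omega>. \<forall>n. jump_time \<omega> n \<le> real m}"
    have "{\<omega> \<in> space seqM. \<forall>n. jump_time \<omega> n \<le> real m} \<in> sets (seqM :: (nat \<Rightarrow> 'e \<times> real) measure)"
      by measurable
    then have N: "?N \<in> sets (mu i)" by (simp add: sets_mu)
    have "measure (mu i) ?N \<le> exp (real m) * \<rho> ^ n" for n
    proof -
      have int: "integrable (mu i) (\<lambda>\<omega>. exp (- jump_time \<omega> n))"
        by (rule integrable_mu_bounded[where B = 1]) (auto intro: jump_time_nonneg)
      have "measure (mu i) ?N = (\<integral>\<omega>. indicator ?N \<omega> \<partial>mu i)" using N by simp
      also have "\<dots> \<le> (\<integral>\<omega>. exp (real m) * exp (- jump_time \<omega> n) \<partial>mu i)"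
      proof (rule integral_mono)
        show "integrable (mu i) (indicat_real ?N)"
          using N by (intro integrable_real_indicator) (auto simp: emeasure_eq_measure)
        show "integrable (mu i) (\<lambda>\<omega>. exp (real m) * exp (- jump_time \<omega> n))" using int by simp
      qed (auto simp: indicator_def simp flip: exp_add)
      also have "\<dots> \<le> exp (real m) * \<rho> ^ n"
        using Emean[of i n] by simp
      finally show ?thesis .
    qed
    note le = this
    have "(\<lambda>n. exp (real m) * \<rho> ^ n) \<longlonglongrightarrow> exp (real m) * 0"
      using \<rho>1 by (intro tendsto_mult_left LIMSEQ_realpow_zero) auto
    from LIMSEQ_le_const[OF this, of "measure (mu i) ?N"] have "measure (mu i) ?N \<le> 0"
      using le by auto
    then have "?N \<in> null_sets (mu i)"
      using N by (simp add: null_sets_def emeasure_eq_measure measure_le_0_iff)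
    then have "AE \<omega> in mu i. \<omega> \<notin> ?N" by (rule AE_not_in)
    then show "AE \<omega> in mu i. \<exists>n. real m < jump_time \<omega> n"
      by eventually_elim (auto simp: not_le)
  qed
  then show ?thesis
    by eventually_elim (meson less_le_trans less_imp_le order_less_le_trans reals_Archimedean2 less_trans)
qed

end

section \<open>Drawup functionals of the jump chain\<close>

lemma measurable_vec_nth_compose [measurable (raw)]:
  assumes "z \<in> measurable M (count_space UNIV)"
  shows "(\<lambda>m. (A :: real ^ 'e::finite) $ z m) \<in> borel_measurable M"
  by (rule measurable_compose[OF assms]) simp

locale drawup_chain = phase_chain lam Q mu
  for lam :: "real^'e::finite" and Q :: "real^'e^'e" and mu +
  fixes c p :: "real^'e" and w a :: real
  assumes c_pos: "\<And>i. 0 < c $ i" and p_range: "\<And>i. 0 < p $ i \<and> p $ i < 1"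
    and w_pos: "0 < w" and a_pos: "0 < a"
begin

definition lev :: "real \<Rightarrow> (nat \<Rightarrow> 'e \<times> real) \<Rightarrow> nat \<Rightarrow> real" where
  "lev x \<omega> n = post_jump_level c p x (\<lambda>k. fst (\<omega> k)) (\<lambda>k. snd (\<omega> k)) n"

text \<open>Between jumps the level rises, so new minima can only be post-jump levels. Starting from
  \<open>v\<close> alone is correct when \<open>v \<le> x\<close>.\<close>

primrec rmin :: "real \<Rightarrow> real \<Rightarrow> (nat \<Rightarrow> 'e \<times> real) \<Rightarrow> nat \<Rightarrow> real" where
  "rmin x v \<omega> 0 = v"
| "rmin x v \<omega> (Suc n) = min (rmin x v \<omega> n) (lev x \<omega> (Suc n))"

text \<open>The time the drawup needs, from the \<open>n\<close>-th jump on, to reach \<open>a\<close> if no jump occurs.\<close>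

definition hit :: "real \<Rightarrow> real \<Rightarrow> (nat \<Rightarrow> 'e \<times> real) \<Rightarrow> nat \<Rightarrow> real" where
  "hit x v \<omega> n = c $ fst (\<omega> n) * (rmin x v \<omega> n + a - lev x \<omega> n)"

text \<open>\<open>exp (- w \<tau>\<^sub>a) 1{J(\<tau>\<^sub>a) = j}\<close> as a functional of the jump chain. A holding time equal to \<open>hit\<close> does
not count: the process jumps down at the very moment at which it would reach the threshold.\<close>

definition xi :: "'e \<Rightarrow> real \<Rightarrow> real \<Rightarrow> (nat \<Rightarrow> 'e \<times> real) \<Rightarrow> real" where
  "xi j x v \<omega> = (if \<exists>n. hit x v \<omega> n < snd (\<omega> n) then
     (let n = LEAST n. hit x v \<omega> n < snd (\<omega> n)
      in exp (- w * (jump_time \<omega> n + hit x v \<omega> n)) * of_bool (fst (\<omega> n) = j)) else 0)"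

definition G :: "'e \<Rightarrow> 'e \<Rightarrow> real \<Rightarrow> real \<Rightarrow> real" where
  "G j i x v = (\<integral>\<omega>. xi j x v \<omega> \<partial>mu i)"

lemma lev_0 [simp]: "lev x \<omega> 0 = x"
  by (simp add: lev_def)

lemma lev_Suc: "lev x \<omega> (Suc n) = p $ fst (\<omega> n) * (lev x \<omega> n + snd (\<omega> n) / c $ fst (\<omega> n))"
  by (simp add: lev_def)

lemma lev_shift: "lev x (case_nat (i, s) \<omega>) (Suc n) = lev (p $ i * (x + s / c $ i)) \<omega> n"
  by (induction n) (simp_all add: lev_Suc)

lemma rmin_shift: "rmin x v (case_nat (i, s) \<omega>) (Suc n)
    = rmin (p $ i * (x + s / c $ i)) (min v (p $ i * (x + s / c $ i))) \<omega> n"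
proof (induction n)
  case 0 then show ?case by (simp add: lev_Suc)
next
  case (Suc n)
  then show ?case unfolding rmin.simps(2)[of _ _ _ "Suc n"] rmin.simps(2)[of _ _ _ n] lev_shift by (simp add: lev_shift)
qed

lemma hit_0: "hit x v (case_nat (i, s) \<omega>) 0 = c $ i * (v + a - x)"
  by (simp add: hit_def)

lemma hit_shift: "hit x v (case_nat (i, s) \<omega>) (Suc n)
    = hit (p $ i * (x + s / c $ i)) (min v (p $ i * (x + s / c $ i))) \<omega> n"
  unfolding hit_def rmin_shift lev_shift by simp

text \<open>The first hit is at index 0 or at the successor of the first hit of the shifted chain,
  whose discount is then multiplied by \<open>exp (- w * s)\<close>. The strict comparison sends the
  case of equality to the second branch.\<close>

lemma xi_shift: "xi j x v (case_nat (i, s) \<omega>) =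
    (if c $ i * (v + a - x) < s then exp (- w * (c $ i * (v + a - x))) * of_bool (i = j)
     else exp (- w * s) * xi j (p $ i * (x + s / c $ i)) (min v (p $ i * (x + s / c $ i))) \<omega>)"
proof -
  define x' where "x' = p $ i * (x + s / c $ i)"
  define v' where "v' = min v x'"
  let ?\<omega> = "case_nat (i, s) \<omega>"
  let ?P = "\<lambda>n. hit x v ?\<omega> n < snd (?\<omega> n)"
  have P0: "?P 0 \<longleftrightarrow> c $ i * (v + a - x) < s" by (simp add: hit_0)
  have PS: "?P (Suc n) \<longleftrightarrow> hit x' v' \<omega> n < snd (\<omega> n)" for n
    by (simp add: hit_shift x'_def v'_def)
  show ?thesis
  proof (cases "?P 0")
    case True
    then have ex: "\<exists>n. ?P n" and L: "(LEAST n. ?P n) = 0" by (blast, intro Least_eq_0)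
    have "xi j x v ?\<omega> = exp (- w * (jump_time ?\<omega> 0 + hit x v ?\<omega> 0)) * of_bool (fst (?\<omega> 0) = j)"
      unfolding xi_def Let_def L using ex by (subst if_P) auto
    with True show ?thesis using P0 by (simp add: hit_0)
  next
    case False
    show ?thesis
    proof (cases "\<exists>n. hit x' v' \<omega> n < snd (\<omega> n)")
      case True
      then obtain n where "?P (Suc n)" using PS by blast
      then have L: "(LEAST n. ?P n) = Suc (LEAST n. hit x' v' \<omega> n < snd (\<omega> n))"
        using Least_Suc[of ?P "Suc n", OF _ False] by (simp only: PS)
      have ex: "\<exists>n. ?P n" using \<open>?P (Suc n)\<close> by blast
      let ?n = "LEAST n. hit x' v' \<omega> n < snd (\<omega> n)"
      have "xi j x v ?\<omega> = exp (- w * (jump_time ?\<omega> (Suc ?n) + hit x v ?\<omega> (Suc ?n))) * of_bool (fst (?\<omega> (Suc ?n)) = j)"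
        unfolding xi_def Let_def L using ex by (subst if_P) auto
      also have "\<dots> = exp (- w * s) * xi j x' v' \<omega>"
        unfolding xi_def Let_def jump_time_shift hit_shift x'_def[symmetric] v'_def[symmetric]
        using True by (simp add: exp_add[symmetric] algebra_simps)
      finally show ?thesis using False P0 by (simp add: x'_def v'_def)
    next
      case F: False
      then have nex: "\<not> (\<exists>n. ?P n)" using False PS by (metis not0_implies_Suc)
      have "xi j x v ?\<omega> = 0" unfolding xi_def using nex by (subst if_not_P) auto
      moreover have "xi j x' v' \<omega> = 0" unfolding xi_def using F by (subst if_not_P) auto
      ultimately show ?thesis using False P0 by (simp add: x'_def v'_def)
    qed
  qed
qed

lemma measurable_lev [measurable (raw)]:
  assumes [measurable]: "x \<in> borel_measurable M" "h \<in> measurable M seqM"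
  shows "(\<lambda>m. lev (x m) (h m) n) \<in> borel_measurable M"
proof (induction n)
  case (Suc n)
  note [measurable] = Suc measurable_compose[OF assms(2) measurable_seqM_fst] measurable_compose[OF assms(2) measurable_seqM_snd]
  show ?case unfolding lev_Suc by measurable
qed simp

lemma measurable_rmin [measurable (raw)]:
  assumes [measurable]: "x \<in> borel_measurable M" "v \<in> borel_measurable M" "h \<in> measurable M seqM"
  shows "(\<lambda>m. rmin (x m) (v m) (h m) n) \<in> borel_measurable M"
  by (induction n) simp_all

lemma measurable_hit [measurable (raw)]:
  assumes [measurable]: "x \<in> borel_measurable M" "v \<in> borel_measurable M" "h \<in> measurable M seqM"
  shows "(\<lambda>m. hit (x m) (v m) (h m) n) \<in> borel_measurable M"
proof -
  note [measurable] = measurable_compose[OF assms(3) measurable_seqM_fst]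
  show ?thesis unfolding hit_def by measurable
qed

lemma measurable_xi [measurable (raw)]:
  assumes [measurable]: "x \<in> borel_measurable M" "v \<in> borel_measurable M" "h \<in> measurable M seqM"
  shows "(\<lambda>m. xi j (x m) (v m) (h m)) \<in> borel_measurable M"
proof -
  note [measurable] = measurable_compose[OF assms(3) measurable_seqM_fst]
    measurable_compose[OF assms(3) measurable_seqM_snd]
    measurable_compose[OF assms(3) measurable_jump_time]
  have L: "(\<lambda>m. LEAST n. hit (x m) (v m) (h m) n < snd (h m n)) \<in> measurable M (count_space UNIV)"
    by measurable
  let ?f = "\<lambda>n m. exp (- w * (jump_time (h m) n + hit (x m) (v m) (h m) n)) * of_bool (fst (h m n) = j)"
  have "?f n \<in> borel_measurable M" for n
    by measurable
  from measurable_compose_countable[where f = ?f, OF this L] 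
  have [measurable]: "(\<lambda>m. let n = LEAST n. hit (x m) (v m) (h m) n < snd (h m n)
      in exp (- w * (jump_time (h m) n + hit (x m) (v m) (h m) n)) * of_bool (fst (h m n) = j)) \<in> borel_measurable M"
    unfolding Let_def .
  show ?thesis unfolding xi_def by measurable
qed

text \<open>Joint measurability is what allows \<open>G\<close> to be evaluated at a random level
  and a random running minimum.\<close>

lemma measurable_G [measurable (raw)]:
  assumes [measurable]: "x \<in> borel_measurable M" "v \<in> borel_measurable M"
  shows "(\<lambda>m. G j i (x m) (v m)) \<in> borel_measurable M"
proof -
  interpret prob_space "mu i" by (rule prob_mu)
  have "(\<lambda>(m, \<omega>). xi j (x m) (v m) \<omega>) \<in> borel_measurable (M \<Otimes>\<^sub>M seqM)"
    unfolding split_def by measurable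
  then have "(\<lambda>(m, \<omega>). xi j (x m) (v m) \<omega>) \<in> borel_measurable (M \<Otimes>\<^sub>M mu i)"
    by (simp cong: measurable_cong_sets add: sets_mu)
  then show ?thesis unfolding G_def by (rule borel_measurable_lebesgue_integral)
qed

lemma lev_pos: "0 < x \<Longrightarrow> (\<And>n. 0 < snd (\<omega> n)) \<Longrightarrow> 0 < lev x \<omega> n"
  by (induction n) (auto simp: lev_Suc p_range c_pos intro!: mult_pos_pos add_pos_pos divide_pos_pos)

lemma jump_le: "0 \<le> y \<Longrightarrow> p $ i * y \<le> y"
  using p_range[of i] by (simp add: mult_left_le_one_le)

text \<open>As long as no holding time exceeds its \<open>hit\<close>, the level just before a jump
  is at most the minimum plus \<open>a\<close>, and the jump lowers it. If the jump sets a new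
  minimum, positivity of \<open>a\<close> suffices.\<close>

lemma lev_le_rmin_add:
  assumes x: "0 < x" "x \<le> v + a" and pos: "\<And>n. 0 < snd (\<omega> n)"
    and le: "\<And>k. k < n \<Longrightarrow> snd (\<omega> k) \<le> hit x v \<omega> k"
  shows "lev x \<omega> n \<le> rmin x v \<omega> n + a"
  using le
proof (induction n)
  case 0 then show ?case using x by simp
next
  case (Suc n)
  let ?y = "lev x \<omega> n + snd (\<omega> n) / c $ fst (\<omega> n)"
  have "snd (\<omega> n) / c $ fst (\<omega> n) \<le> rmin x v \<omega> n + a - lev x \<omega> n"
    using Suc.prems[of n] c_pos[of "fst (\<omega> n)"] by (simp add: hit_def field_simps)
  moreover have "0 \<le> ?y"
    using lev_pos[where n = n and \<omega> = \<omega>, OF x(1) pos] pos[of n] c_pos[of "fst (\<omega> n)"] by (simp add: add_nonneg_nonneg less_imp_le)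
  ultimately have "lev x \<omega> (Suc n) \<le> rmin x v \<omega> n + a"
    using jump_le[of ?y "fst (\<omega> n)"] unfolding lev_Suc by linarith
  then show ?case using a_pos by (simp add: min_def)
qed

text \<open>The discount exponent is nonpositive at the first hit: jump times are sums of positive
  holding times, and \<open>hit\<close> is nonnegative there by
  \<open>lev_le_rmin_add\<close>.\<close>

lemma xi_bounds:
  assumes x: "0 < x" "x \<le> v + a" and pos: "\<And>n. 0 < snd (\<omega> n)"
  shows "0 \<le> xi j x v \<omega>" "xi j x v \<omega> \<le> 1"
proof -
  show "0 \<le> xi j x v \<omega>" by (simp add: xi_def Let_def)
  show "xi j x v \<omega> \<le> 1"
  proof (cases "\<exists>n. hit x v \<omega> n < snd (\<omega> n)")
    case True
    define n where "n = (LEAST n. hit x v \<omega> n < snd (\<omega> n))"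
    have "snd (\<omega> k) \<le> hit x v \<omega> k" if "k < n" for k
      using not_less_Least[of k "\<lambda>n. hit x v \<omega> n < snd (\<omega> n)"] that by (auto simp: n_def)
    then have "lev x \<omega> n \<le> rmin x v \<omega> n + a" by (rule lev_le_rmin_add[OF x pos])
    then have "0 \<le> hit x v \<omega> n" using c_pos[of "fst (\<omega> n)"] by (simp add: hit_def less_imp_le)
    then have "0 \<le> w * (jump_time \<omega> n + hit x v \<omega> n)"
      using w_pos jump_time_nonneg[OF pos] by simp
    then show ?thesis using True by (simp add: xi_def Let_def flip: n_def)
  qed (simp add: xi_def)
qed

lemma integrable_xi:
  assumes x: "0 < x" "x \<le> v + a"
  shows "integrable (mu i) (xi j x v)"
  by (rule integrable_mu_bounded[where B = 1]) (use xi_bounds[OF x] in \<open>auto simp: abs_le_iff intro: order_trans\<close>)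

lemma G_bounds:
  assumes x: "0 < x" "x \<le> v + a"
  shows "0 \<le> G j i x v" "G j i x v \<le> 1"
proof -
  interpret prob_space "mu i" by (rule prob_mu)
  have *: "AE \<omega> in mu i. 0 \<le> xi j x v \<omega> \<and> xi j x v \<omega> \<le> 1"
    using AE_mu_pos[of i] by eventually_elim (use xi_bounds[OF x] in blast)
  then show "0 \<le> G j i x v" unfolding G_def by (intro integral_nonneg_AE) auto
  show "G j i x v \<le> 1" unfolding G_def
    using * by (intro integral_le_const integrable_xi x) auto
qed

text \<open>\<open>d\<close> is the time needed to reach the threshold without a jump. A longer
  first holding time gives the boundary term; otherwise the discount \<open>exp (- w * s)\<close> is
  absorbed into the exponential density under the integral.\<close>

lemma G_equation:
  fixes i :: 'e
  assumes x: "0 < x" "x \<le> v + a"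
  defines "d \<equiv> c $ i * (v + a - x)" and "y \<equiv> \<lambda>s. p $ i * (x + s / c $ i)"
  shows "integrable lborel (\<lambda>s. indicator {0..d} s * (lam $ i * exp (- (w + lam $ i) * s) *
      (\<Sum>k\<in>UNIV. Q $ i $ k * G j k (y s) (min v (y s)))))" (is "integrable _ ?B")
    and "G j i x v = exp (- (w + lam $ i) * d) * of_bool (i = j) +
      (\<integral>s. indicator {0..d} s * (lam $ i * exp (- (w + lam $ i) * s) *
        (\<Sum>k\<in>UNIV. Q $ i $ k * G j k (y s) (min v (y s)))) \<partial>lborel)"
proof -
  have d: "0 \<le> d" unfolding d_def using c_pos[of i] x by simp
  have b: "\<forall>\<omega>. (\<forall>n. 0 < snd (\<omega> n)) \<longrightarrow> \<bar>xi j x v \<omega>\<bar> \<le> 1"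
    using xi_bounds[OF x] by simp
  have m: "xi j x v \<in> borel_measurable seqM" by simp
  note os = one_step[where i = i, OF m b]
  let ?A = "\<lambda>s. indicator {d<..} s * exponential_density (lam $ i) s * (exp (- w * d) * of_bool (i = j))"
  have eq: "exponential_density (lam $ i) s * (\<Sum>k\<in>UNIV. Q $ i $ k * (\<integral>\<omega>. xi j x v (case_nat (i, s) \<omega>) \<partial>mu k))
     = ?A s + ?B s" for s
  proof -
    have K: "(\<integral>\<omega>. xi j x v (case_nat (i, s) \<omega>) \<partial>mu k)
       = (if d < s then exp (- w * d) * of_bool (i = j) else exp (- w * s) * G j k (y s) (min v (y s)))" for k
    proof -
      interpret prob_space "mu k" by (rule prob_mu)
      show ?thesis unfolding xi_shift d_def[symmetric] using prob_space by (simp add: G_def y_def)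
    qed
    have "(\<Sum>k\<in>UNIV. Q $ i $ k * (\<integral>\<omega>. xi j x v (case_nat (i, s) \<omega>) \<partial>mu k))
       = (if d < s then exp (- w * d) * of_bool (i = j) else exp (- w * s) * (\<Sum>k\<in>UNIV. Q $ i $ k * G j k (y s) (min v (y s))))"
    proof (cases "d < s")
      case True
      then show ?thesis unfolding K by (simp add: Q_sum flip: sum_distrib_right)
    next
      case False
      then show ?thesis unfolding K by (simp add: sum_distrib_left mult_ac)
    qed
    then show ?thesis using d
      by (simp add: indicator_def exponential_density_def exp_add[symmetric] algebra_simps)
  qed
  have intA: "integrable lborel ?A"
    using integrable_exponential_density(1)[OF lam_pos[of i]]
    by (intro integrable_mult_left integrable_real_mult_indicator) (auto simp: mult.commute[of "indicator _ _"] intro!: integrable_real_mult_indicator)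
  \<comment> \<open>The second part inherits integrability from the whole integrand by
    subtraction.\<close>
  have "integrable lborel (\<lambda>s. (?A s + ?B s) - ?A s)"
    by (rule Bochner_Integration.integrable_diff[OF os(2)[unfolded eq] intA])
  then show intB: "integrable lborel ?B" by simp
  have "G j i x v = (\<integral>s. ?A s + ?B s \<partial>lborel)"
    unfolding G_def[of j i x v] os(1) eq ..
  also have "\<dots> = (\<integral>s. ?A s \<partial>lborel) + (\<integral>s. ?B s \<partial>lborel)"
    by (rule Bochner_Integration.integral_add[OF intA intB])
  also have "(\<integral>s. ?A s \<partial>lborel) = exp (- (w + lam $ i) * d) * of_bool (i = j)"
    unfolding integral_mult_left_zero integral_exponential_tail[OF lam_pos d]
    by (simp add: exp_add[symmetric] algebra_simps)
  finally show "G j i x v = exp (- (w + lam $ i) * d) * of_bool (i = j) + (\<integral>s. ?B s \<partial>lborel)" .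
qed

text \<open>\<open>survive n x v t \<omega>\<close>: at time \<open>t\<close> exactly \<open>n\<close> jumps have occurred and the drawup has not yet reached \<open>a\<close>.\<close>

definition survive :: "nat \<Rightarrow> real \<Rightarrow> real \<Rightarrow> real \<Rightarrow> (nat \<Rightarrow> 'e \<times> real) \<Rightarrow> bool" where
  "survive n x v t \<omega> \<longleftrightarrow> jump_time \<omega> n \<le> t \<and> t < jump_time \<omega> (Suc n) \<and>
     (\<forall>k<n. snd (\<omega> k) \<le> hit x v \<omega> k) \<and> t - jump_time \<omega> n < hit x v \<omega> n"

definition Gstate :: "'e \<Rightarrow> nat \<Rightarrow> real \<Rightarrow> real \<Rightarrow> real \<Rightarrow> (nat \<Rightarrow> 'e \<times> real) \<Rightarrow> real" where
  "Gstate j n x v t \<omega> = exp (- w * t) *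
     G j (fst (\<omega> n)) (lev x \<omega> n + (t - jump_time \<omega> n) / c $ fst (\<omega> n)) (rmin x v \<omega> n)"

text \<open>The error of the candidate conditional expectation \<open>Gstate\<close> on the event of
  \<open>n\<close> jumps. The martingale property will follow once its integral over every past
  event vanishes.\<close>

definition gap :: "'e \<Rightarrow> nat \<Rightarrow> real \<Rightarrow> real \<Rightarrow> real \<Rightarrow> (nat \<Rightarrow> 'e \<times> real) \<Rightarrow> real" where
  "gap j n x v t \<omega> = (if survive n x v t \<omega> then xi j x v \<omega> - Gstate j n x v t \<omega> else 0)"

text \<open>The past up to the \<open>n\<close>-th jump contains the \<open>n\<close>-th phase, but not the \<open>n\<close>-th holding time.\<close>

definition history :: "nat \<Rightarrow> (nat \<Rightarrow> 'e \<times> real) set \<Rightarrow> bool" where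
  "history n B \<longleftrightarrow> B \<in> sets seqM \<and>
     (\<forall>\<omega> \<omega>'. fst (\<omega> n) = fst (\<omega>' n) \<longrightarrow> (\<forall>k<n. \<omega> k = \<omega>' k) \<longrightarrow> \<omega> \<in> B \<longleftrightarrow> \<omega>' \<in> B)"

lemma measurable_Gstate [measurable]: "Gstate j n x v t \<in> borel_measurable seqM"
proof -
  have "(\<lambda>\<omega>. G j e (lev x \<omega> n + (t - jump_time \<omega> n) / c $ fst (\<omega> n)) (rmin x v \<omega> n)) \<in> borel_measurable seqM" for e
    by measurable
  then have "(\<lambda>\<omega>. G j (fst (\<omega> n)) (lev x \<omega> n + (t - jump_time \<omega> n) / c $ fst (\<omega> n)) (rmin x v \<omega> n)) \<in> borel_measurable seqM"
    by (rule measurable_compose_countable[OF _ measurable_seqM_fst])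
  then show ?thesis unfolding Gstate_def[abs_def] by measurable
qed

lemma measurable_survive [measurable]: "Measurable.pred seqM (survive n x v t)"
proof -
  have h: "(\<lambda>\<omega>. hit x v \<omega> k) \<in> borel_measurable seqM" for k
    by (rule measurable_hit) auto
  have "Measurable.pred seqM (\<lambda>\<omega>. snd (\<omega> k) \<le> hit x v \<omega> k)" for k
    unfolding pred_def by (rule borel_measurable_le[OF measurable_seqM_snd h])
  then have "Measurable.pred seqM (\<lambda>\<omega>. \<forall>k\<in>{..<n}. snd (\<omega> k) \<le> hit x v \<omega> k)"
    by (intro pred_intros_finite) auto
  moreover have "Measurable.pred seqM (\<lambda>\<omega>. jump_time \<omega> n \<le> t)" by measurable
  moreover have "Measurable.pred seqM (\<lambda>\<omega>. t < jump_time \<omega> (Suc n))" by measurable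
  moreover have "Measurable.pred seqM (\<lambda>\<omega>. t - jump_time \<omega> n < hit x v \<omega> n)" by measurable
  ultimately show ?thesis
    unfolding survive_def[abs_def] Ball_def lessThan_iff by (intro pred_intros_logic)
qed

lemma measurable_gap [measurable]: "gap j n x v t \<in> borel_measurable seqM"
  unfolding gap_def[abs_def] by measurable

lemma survive_shift: "survive (Suc n) x v t (case_nat (i, s) \<omega>) \<longleftrightarrow> s \<le> c $ i * (v + a - x) \<and>
    survive n (p $ i * (x + s / c $ i)) (min v (p $ i * (x + s / c $ i))) (t - s) \<omega>"
  unfolding survive_def jump_time_shift hit_shift All_less_Suc2 hit_0 by auto

text \<open>After the first jump both terms of the gap carry the factor
  \<open>exp (- w * s)\<close>, which gives the recursion that removes one jump.\<close>

lemma gap_shift: "gap j (Suc n) x v t (case_nat (i, s) \<omega>) = (if s \<le> c $ i * (v + a - x) then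
    exp (- w * s) * gap j n (p $ i * (x + s / c $ i)) (min v (p $ i * (x + s / c $ i))) (t - s) \<omega> else 0)"
proof -
  have "exp (- w * t) = exp (- w * s) * exp (- w * (t - s))"
    by (simp add: exp_add[symmetric] algebra_simps)
  then show ?thesis
    unfolding gap_def survive_shift Gstate_def xi_shift lev_shift rmin_shift jump_time_shift
    by (auto simp: algebra_simps)
qed

text \<open>Places the current state in the range where \<open>G\<close> is known to lie between 0
  and 1.\<close>

lemma survive_state:
  assumes x: "0 < x" "x \<le> v + a" and pos: "\<And>n. 0 < snd (\<omega> n)" and s: "survive n x v t \<omega>"
  defines "y \<equiv> lev x \<omega> n + (t - jump_time \<omega> n) / c $ fst (\<omega> n)"
  shows "0 < y" "lev x \<omega> n \<le> y" "y < rmin x v \<omega> n + a"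
proof -
  have "0 \<le> (t - jump_time \<omega> n) / c $ fst (\<omega> n)"
    using s c_pos[of "fst (\<omega> n)"] by (simp add: survive_def)
  then show "lev x \<omega> n \<le> y" "0 < y"
    using lev_pos[where n = n and \<omega> = \<omega>, OF x(1) pos] by (simp_all add: y_def)
  have "t - jump_time \<omega> n < hit x v \<omega> n" using s by (simp add: survive_def)
  then have "(t - jump_time \<omega> n) / c $ fst (\<omega> n) < rmin x v \<omega> n + a - lev x \<omega> n"
    using c_pos[of "fst (\<omega> n)"] by (simp add: hit_def pos_divide_less_eq mult.commute)
  then show "y < rmin x v \<omega> n + a" by (simp add: y_def)
qed

lemma gap_bound:
  assumes x: "0 < x" "x \<le> v + a" and pos: "\<And>n. 0 < snd (\<omega> n)"
  shows "\<bar>gap j n x v t \<omega>\<bar> \<le> 1"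
proof (cases "survive n x v t \<omega>")
  case True
  have "0 \<le> t" using True jump_time_nonneg[OF pos] unfolding survive_def by (meson order_trans)
  then have "exp (- w * t) \<le> 1" using w_pos by simp
  moreover note st = survive_state[OF x pos True]
  ultimately have "Gstate j n x v t \<omega> \<le> 1" "0 \<le> Gstate j n x v t \<omega>"
    using G_bounds[of _ _ j "fst (\<omega> n)", OF st(1) less_imp_le[OF st(3)]]
    by (simp_all add: Gstate_def mult_le_one)
  with xi_bounds[where \<omega> = \<omega> and j = j, OF x pos] True show ?thesis by (simp add: gap_def)
qed (simp add: gap_def)

text \<open>Given that the first holding time exceeds \<open>t\<close>, its excess is again
  exponential, and the process continues from level \<open>x + t / c $ i\<close> with the same
  minimum.\<close>

lemma gap_0_integral:
  assumes x: "0 < x" "x \<le> v + a"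
  shows "(\<integral>\<omega>. gap j 0 x v t \<omega> \<partial>mu i) = 0"
proof (cases "0 \<le> t \<and> t < c $ i * (v + a - x)")
  case False
  \<comment> \<open>Outside this range, survival without a jump is impossible for a path that starts
    in phase \<open>i\<close>.\<close>
  have "AE \<omega> in mu i. gap j 0 x v t \<omega> = 0"
    using AE_mu_start[of i] by eventually_elim (use False in \<open>auto simp: gap_def survive_def hit_def\<close>)
  then show ?thesis by (simp cong: integral_cong_AE add: integral_eq_zero_AE)
next
  case True
  define d where "d = c $ i * (v + a - x)"
  define x' where "x' = x + t / c $ i"
  have t: "0 \<le> t" "t < d" using True by (auto simp: d_def)
  have tc: "0 \<le> t / c $ i" "t / c $ i < v + a - x"
    using t c_pos[of i] by (simp_all add: d_def pos_divide_less_eq mult.commute)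
  have x': "0 < x'" "x' \<le> v + a" using x tc by (auto simp: x'_def)
  \<comment> \<open>Using up \<open>t\<close> of the first holding time shortens the way to the
    threshold by the same \<open>t\<close> and leaves the next post-jump level unchanged; only the
    discount \<open>exp (- w * t)\<close> remains.\<close>
  have xi_eq: "xi j x v (case_nat (i, s) \<omega>) = exp (- w * t) * xi j x' v (case_nat (i, s - t) \<omega>)" for s \<omega>
  proof -
    have h: "c $ i * (v + a - x') = d - t"
      using c_pos[of i] by (simp add: d_def x'_def algebra_simps)
    have l: "x' + (s - t) / c $ i = x + s / c $ i" by (simp add: x'_def diff_divide_distrib)
    show ?thesis unfolding xi_shift h l d_def[symmetric]
      by (auto simp: exp_add[symmetric] algebra_simps)
  qed
  have gap_eq: "gap j 0 x v t (case_nat (i, s) \<omega>) = indicator {t<..} s *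
      (exp (- w * t) * xi j x' v (case_nat (i, s - t) \<omega>) - exp (- w * t) * G j i x' v)" for s \<omega>
    using t by (simp add: gap_def survive_def hit_0 jump_time_Suc Gstate_def xi_eq x'_def d_def)
  define h where "h s = (\<Sum>k\<in>UNIV. Q $ i $ k * (\<integral>\<omega>. xi j x' v (case_nat (i, s) \<omega>) \<partial>mu k))" for s
  have bx: "\<forall>\<omega>. (\<forall>n. 0 < snd (\<omega> n)) \<longrightarrow> \<bar>xi j x' v \<omega>\<bar> \<le> 1"
    using xi_bounds[OF x'] by simp
  have bg: "\<forall>\<omega>. (\<forall>n. 0 < snd (\<omega> n)) \<longrightarrow> \<bar>gap j 0 x v t \<omega>\<bar> \<le> 1"
    using gap_bound[OF x] by simp
  have mx: "xi j x' v \<in> borel_measurable seqM" by simp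
  note osx = one_step[where i = i, OF mx bx, folded h_def]
  note osg = one_step[where i = i, OF measurable_gap bg]
  have int_xi: "integrable (mu k) (\<lambda>\<omega>. xi j x' v (case_nat (i, s) \<omega>))" if "0 < s" for s k
  proof (rule integrable_mu_bounded[where B = 1])
    have "(\<lambda>\<omega>. case_nat (i, s) \<omega>) \<in> measurable seqM seqM"
      using measurable_compose[OF measurable_Pair1'[of s borel seqM] measurable_case_nat_seqM[of i]] by simp
    then show "(\<lambda>\<omega>. xi j x' v (case_nat (i, s) \<omega>)) \<in> borel_measurable seqM"
      by measurable
    show "\<bar>xi j x' v (case_nat (i, s) \<omega>)\<bar> \<le> 1" if "\<And>n. 0 < snd (\<omega> n)" for \<omega>
      by (rule bx[rule_format]) (use that \<open>0 < s\<close> in \<open>auto split: nat.split\<close>)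
  qed
  have inner: "(\<Sum>k\<in>UNIV. Q $ i $ k * (\<integral>\<omega>. gap j 0 x v t (case_nat (i, s) \<omega>) \<partial>mu k))
      = indicator {t<..} s * exp (- w * t) * (h (s - t) - G j i x' v)" for s
  proof (cases "t < s")
    case True
    have K: "(\<integral>\<omega>. gap j 0 x v t (case_nat (i, s) \<omega>) \<partial>mu k)
        = exp (- w * t) * ((\<integral>\<omega>. xi j x' v (case_nat (i, s - t) \<omega>) \<partial>mu k) - G j i x' v)" for k
    proof -
      interpret prob_space "mu k" by (rule prob_mu)
      show ?thesis unfolding gap_eq
        using True int_xi[of "s - t" k] prob_space by (simp add: right_diff_distrib)
    qed
    have "(\<Sum>k\<in>UNIV. Q $ i $ k * (\<integral>\<omega>. gap j 0 x v t (case_nat (i, s) \<omega>) \<partial>mu k))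
       = (\<Sum>k\<in>UNIV. exp (- w * t) * (Q $ i $ k * (\<integral>\<omega>. xi j x' v (case_nat (i, s - t) \<omega>) \<partial>mu k)))
          - (\<Sum>k\<in>UNIV. Q $ i $ k * (exp (- w * t) * G j i x' v))"
      unfolding K sum_subtractf[symmetric] by (rule sum.cong) (simp_all add: algebra_simps)
    also have "\<dots> = exp (- w * t) * (h (s - t) - G j i x' v)"
      by (simp add: h_def Q_sum right_diff_distrib flip: sum_distrib_left sum_distrib_right)
    finally show ?thesis using True by simp
  next
    case False then show ?thesis by (simp add: gap_eq)
  qed
  let ?D = "exponential_density (lam $ i)"
  have "(\<integral>\<omega>. gap j 0 x v t \<omega> \<partial>mu i)
      = (\<integral>s. ?D s * (indicator {t<..} s * exp (- w * t) * (h (s - t) - G j i x' v)) \<partial>lborel)"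
    unfolding osg(1) inner ..
  \<comment> \<open>Translation by \<open>t\<close> moves the integration to the excess of the
    holding time over \<open>t\<close>.\<close>
  also have "\<dots> = (\<integral>s. ?D (t + 1 * s) * (indicator {t<..} (t + 1 * s) * exp (- w * t) * (h (t + 1 * s - t) - G j i x' v)) \<partial>lborel)"
    by (subst lborel_integral_real_affine[of 1 _ t]) simp_all
  also have "\<dots> = (\<integral>s. exp (- w * t) * exp (- lam $ i * t) * (?D s * h s - ?D s * G j i x' v) \<partial>lborel)"
  proof (rule integral_cong_AE)
    \<comment> \<open>At \<open>s = 0\<close> the indicator on the left vanishes while the density
      on the right does not, so this point is excluded as a null set.\<close>
    have "?D (t + 1 * s) * (indicator {t<..} (t + 1 * s) * exp (- w * t) * (h (t + 1 * s - t) - G j i x' v))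
       = exp (- w * t) * exp (- lam $ i * t) * (?D s * h s - ?D s * G j i x' v)" if "s \<noteq> 0" for s
    proof (cases "0 < s")
      case True
      then have "?D (t + s) = exp (- lam $ i * t) * ?D s"
        using t by (simp add: exponential_density_def exp_add[symmetric] algebra_simps)
      with True show ?thesis by (simp add: algebra_simps)
    next
      case False
      with that show ?thesis by (simp add: exponential_density_def)
    qed
    then show "AE s in lborel. ?D (t + 1 * s) * (indicator {t<..} (t + 1 * s) * exp (- w * t) * (h (t + 1 * s - t) - G j i x' v))
       = exp (- w * t) * exp (- lam $ i * t) * (?D s * h s - ?D s * G j i x' v)"
      using AE_lborel_singleton[of 0] by (auto elim: eventually_mono)
    have [measurable]: "h \<in> borel_measurable borel" unfolding h_def by measurable
    show "(\<lambda>s. ?D (t + 1 * s) * (indicator {t<..} (t + 1 * s) * exp (- w * t) * (h (t + 1 * s - t) - G j i x' v))) \<in> borel_measurable lborel"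
      "(\<lambda>s. exp (- w * t) * exp (- lam $ i * t) * (?D s * h s - ?D s * G j i x' v)) \<in> borel_measurable lborel"
      by measurable
  qed
  also have "\<dots> = exp (- w * t) * exp (- lam $ i * t) * ((\<integral>s. ?D s * h s \<partial>lborel) - (\<integral>s. ?D s * G j i x' v \<partial>lborel))"
    using osx(2) integrable_exponential_density[OF lam_pos[of i]]
    by (subst integral_mult_right_zero, subst Bochner_Integration.integral_diff) auto
  also have "\<dots> = 0"
    using osx(1) integrable_exponential_density[OF lam_pos[of i]] by (simp add: G_def)
  finally show ?thesis .
qed

text \<open>Phase, level, minimum, time and event all vary in the induction, because removing a jump
  changes each of them.\<close>

lemma integral_history_gap:
  assumes "0 < x" "x \<le> v + a" "history n B"
  shows "(\<integral>\<omega>. indicator B \<omega> * gap j n x v t \<omega> \<partial>mu i) = 0"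
  using assms
proof (induction n arbitrary: i x v t B)
  case 0
  have [measurable]: "B \<in> sets seqM" using 0 by (simp add: history_def)
  \<comment> \<open>For \<open>n = 0\<close> a history event depends on the initial phase alone, so
    its indicator is almost surely a constant, read off here from an arbitrary path in phase
    \<open>i\<close>.\<close>
  let ?b = "indicator B (\<lambda>_. (i, 0 :: real)) :: real"
  have "(\<integral>\<omega>. indicator B \<omega> * gap j 0 x v t \<omega> \<partial>mu i) = (\<integral>\<omega>. ?b * gap j 0 x v t \<omega> \<partial>mu i)"
  proof (rule integral_cong_AE)
    have Beq: "(\<omega> \<in> B) = ((\<lambda>_. (i, 0)) \<in> B)" if "fst (\<omega> 0) = i" for \<omega>
      using 0(3) that unfolding history_def by (metis fst_conv less_nat_zero_code)
    show "AE \<omega> in mu i. indicator B \<omega> * gap j 0 x v t \<omega> = ?b * gap j 0 x v t \<omega>"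
      using AE_mu_start[of i]
    proof eventually_elim
      case (elim \<omega>)
      show ?case unfolding indicator_def using Beq[where \<omega> = \<omega>, OF elim] by simp
    qed
  qed (unfold measurable_cong_sets[OF sets_mu refl], measurable)
  also have "\<dots> = 0" using gap_0_integral[OF 0(1,2)] by simp
  finally show ?case .
next
  case (Suc n)
  have B [measurable]: "B \<in> sets seqM" using Suc.prems by (simp add: history_def)
  have m: "(\<lambda>\<omega>. indicator B \<omega> * gap j (Suc n) x v t \<omega>) \<in> borel_measurable seqM" by measurable
  have b: "\<forall>\<omega>. (\<forall>n. 0 < snd (\<omega> n)) \<longrightarrow> \<bar>indicator B \<omega> * gap j (Suc n) x v t \<omega>\<bar> \<le> 1"
    using gap_bound[OF Suc.prems(1,2)] by (simp add: indicator_def)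
  \<comment> \<open>The integrand vanishes for every single \<open>s\<close>: the density is 0, or
    the gap is 0, or the induction hypothesis applies.\<close>
  have zero: "exponential_density (lam $ i) s * (\<Sum>k\<in>UNIV. Q $ i $ k *
     (\<integral>\<omega>. indicator B (case_nat (i, s) \<omega>) * gap j (Suc n) x v t (case_nat (i, s) \<omega>) \<partial>mu k)) = 0" for s
  proof (cases "0 \<le> s \<and> s \<le> c $ i * (v + a - x)")
    case False
    then show ?thesis by (auto simp: exponential_density_def gap_shift)
  next
    case True
    let ?x = "p $ i * (x + s / c $ i)" and ?B = "{\<omega>. case_nat (i, s) \<omega> \<in> B}"
    have "0 \<le> s / c $ i" "s / c $ i \<le> v + a - x"
      using True c_pos[of i] by (simp_all add: pos_divide_le_eq mult.commute)
    then have xx: "0 < x + s / c $ i" "x + s / c $ i \<le> v + a" using Suc.prems by auto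
    then have x: "0 < ?x" "?x \<le> min v ?x + a"
      using order_trans[OF jump_le[of "x + s / c $ i" i], of "v + a"] p_range[of i] a_pos
      by (auto simp: min_def)
    have "(\<lambda>\<omega>. case_nat (i, s) \<omega>) \<in> measurable seqM seqM"
      using measurable_compose[OF measurable_Pair1'[of s borel seqM] measurable_case_nat_seqM[of i]] by simp
    from measurable_sets[OF this B] have "?B \<in> sets seqM" by (simp add: vimage_def)
    \<comment> \<open>Fixing the first pair turns a history of \<open>n + 1\<close> jumps into a
      history of \<open>n\<close> jumps.\<close>
    moreover have "\<omega> \<in> ?B \<longleftrightarrow> \<omega>' \<in> ?B" if "fst (\<omega> n) = fst (\<omega>' n)" "\<forall>k<n. \<omega> k = \<omega>' k" for \<omega> \<omega>'
    proof -
      have "fst (case_nat (i, s) \<omega> (Suc n)) = fst (case_nat (i, s) \<omega>' (Suc n))"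
        "\<forall>k<Suc n. case_nat (i, s) \<omega> k = case_nat (i, s) \<omega>' k"
        using that by (auto split: nat.split)
      then show ?thesis using Suc.prems(3) unfolding history_def by blast
    qed
    ultimately have "history n ?B" unfolding history_def by blast
    note IH = Suc.IH[where t = "t - s", OF x this]
    have "(\<integral>\<omega>. indicator B (case_nat (i, s) \<omega>) * gap j (Suc n) x v t (case_nat (i, s) \<omega>) \<partial>mu k)
       = (\<integral>\<omega>. exp (- w * s) * (indicator ?B \<omega> * gap j n ?x (min v ?x) (t - s) \<omega>) \<partial>mu k)" for k
      using True by (intro Bochner_Integration.integral_cong) (auto simp: gap_shift indicator_def)
    then show ?thesis using IH by simp
  qed
  then show ?case
    unfolding one_step[where i = i, OF m b] zero by simp
qed

end

section \<open>Sample paths\<close>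

context drawup_chain
begin

text \<open>\<open>\<eta>\<close> is a point of the given probability space and
  \<open>\<omega>\<close> its jump sequence. The pathwise arguments are deterministic statements
  about one such pair, and the three clauses will be shown to hold almost surely.\<close>

definition tracks :: "(real \<Rightarrow> 'w \<Rightarrow> real) \<Rightarrow> (real \<Rightarrow> 'w \<Rightarrow> 'e) \<Rightarrow> 'w \<Rightarrow> real \<Rightarrow> (nat \<Rightarrow> 'e \<times> real) \<Rightarrow> bool" where
  "tracks X J \<eta> x \<omega> \<longleftrightarrow> (\<forall>n. 0 < snd (\<omega> n)) \<and> (\<forall>t. \<exists>n. t < jump_time \<omega> n) \<and>
     (\<forall>n t. jump_time \<omega> n \<le> t \<and> t < jump_time \<omega> (Suc n) \<longrightarrow>
        J t \<eta> = fst (\<omega> n) \<and> X t \<eta> = lev x \<omega> n + (t - jump_time \<omega> n) / c $ fst (\<omega> n))"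

text \<open>Approximation from the right by rationals up to \<open>t\<close> breaks down at
  \<open>t\<close> itself, where a jump may occur; hence the endpoint is included.\<close>

definition countable_times :: "real \<Rightarrow> real set" where
  "countable_times t = insert t {q \<in> \<rat>. 0 \<le> q \<and> q \<le> t}"

lemma countable_countable_times: "countable (countable_times t)"
  unfolding countable_times_def using countable_rat by (auto intro: countable_subset[of _ \<rat>])

lemma countable_times_bounds: "0 \<le> t \<Longrightarrow> q \<in> countable_times t \<Longrightarrow> 0 \<le> q \<and> q \<le> t"
  by (auto simp: countable_times_def)

text \<open>Approximation from the right is enough because the segments between jumps are closed on
  the left. The approximant must not pass \<open>q\<close>, since infima up to \<open>q\<close> are
  to be recovered.\<close>

lemma countable_times_dense:
  assumes "0 \<le> r" "r \<le> q" "r < b" "q \<in> countable_times t"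
  shows "\<exists>s\<in>countable_times t. r \<le> s \<and> s \<le> q \<and> s < b"
proof (cases "r = q")
  case True with assms show ?thesis by auto
next
  case False
  with assms have "r < min q b" by auto
  then obtain s where "s \<in> \<rat>" "r < s" "s < min q b" using Rats_dense_in_real by blast
  moreover have "q \<le> t" using assms by (auto simp: countable_times_def)
  ultimately show ?thesis using assms by (auto simp: countable_times_def intro!: bexI[of _ s])
qed

section \<open>One trajectory and its jump sequence\<close>

context
  fixes X :: "real \<Rightarrow> 'w \<Rightarrow> real" and J :: "real \<Rightarrow> 'w \<Rightarrow> 'e" and \<eta> x \<omega> v
  assumes tr: "tracks X J \<eta> x \<omega>" and v: "0 < v" "v \<le> x" "x < v + a"
begin

abbreviation (input) T where "T \<equiv> jump_time \<omega>"
abbreviation (input) segment where "segment n t \<equiv> T n \<le> t \<and> t < T (Suc n)"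
abbreviation (input) hits where "hits n \<equiv> hit x v \<omega> n < snd (\<omega> n)"

lemma holding_pos: "0 < snd (\<omega> n)"
  using tr by (simp add: tracks_def)

lemma jump_time_less: "m < n \<Longrightarrow> T (Suc m) \<le> T n"
proof -
  have "mono T" by (rule mono_iff_le_Suc[THEN iffD2]) (simp add: jump_time_Suc less_imp_le[OF holding_pos])
  then show "m < n \<Longrightarrow> T (Suc m) \<le> T n" by (simp add: monoD)
qed

lemma segment_unique: "segment n t \<Longrightarrow> segment m t \<Longrightarrow> n = m"
  using jump_time_less[of n m] jump_time_less[of m n] by (metis linorder_neqE_nat not_le order_trans)

lemma segment_ex: "0 \<le> t \<Longrightarrow> \<exists>n. segment n t"
proof -
  assume t: "0 \<le> t"
  have ex: "\<exists>n. t < T n" using tr by (simp add: tracks_def)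
  let ?m = "LEAST n. t < T n"
  have m: "t < T ?m" using ex by (rule LeastI_ex)
  with t have "?m \<noteq> 0" by (metis jump_time_0 not_le)
  then obtain n where n: "?m = Suc n" using not0_implies_Suc by blast
  have "\<not> t < T n" by (rule not_less_Least) (simp add: n)
  with m n show ?thesis by (auto intro!: exI[of _ n])
qed

lemma segment_X: "segment n t \<Longrightarrow> X t \<eta> = lev x \<omega> n + (t - T n) / c $ fst (\<omega> n)"
  and segment_J: "segment n t \<Longrightarrow> J t \<eta> = fst (\<omega> n)"
  using tr by (auto simp: tracks_def)

lemma x_pos: "0 < x" using v by simp

lemma level_pos: "0 < lev x \<omega> n"
  by (rule lev_pos[OF x_pos holding_pos])

lemma X_ge_lev: "segment n t \<Longrightarrow> lev x \<omega> n \<le> X t \<eta>"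
  using c_pos[of "fst (\<omega> n)"] by (simp add: segment_X)

lemma X_pos: "0 \<le> t \<Longrightarrow> 0 < X t \<eta>"
  using segment_ex X_ge_lev level_pos by (metis less_le_trans)

lemma rmin_le: "rmin x v \<omega> n \<le> v" "k \<le> n \<Longrightarrow> rmin x v \<omega> n \<le> lev x \<omega> k"
proof -
  show "rmin x v \<omega> n \<le> v" by (induction n) auto
  show "k \<le> n \<Longrightarrow> rmin x v \<omega> n \<le> lev x \<omega> k"
  proof (induction n)
    case 0 then show ?case using v by simp
  next
    case (Suc n) then show ?case by (auto simp: le_Suc_eq)
  qed
qed

lemma rmin_cases: "rmin x v \<omega> n = v \<or> (\<exists>k. k \<le> n \<and> rmin x v \<omega> n = lev x \<omega> k)"
  by (induction n) (auto simp: min_def le_Suc_eq)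

lemma rmin_pos: "0 < rmin x v \<omega> n"
  using rmin_cases[of n] v level_pos by auto

lemma X_ge_rmin: "segment n t \<Longrightarrow> 0 \<le> s \<Longrightarrow> s \<le> t \<Longrightarrow> rmin x v \<omega> n \<le> X s \<eta>"
proof -
  assume a: "segment n t" "0 \<le> s" "s \<le> t"
  obtain k where k: "segment k s" using segment_ex[OF a(2)] by blast
  have "k \<le> n"
  proof (rule ccontr)
    assume "\<not> k \<le> n"
    then have "T (Suc n) \<le> T k" using jump_time_less[of n k] by simp
    with a k show False by linarith
  qed
  then show ?thesis using rmin_le(2)[of k n] X_ge_lev[OF k] by linarith
qed

lemma T_segment: "segment n (T n)"
  using holding_pos[of n] by (simp add: jump_time_Suc)

lemma T_nonneg: "0 \<le> T n"
  by (rule jump_time_nonneg[OF holding_pos])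

lemma T_mono: "k \<le> n \<Longrightarrow> T k \<le> T n"
  using jump_time_less[of k n] T_segment[of k] by (cases "k = n") auto

text \<open>Positivity of the levels bounds the infimum from below, and the candidate value is
  attained at a jump time unless it is \<open>v\<close>.\<close>

lemma run_min_eq:
  assumes s: "segment n t"
  shows "run_min X v t \<eta> = rmin x v \<omega> n"
proof -
  have t: "0 \<le> t" using s T_nonneg[of n] by linarith
  have bdd: "bdd_below ((\<lambda>s. X s \<eta>) ` {0..t})"
    by (rule bdd_belowI2[of _ 0]) (auto intro: less_imp_le X_pos)
  have "rmin x v \<omega> n \<le> (INF s\<in>{0..t}. X s \<eta>)"
    using t by (intro cINF_greatest X_ge_rmin[OF s]) auto
  moreover have "min v (INF s\<in>{0..t}. X s \<eta>) \<le> rmin x v \<omega> n"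
    using rmin_cases[of n]
  proof
    assume "\<exists>k. k \<le> n \<and> rmin x v \<omega> n = lev x \<omega> k"
    then obtain k where k: "k \<le> n" "rmin x v \<omega> n = lev x \<omega> k" by blast
    have "T k \<in> {0..t}" using T_nonneg[of k] T_mono[OF k(1)] s by auto
    then have "(INF s\<in>{0..t}. X s \<eta>) \<le> X (T k) \<eta>" by (rule cINF_lower[OF bdd])
    also have "\<dots> = lev x \<omega> k" by (simp add: segment_X[OF T_segment])
    finally show ?thesis using k by simp
  qed simp
  ultimately show ?thesis unfolding run_min_def using rmin_le(1)[of n] by linarith
qed

text \<open>A post-jump level is approached by the values at countably many times just after the
  jump, since the motion there is continuous.\<close>

lemma countable_run_min_eq:
  assumes t: "0 \<le> t" and q: "q \<in> countable_times t"
  shows "run_min X v q \<eta> = min v (INF r\<in>{r \<in> countable_times t. r \<le> q}. X r \<eta>)"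
proof -
  let ?D = "{r \<in> countable_times t. r \<le> q}"
  have q0: "0 \<le> q" using countable_times_bounds[OF t q] by simp
  obtain n where s: "segment n q" using segment_ex[OF q0] by blast
  have bdd: "bdd_below ((\<lambda>r. X r \<eta>) ` ?D)"
    by (rule bdd_belowI2[of _ 0]) (use countable_times_bounds[OF t] X_pos in \<open>auto intro: less_imp_le\<close>)
  have "rmin x v \<omega> n \<le> (INF r\<in>?D. X r \<eta>)"
  proof (rule cINF_greatest)
    show "?D \<noteq> {}" using q by auto
    fix r assume "r \<in> ?D"
    then show "rmin x v \<omega> n \<le> X r \<eta>" using countable_times_bounds[OF t] by (intro X_ge_rmin[OF s]) auto
  qed
  moreover have "min v (INF r\<in>?D. X r \<eta>) \<le> rmin x v \<omega> n"
    using rmin_cases[of n]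
  proof
    assume "\<exists>k. k \<le> n \<and> rmin x v \<omega> n = lev x \<omega> k"
    then obtain k where k: "k \<le> n" "rmin x v \<omega> n = lev x \<omega> k" by blast
    have cp: "0 < c $ fst (\<omega> k)" by (rule c_pos)
    have "(INF r\<in>?D. X r \<eta>) \<le> lev x \<omega> k + e" if "0 < e" for e
    proof -
      have "T k \<le> q" using T_mono[OF k(1)] s by auto
      \<comment> \<open>Within time \<open>e * c $ fst (\<omega> k)\<close> after the jump the level
        rises by at most \<open>e\<close>.\<close>
      moreover have "T k < min (T (Suc k)) (T k + e * c $ fst (\<omega> k))" using T_segment[of k] that cp by simp
      ultimately obtain r where r: "r \<in> countable_times t" "T k \<le> r" "r \<le> q"
          "r < min (T (Suc k)) (T k + e * c $ fst (\<omega> k))"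
        using countable_times_dense[OF T_nonneg _ _ q] by blast
      have "(INF r\<in>?D. X r \<eta>) \<le> X r \<eta>"
        using r by (intro cINF_lower[OF bdd]) auto
      also have "\<dots> = lev x \<omega> k + (r - T k) / c $ fst (\<omega> k)" using r by (intro segment_X) simp
      also have "\<dots> \<le> lev x \<omega> k + e" using r cp by (simp add: pos_divide_le_eq)
      finally show ?thesis .
    qed
    then have "(INF r\<in>?D. X r \<eta>) \<le> lev x \<omega> k" by (rule field_le_epsilon)
    then show ?thesis using k by simp
  qed simp
  ultimately show ?thesis unfolding run_min_eq[OF s] using rmin_le(1)[of n] by linarith
qed

lemma drawup_ge_iff:
  assumes s: "segment n t"
  shows "a \<le> X t \<eta> - run_min X v t \<eta> \<longleftrightarrow> hit x v \<omega> n \<le> t - T n"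
  unfolding run_min_eq[OF s] segment_X[OF s] hit_def using c_pos[of "fst (\<omega> n)"]
  by (simp add: field_simps)

text \<open>The strict form of \<open>lev_le_rmin_add\<close>: a jump shrinks a positive level
  strictly, so the process restarts below the threshold and can reach it only by continuous
  motion.\<close>

lemma hit_pos:
  assumes "\<And>k. k < n \<Longrightarrow> \<not> hits k"
  shows "0 < hit x v \<omega> n"
proof (cases n)
  case 0 then show ?thesis using v c_pos by (simp add: hit_def)
next
  case (Suc m)
  have le: "snd (\<omega> k) \<le> hit x v \<omega> k" if "k < n" for k using assms[OF that] by simp
  let ?y = "lev x \<omega> m + snd (\<omega> m) / c $ fst (\<omega> m)"
  have "snd (\<omega> m) / c $ fst (\<omega> m) \<le> rmin x v \<omega> m + a - lev x \<omega> m"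
    using le[of m] Suc c_pos[of "fst (\<omega> m)"] by (simp add: hit_def field_simps)
  moreover have y: "0 < ?y"
    using level_pos[of m] holding_pos[of m] c_pos[of "fst (\<omega> m)"] by (simp add: add_pos_pos)
  moreover have "p $ fst (\<omega> m) * ?y < ?y"
    using y p_range[of "fst (\<omega> m)"] by simp
  ultimately have "lev x \<omega> n < rmin x v \<omega> m + a"
    unfolding Suc lev_Suc by linarith
  then have "lev x \<omega> n < rmin x v \<omega> n + a" unfolding Suc using a_pos by (simp add: min_def)
  then show ?thesis using c_pos by (simp add: hit_def)
qed

section \<open>The first hit and the drawup time\<close>

context
  fixes \<kappa>
  assumes \<kappa>: "hits \<kappa>" and first: "\<And>k. k < \<kappa> \<Longrightarrow> \<not> hits k"
begin

lemma hit_segment: "segment \<kappa> (T \<kappa> + hit x v \<omega> \<kappa>)"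
  using hit_pos[of \<kappa>] first \<kappa> by (simp add: jump_time_Suc less_imp_le)

text \<open>A time with drawup at least \<open>a\<close> lies in a segment that hits, hence in
  segment \<open>\<kappa>\<close> or a later one.\<close>

lemma ge_hit_time:
  assumes "0 \<le> t" "a \<le> X t \<eta> - run_min X v t \<eta>"
  shows "T \<kappa> + hit x v \<omega> \<kappa> \<le> t"
proof -
  obtain m where m: "segment m t" using segment_ex[OF assms(1)] by blast
  have h: "hit x v \<omega> m \<le> t - T m" using assms(2) drawup_ge_iff[OF m] by simp
  then have "hits m" using m by (simp add: jump_time_Suc)
  then have "\<not> m < \<kappa>" using first by blast
  then consider "m = \<kappa>" | "\<kappa> < m" by linarith
  then show ?thesis
  proof cases
    case 1 then show ?thesis using h by simp
  next
    case 2 then show ?thesis using jump_time_less[OF 2] m hit_segment by linarith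
  qed
qed

lemma drawup_time_eq: "drawup_time X v a \<eta> = ereal (T \<kappa> + hit x v \<omega> \<kappa>)"
  unfolding drawup_time_def
proof (rule cInf_eq_minimum)
  let ?t = "T \<kappa> + hit x v \<omega> \<kappa>"
  have "a \<le> X ?t \<eta> - run_min X v ?t \<eta>"
    by (subst drawup_ge_iff[OF hit_segment]) simp
  moreover have "0 \<le> ?t" using T_nonneg[of \<kappa>] hit_segment by linarith
  ultimately show "ereal ?t \<in> ereal ` {t. 0 \<le> t \<and> a \<le> X t \<eta> - run_min X v t \<eta>}" by auto
  show "ereal ?t \<le> z" if "z \<in> ereal ` {t. 0 \<le> t \<and> a \<le> X t \<eta> - run_min X v t \<eta>}" for z
    using that ge_hit_time by auto
qed

lemma xi_eq_at_hit: "xi j x v \<omega> = exp (- w * (T \<kappa> + hit x v \<omega> \<kappa>)) * of_bool (fst (\<omega> \<kappa>) = j)"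
proof -
  have "(LEAST n. hits n) = \<kappa>"
    by (rule Least_equality) (use \<kappa> first in \<open>auto simp: not_less[symmetric]\<close>)
  then show ?thesis using \<kappa> by (auto simp: xi_def Let_def)
qed

text \<open>There is no overshoot, which is what makes the boundary value at the minimum plus
  \<open>a\<close> applicable.\<close>

lemma X_hit: "X (T \<kappa> + hit x v \<omega> \<kappa>) \<eta> = rmin x v \<omega> \<kappa> + a"
  using c_pos[of "fst (\<omega> \<kappa>)"] by (simp add: segment_X[OF hit_segment]) (simp add: hit_def)

end

lemma first_hit: "hits n \<Longrightarrow> \<exists>\<kappa>\<le>n. hits \<kappa> \<and> (\<forall>k<\<kappa>. \<not> hits k)"
  using exists_least_iff[of "\<lambda>n. hits n"] by (metis linorder_not_le)

lemma drawup_time_infinite: "\<nexists>n. hits n \<Longrightarrow> drawup_time X v a \<eta> = \<infinity>"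
proof -
  assume n: "\<nexists>n. hits n"
  have "\<not> a \<le> X t \<eta> - run_min X v t \<eta>" if "0 \<le> t" for t
  proof -
    obtain m where m: "segment m t" using segment_ex[OF \<open>0 \<le> t\<close>] by blast
    have "\<not> hits m" using n by blast
    then show ?thesis unfolding drawup_ge_iff[OF m] using m by (simp add: jump_time_Suc)
  qed
  then have e: "{t. 0 \<le> t \<and> a \<le> X t \<eta> - run_min X v t \<eta>} = {}" by auto
  show ?thesis unfolding drawup_time_def e by (simp add: top_ereal_def)
qed

lemma xi_eq_drawup:
  "xi j x v \<omega> = (let \<tau> = drawup_time X v a \<eta> in
     if \<tau> < \<infinity> \<and> J (real_of_ereal \<tau>) \<eta> = j then exp (- w * real_of_ereal \<tau>) else 0)"
proof (cases "\<exists>n. hits n")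
  case True
  then obtain \<kappa> where \<kappa>: "hits \<kappa>" "\<And>k. k < \<kappa> \<Longrightarrow> \<not> hits k" using first_hit by blast
  show ?thesis
    by (simp add: drawup_time_eq[OF \<kappa>] xi_eq_at_hit[OF \<kappa>] segment_J[OF hit_segment[OF \<kappa>]])
next
  case False
  then have "xi j x v \<omega> = 0" unfolding xi_def by auto
  then show ?thesis by (simp add: drawup_time_infinite[OF False])
qed

lemma stopped_survive:
  assumes "survive n x v t \<omega>"
  shows "stopped_at X v a t \<eta> = t"
proof -
  have s: "segment n t" and k: "\<And>k. k < n \<Longrightarrow> \<not> hits k" and tn: "t - T n < hit x v \<omega> n"
    using assms by (auto simp: survive_def not_less)
  have "ereal t \<le> drawup_time X v a \<eta>"
  proof (cases "\<exists>n. hits n")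
    case True
    then obtain \<kappa> where \<kappa>: "hits \<kappa>" "\<And>k. k < \<kappa> \<Longrightarrow> \<not> hits k" using first_hit by blast
    have "\<not> \<kappa> < n" using k \<kappa> by blast
    then consider "\<kappa> = n" | "n < \<kappa>" by linarith
    then have "t \<le> T \<kappa> + hit x v \<omega> \<kappa>"
    proof cases
      case 1 then show ?thesis using tn by simp
    next
      case 2 then show ?thesis using jump_time_less[OF 2] s hit_segment[OF \<kappa>] by linarith
    qed
    then show ?thesis by (simp add: drawup_time_eq[OF \<kappa>])
  qed (simp add: drawup_time_infinite)
  then show ?thesis by (simp add: stopped_at_def min_def)
qed

text \<open>If survival fails, an earlier holding time exceeded its \<open>hit\<close>, or the
  current segment has already reached the threshold.\<close>

lemma not_survive_hit:
  assumes s: "segment n t" and ns: "\<not> survive n x v t \<omega>"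
  obtains \<kappa> where "hits \<kappa>" "\<And>k. k < \<kappa> \<Longrightarrow> \<not> hits k" "T \<kappa> + hit x v \<omega> \<kappa> \<le> t"
proof -
  have "\<exists>k\<le>n. hits k"
    using ns s unfolding survive_def by (auto simp: jump_time_Suc not_le not_less intro: less_imp_le)
  then obtain \<kappa> where k: "\<kappa> \<le> n" and \<kappa>: "hits \<kappa>" "\<And>k. k < \<kappa> \<Longrightarrow> \<not> hits k"
    using first_hit by (meson order_trans)
  have "T \<kappa> + hit x v \<omega> \<kappa> \<le> t"
  proof (cases "\<kappa> = n")
    case True
    then show ?thesis using ns s \<kappa>(2) by (auto simp: survive_def not_less)
  next
    case False
    with k have "\<kappa> < n" by simp
    from jump_time_less[OF this] hit_segment[OF \<kappa>] s show ?thesis by linarith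
  qed
  with \<kappa> show thesis by (rule that)
qed

text \<open>Before stopping, the row of \<open>F\<close> gives \<open>Gstate\<close>. After
  stopping, the level is the minimum plus \<open>a\<close>, where the identity matrix produces the
  phase indicator contained in \<open>xi\<close>.\<close>

lemma martingale_value:
  fixes F :: "real \<Rightarrow> real \<Rightarrow> real^'e^'e"
  assumes FG: "\<And>u y i j. 0 < u \<Longrightarrow> u \<le> y \<Longrightarrow> y \<le> u + a \<Longrightarrow> F y u $ i $ j = G j i y u"
    and Fend: "\<And>u. 0 < u \<Longrightarrow> F (u + a) u = mat 1"
    and s: "segment n t"
  shows "(let r = stopped_at X v a t \<eta> in
      exp (- w * r) *\<^sub>R row (J r \<eta>) (F (X r \<eta>) (run_min X v r \<eta>))) $ j
    = (if survive n x v t \<omega> then Gstate j n x v t \<omega> else xi j x v \<omega>)"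
proof (cases "survive n x v t \<omega>")
  case True
  note st = survive_state[OF x_pos less_imp_le[OF v(3)] holding_pos True]
  have "rmin x v \<omega> n \<le> X t \<eta>" using rmin_le(2)[of n n] X_ge_lev[OF s] by simp
  then show ?thesis
    using True st FG[OF rmin_pos, of n "X t \<eta>" "fst (\<omega> n)" j]
    by (simp add: stopped_survive run_min_eq[OF s] segment_J[OF s] row_def Gstate_def)
      (simp add: segment_X[OF s])
next
  case False
  then obtain \<kappa> where \<kappa>: "hits \<kappa>" "\<And>k. k < \<kappa> \<Longrightarrow> \<not> hits k" "T \<kappa> + hit x v \<omega> \<kappa> \<le> t"
    using not_survive_hit[OF s] by blast
  have "stopped_at X v a t \<eta> = T \<kappa> + hit x v \<omega> \<kappa>"
    using \<kappa>(3) by (simp add: stopped_at_def drawup_time_eq[OF \<kappa>(1,2)] min_def)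
  then show ?thesis
    using False Fend[OF rmin_pos, of \<kappa>]
    by (simp add: X_hit[OF \<kappa>(1,2)] run_min_eq[OF hit_segment[OF \<kappa>(1,2)]] segment_J[OF hit_segment[OF \<kappa>(1,2)]]
      xi_eq_at_hit[OF \<kappa>(1,2)] row_def mat_def)
qed

text \<open>Only countably many coordinates of the path occur on the right-hand side, so it is adapted. The infimum
recovers the drawup time, and the phase at that time is the one shared by all sufficiently early hits.\<close>

lemma martingale_value_countable:
  assumes t: "0 \<le> t" and s: "segment n t"
  defines "D \<equiv> countable_times t"
  defines "h \<equiv> \<lambda>q. a \<le> X q \<eta> - run_min X v q \<eta>"
  shows "(if survive n x v t \<omega> then Gstate j n x v t \<omega> else xi j x v \<omega>)
    = (if \<exists>q\<in>D. h q then exp (- w * (INF q\<in>D. if h q then q else t)) *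
          of_bool (\<exists>q\<in>D. h q \<and> J q \<eta> = j \<and> (\<forall>r\<in>D. r \<le> q \<and> h r \<longrightarrow> J r \<eta> = j))
       else exp (- w * t) * G j (J t \<eta>) (X t \<eta>) (run_min X v t \<eta>))"
proof (cases "survive n x v t \<omega>")
  case True
  have "\<not> h q" if "q \<in> D" for q
  proof
    assume "h q"
    have q: "0 \<le> q" "q \<le> t" using countable_times_bounds[OF t] that by (auto simp: D_def)
    obtain m where m: "segment m q" using segment_ex[OF q(1)] by blast
    have le: "hit x v \<omega> m \<le> q - T m" using \<open>h q\<close> drawup_ge_iff[OF m] by (simp add: h_def)
    then have "hits m" using m by (simp add: jump_time_Suc)
    then have "\<not> m < n" using True by (auto simp: survive_def not_less)
    moreover have "\<not> n < m" using jump_time_less[of n m] s m q by auto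
    ultimately have "m = n" by simp
    with le q True show False by (simp add: survive_def)
  qed
  then show ?thesis using True
    by (simp add: Gstate_def run_min_eq[OF s] segment_J[OF s]) (simp add: segment_X[OF s])
next
  case False
  then obtain \<kappa> where \<kappa>: "hits \<kappa>" "\<And>k. k < \<kappa> \<Longrightarrow> \<not> hits k" and \<tau>t: "T \<kappa> + hit x v \<omega> \<kappa> \<le> t"
    using not_survive_hit[OF s] by blast
  define \<tau> where "\<tau> = T \<kappa> + hit x v \<omega> \<kappa>"
  have seg: "segment \<kappa> \<tau>" using hit_segment[OF \<kappa>] by (simp add: \<tau>_def)
  have \<tau>0: "0 \<le> \<tau>" using seg T_nonneg[of \<kappa>] by linarith
  have D: "0 \<le> q" "q \<le> t" if "q \<in> D" for q using countable_times_bounds[OF t] that by (auto simp: D_def)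
  have tD: "t \<in> D" by (simp add: D_def countable_times_def)
  have ge: "\<tau> \<le> q" if "q \<in> D" "h q" for q
    using ge_hit_time[OF \<kappa> D(1)[OF that(1)]] that(2) by (simp add: h_def \<tau>_def)
  have seg': "segment \<kappa> q" "h q" if "\<tau> \<le> q" "q < T (Suc \<kappa>)" for q
  proof -
    show s': "segment \<kappa> q" using that seg by linarith
    show "h q" unfolding h_def drawup_ge_iff[OF s'] using that by (simp add: \<tau>_def)
  qed
  have near: "\<exists>q'\<in>D. \<tau> \<le> q' \<and> q' \<le> q \<and> q' < b \<and> q' < T (Suc \<kappa>)" if "q \<in> D" "\<tau> \<le> q" "\<tau> < b" for q b
    using countable_times_dense[of \<tau> q "min b (T (Suc \<kappa>))" t] that \<tau>0 seg by (auto simp: D_def)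
  \<comment> \<open>The default \<open>t\<close> at times without a hit cannot lower the infimum,
    since \<tau> \<le> \<open>t\<close>.\<close>
  have INF: "(INF q\<in>D. if h q then q else t) = \<tau>"
  proof (rule antisym)
    show "\<tau> \<le> (INF q\<in>D. if h q then q else t)"
      using tD ge \<tau>t by (intro cINF_greatest) (auto simp: \<tau>_def)
    have bdd: "bdd_below ((\<lambda>q. if h q then q else t) ` D)"
      by (rule bdd_belowI2[of _ 0]) (auto dest: D simp: t)
    show "(INF q\<in>D. if h q then q else t) \<le> \<tau>"
    proof (rule field_le_epsilon)
      fix e :: real assume "0 < e"
      then obtain q where q: "q \<in> D" "\<tau> \<le> q" "q < \<tau> + e" "q < T (Suc \<kappa>)"
        using near[OF tD, of "\<tau> + e"] \<tau>t by (auto simp: \<tau>_def)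
      then have "(INF q\<in>D. if h q then q else t) \<le> (if h q then q else t)"
        by (intro cINF_lower[OF bdd]) auto
      also have "\<dots> \<le> \<tau> + e" using q seg'(2)[of q] by simp
      finally show "(INF q\<in>D. if h q then q else t) \<le> \<tau> + e" .
    qed
  qed
  \<comment> \<open>\<open>q0\<close> still lies in the segment of \<tau>, so all hits up to
    \<open>q0\<close> share the phase at \<tau>.\<close>
  obtain q0 where q0: "q0 \<in> D" "\<tau> \<le> q0" "q0 < T (Suc \<kappa>)"
    using near[OF tD, of "\<tau> + 1"] \<tau>t by (auto simp: \<tau>_def)
  have ex: "\<exists>q\<in>D. h q" using q0 seg' by blast
  have J: "J q \<eta> = fst (\<omega> \<kappa>)" if "\<tau> \<le> q" "q < T (Suc \<kappa>)" for q
    using segment_J[OF seg'(1)[OF that]] .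
  have "(\<exists>q\<in>D. h q \<and> J q \<eta> = j \<and> (\<forall>r\<in>D. r \<le> q \<and> h r \<longrightarrow> J r \<eta> = j)) \<longleftrightarrow> fst (\<omega> \<kappa>) = j"
  proof
    assume "\<exists>q\<in>D. h q \<and> J q \<eta> = j \<and> (\<forall>r\<in>D. r \<le> q \<and> h r \<longrightarrow> J r \<eta> = j)"
    then obtain q where q: "q \<in> D" "h q" "\<forall>r\<in>D. r \<le> q \<and> h r \<longrightarrow> J r \<eta> = j" by blast
    obtain r where "r \<in> D" "\<tau> \<le> r" "r \<le> q" "r < T (Suc \<kappa>)"
      using near[OF q(1) ge[OF q(1,2)], of "\<tau> + 1"] by auto
    with q(3) J[of r] seg'(2)[of r] show "fst (\<omega> \<kappa>) = j" by auto
  next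
    assume "fst (\<omega> \<kappa>) = j"
    moreover have "J r \<eta> = fst (\<omega> \<kappa>)" if "r \<in> D" "r \<le> q0" "h r" for r
      using J[of r] ge[of r] that q0 by auto
    ultimately show "\<exists>q\<in>D. h q \<and> J q \<eta> = j \<and> (\<forall>r\<in>D. r \<le> q \<and> h r \<longrightarrow> J r \<eta> = j)"
      using q0 J[of q0] seg'(2)[of q0] by (intro bexI[of _ q0]) auto
  qed
  then show ?thesis unfolding INF using False ex by (simp add: xi_eq_at_hit[OF \<kappa>] \<tau>_def)
qed

end

end

section \<open>The solution of the boundary value problem\<close>

text \<open>Serves functionals of the drawup time, which are identified with measurable functions of
  the jump chain only up to a null set.\<close>

lemma borel_measurable_completion_AE:
  assumes g: "g \<in> borel_measurable M" and eq: "AE \<omega> in M. f \<omega> = g \<omega>"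
  shows "f \<in> borel_measurable (completion M)"
proof (rule measurableI)
  fix A :: "'b set" assume A: "A \<in> sets borel"
  show "f -` A \<inter> space (completion M) \<in> sets (completion M)"
  proof (rule completion.in_sets_AE)
    show "g -` A \<inter> space (completion M) \<in> sets (completion M)"
      by (rule measurable_sets[OF measurable_completion[OF g] A])
    show "AE \<omega> in completion M. \<omega> \<in> g -` A \<inter> space (completion M) \<longleftrightarrow> \<omega> \<in> f -` A \<inter> space (completion M)"
      using AE_completion[OF eq] by eventually_elim simp
  qed auto
qed auto

lemma integral_completion_AE:
  fixes g :: "'w \<Rightarrow> real"
  assumes g: "g \<in> borel_measurable M" and eq: "AE \<omega> in M. f \<omega> = g \<omega>"
  shows "(\<integral>\<omega>. f \<omega> \<partial>completion M) = (\<integral>\<omega>. g \<omega> \<partial>M)"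
proof -
  have "(\<integral>\<omega>. f \<omega> \<partial>completion M) = (\<integral>\<omega>. g \<omega> \<partial>completion M)"
    by (rule integral_cong_AE[OF borel_measurable_completion_AE[OF g eq] measurable_completion[OF g] AE_completion[OF eq]])
  then show ?thesis by (simp add: integral_completion[OF g])
qed

section \<open>Coupling with the given processes\<close>

lemma level_phase_process_chain:
  fixes Q :: "real^'e^'e::finite"
  assumes proc: "level_phase_process c lam p Q M X J x i" and Q: "stochastic_matrix Q"
  obtains W where "W \<in> measurable M seqM" "chain_law lam Q i (distr M seqM W)"
    "AE \<eta> in M. \<forall>n t. jump_time (W \<eta>) n \<le> t \<and> t < jump_time (W \<eta>) (Suc n) \<longrightarrow>
        J t \<eta> = fst (W \<eta> n) \<and>
        X t \<eta> = post_jump_level c p x (\<lambda>k. fst (W \<eta> k)) (\<lambda>k. snd (W \<eta> k)) n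
          + (t - jump_time (W \<eta>) n) / c $ fst (W \<eta> n)"
proof -
  obtain Z S where Z: "\<And>n. Z n \<in> measurable M (count_space UNIV)"
    and S: "\<And>n. S n \<in> borel_measurable M"
    and law: "\<And>n z s. (\<forall>k<n. 0 \<le> s k) \<Longrightarrow>
           measure M {\<omega> \<in> space M. Z 0 \<omega> = z 0 \<and> (\<forall>k<n. s k < S k \<omega> \<and> Z (Suc k) \<omega> = z (Suc k))}
           = (if z 0 = i then \<Prod>k<n. exp (- (lam $ z k) * s k) * Q $ z k $ z (Suc k) else 0)"
    and path: "AE \<omega> in M. \<forall>n t. (\<Sum>k<n. S k \<omega>) \<le> t \<and> t < (\<Sum>k<Suc n. S k \<omega>) \<longrightarrow>
           J t \<omega> = Z n \<omega> \<and>
           X t \<omega> = post_jump_level c p x (\<lambda>k. Z k \<omega>) (\<lambda>k. S k \<omega>) n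
                     + (t - (\<Sum>k<n. S k \<omega>)) / c $ Z n \<omega>"
    using proc unfolding level_phase_process_def by blast
  interpret prob_space M using proc by (simp add: level_phase_process_def)
  define W where "W \<eta> n = (Z n \<eta>, S n \<eta>)" for \<eta> n
  have W: "W \<in> measurable M seqM"
    by (rule measurable_into_seqM) (simp add: W_def Z S measurable_Pair)
  have "chain_law lam Q i (distr M seqM W)"
  proof (rule chain_lawI[OF _ _ Q])
    show "prob_space (distr M seqM W)" by (rule prob_space_distr[OF W])
    fix n :: nat and z :: "nat \<Rightarrow> 'e" and s :: "nat \<Rightarrow> real" assume "\<And>k. k < n \<Longrightarrow> 0 \<le> s k"
    moreover have "W -` cyl n z s \<inter> space M
        = {\<omega> \<in> space M. Z 0 \<omega> = z 0 \<and> (\<forall>k<n. s k < S k \<omega> \<and> Z (Suc k) \<omega> = z (Suc k))}"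
      by (auto simp: cyl_def W_def)
    ultimately show "measure (distr M seqM W) (cyl n z s)
        = (if z 0 = i then \<Prod>k<n. exp (- lam $ z k * s k) * Q $ z k $ z (Suc k) else 0)"
      by (subst measure_distr[OF W sets_cyl]) (simp add: law)
  qed simp
  then show thesis
    by (rule that[OF W]) (use path in \<open>simp add: W_def jump_time_def\<close>)
qed

locale drawup_model = level_phase_model c lam p Q P X J
  for c lam p :: "real^'e::finite" and Q :: "real^'e^'e" and P :: "real \<Rightarrow> 'e \<Rightarrow> 'w measure"
    and X J +
  fixes w a :: real
  assumes w_pos: "0 < w" and a_pos: "0 < a"
begin

text \<open>The law of the jump chain depends on the starting phase but not on the starting level.
  Its existence is read off the given process started at level 0.\<close>

definition mu :: "'e \<Rightarrow> (nat \<Rightarrow> 'e \<times> real) measure" where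
  "mu i = (SOME \<mu>. chain_law lam Q i \<mu>)"

lemma chain_law_mu: "chain_law lam Q i (mu i)"
proof -
  obtain W where "chain_law lam Q i (distr (P 0 i) seqM W)"
    using level_phase_process_chain[OF process Q_stochastic] by (metis order_refl)
  then show ?thesis unfolding mu_def by (rule someI)
qed

end

sublocale drawup_model \<subseteq> drawup_chain lam Q mu c p w a
  by unfold_locales (rule lam_pos Q_stochastic chain_law_mu c_pos p_range w_pos a_pos)+

context drawup_model
begin

lemma coupling:
  assumes x: "0 \<le> x"
  obtains W where "W \<in> measurable (P x i) seqM" "distr (P x i) seqM W = mu i"
    "AE \<eta> in P x i. tracks X J \<eta> x (W \<eta>)"
proof -
  obtain W where W: "W \<in> measurable (P x i) seqM" "chain_law lam Q i (distr (P x i) seqM W)"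
    and path: "AE \<eta> in P x i. \<forall>n t. jump_time (W \<eta>) n \<le> t \<and> t < jump_time (W \<eta>) (Suc n) \<longrightarrow>
        J t \<eta> = fst (W \<eta> n) \<and>
        X t \<eta> = post_jump_level c p x (\<lambda>k. fst (W \<eta> k)) (\<lambda>k. snd (W \<eta> k)) n
          + (t - jump_time (W \<eta>) n) / c $ fst (W \<eta> n)"
    by (rule level_phase_process_chain[OF process[OF x] Q_stochastic])
  have d: "distr (P x i) seqM W = mu i"
    by (rule chain_law_unique[OF W(2) chain_law_mu])
  have "AE \<eta> in P x i. \<forall>n. 0 < snd (W \<eta> n)" "AE \<eta> in P x i. \<forall>t. \<exists>n. t < jump_time (W \<eta>) n"
    using AE_mu_pos[of i] AE_mu_unbounded[of i] unfolding d[symmetric] by (auto intro: AE_distrD[OF W(1)])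
  with path have "AE \<eta> in P x i. tracks X J \<eta> x (W \<eta>)"
    by eventually_elim (simp add: tracks_def lev_def)
  with W(1) d show thesis by (rule that)
qed

lemma H_mat_eq:
  assumes u: "0 < u"
  shows "H_mat P X J w a u $ k $ j = G j k u u"
proof -
  obtain W where W: "W \<in> measurable (P u k) seqM" "distr (P u k) seqM W = mu k"
    "AE \<eta> in P u k. tracks X J \<eta> u (W \<eta>)"
    using coupling[of u k] u by auto
  have m: "(\<lambda>\<eta>. xi j u u (W \<eta>)) \<in> borel_measurable (P u k)"
    by (rule measurable_xi[OF _ _ W(1)]) auto
  have eq: "AE \<eta> in P u k. (let \<tau> = drawup_time X u a \<eta> in
           if \<tau> < \<infinity> \<and> J (real_of_ereal \<tau>) \<eta> = j then exp (- w * real_of_ereal \<tau>) else 0) = xi j u u (W \<eta>)"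
    using W(3) by eventually_elim (rule xi_eq_drawup[symmetric], auto simp: u a_pos)
  have "H_mat P X J w a u $ k $ j = (\<integral>\<eta>. xi j u u (W \<eta>) \<partial>P u k)"
    using integral_completion_AE[OF m eq] by (simp add: H_mat_def)
  also have "\<dots> = (\<integral>\<omega>. xi j u u \<omega> \<partial>mu k)"
    unfolding W(2)[symmetric] by (rule integral_distr[OF W(1), symmetric]) simp
  finally show ?thesis by (simp add: G_def)
qed

text \<open>The weight \<open>exp (- L * (y - x))\<close> is the integrating factor of the linear
  term. Integration from \<open>x\<close> to \<open>v + a\<close> brings in the boundary value, and
  the substitution \<open>y = x + s / c $ i\<close> turns the level into the holding time that
  occurs in \<open>G_equation\<close>.\<close>

lemma bvp_has_integral:
  fixes i j :: 'e
  assumes bvp: "solves_bvp c lam p Q w a (H_mat P X J w a) v f" and v: "0 < v" and x: "v \<le> x" "x \<le> v + a"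
  defines "K \<equiv> \<lambda>k y. if y < v then G j k y y else f y $ k $ j"
  defines "d \<equiv> c $ i * (v + a - x)"
  shows "((\<lambda>s. lam $ i * exp (- (w + lam $ i) * s) * (\<Sum>k\<in>UNIV. Q $ i $ k * K k (p $ i * (x + s / c $ i))))
    has_integral (f x $ i $ j - exp (- (w + lam $ i) * d) * of_bool (i = j))) {0..d}"
proof -
  define L where "L = (w + lam $ i) * c $ i"
  have L: "0 < L" using w_pos lam_pos[of i] c_pos[of i] by (simp add: L_def)
  define e where "e y = exp (- L * (y - x))" for y
  define \<phi> where "\<phi> y = e y * f y $ i $ j" for y
  define g where "g y = - (c $ i * lam $ i * e y * (\<Sum>k\<in>UNIV. Q $ i $ k * K k (p $ i * y)))" for y
  obtain B where B: "\<And>y. v \<le> y \<Longrightarrow> y \<le> v + a \<Longrightarrow> norm (f y) \<le> B" and B0: "0 \<le> B"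
  proof -
    have "bounded (f ` {v..v+a})" using bvp by (simp add: solves_bvp_def)
    then obtain B where "\<forall>y\<in>{v..v+a}. norm (f y) \<le> B" by (auto simp: bounded_iff)
    with that[of B] a_pos show thesis by (metis atLeastAtMost_iff less_eq_real_def less_add_same_cancel1 norm_ge_zero order_trans)
  qed
  have comp: "\<bar>A $ i $ j\<bar> \<le> norm A" for A :: "real^'e^'e"
    using Finite_Cartesian_Product.norm_nth_le[of A i] component_le_norm_cart[of "A $ i" j] by simp
  have AC: "absolutely_continuous_between x (v + a) \<phi>"
  proof (rule absolutely_continuous_between_dominated[where C = 1 and K = "B * L"])
    show "absolutely_continuous_between x (v + a) f"
      using bvp x by (auto simp: solves_bvp_def intro: absolutely_continuous_between_subset)
    fix y z assume yz: "x \<le> y" "y \<le> z" "z \<le> v + a"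
    have e1: "0 \<le> e z" "e z \<le> 1" using yz L by (simp_all add: e_def)
    have "e y - e z = e y * (1 - exp (- (L * (z - y))))"
      by (simp add: e_def right_diff_distrib exp_add[symmetric] algebra_simps)
    moreover have "0 \<le> e y" "e y \<le> 1" using yz L by (simp_all add: e_def)
    moreover have "0 \<le> 1 - exp (- (L * (z - y)))" "1 - exp (- (L * (z - y))) \<le> L * (z - y)"
      using exp_ge_add_one_self[of "- (L * (z - y))"] yz L by auto
    moreover have "e z \<le> e y" using yz L by (simp add: e_def)
    ultimately have e2: "\<bar>e z - e y\<bar> \<le> L * (z - y)"
      using mult_left_le_one_le[of "1 - exp (- (L * (z - y)))" "e y"] by (simp add: abs_if)
    have "\<phi> z - \<phi> y = e z * (f z - f y) $ i $ j + (e z - e y) * f y $ i $ j"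
      by (simp add: \<phi>_def algebra_simps)
    then have "\<bar>\<phi> z - \<phi> y\<bar> \<le> \<bar>e z\<bar> * \<bar>(f z - f y) $ i $ j\<bar> + \<bar>e z - e y\<bar> * \<bar>f y $ i $ j\<bar>"
      by (metis abs_mult abs_triangle_ineq)
    also have "\<dots> \<le> 1 * norm (f z - f y) + (L * (z - y)) * B"
      using e1 e2 comp[of "f z - f y"] order_trans[OF comp B[of y]] x yz L by (intro add_mono mult_mono) auto
    finally show "norm (\<phi> z - \<phi> y) \<le> 1 * norm (f z - f y) + B * L * (z - y)" by (simp add: mult_ac)
  qed (use B0 L in auto)
  have "AE y in lborel. v < y \<and> y < v + a \<longrightarrow> (\<phi> has_vector_derivative g y) (at y)"
  proof -
    have "AE y in lborel. v < y \<and> y < v + a \<longrightarrow> (\<forall>i. \<exists>D.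
        ((\<lambda>y. row i (f y)) has_vector_derivative D) (at y) \<and>
        (1 / c $ i) *\<^sub>R D - (w + lam $ i) *\<^sub>R row i (f y)
          + lam $ i *\<^sub>R (\<Sum>k\<in>UNIV. Q $ i $ k *\<^sub>R
              row k (if p $ i * y < v then H_mat P X J w a (p $ i * y) else f (p $ i * y))) = 0)"
      using bvp by (simp add: solves_bvp_def)
    then show ?thesis
    proof eventually_elim
      case (elim y)
      show ?case
      proof
        assume y: "v < y \<and> y < v + a"
        then obtain D where D: "((\<lambda>y. row i (f y)) has_vector_derivative D) (at y)"
          and eq: "(1 / c $ i) *\<^sub>R D - (w + lam $ i) *\<^sub>R row i (f y)
          + lam $ i *\<^sub>R (\<Sum>k\<in>UNIV. Q $ i $ k *\<^sub>R
              row k (if p $ i * y < v then H_mat P X J w a (p $ i * y) else f (p $ i * y))) = 0"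
          using elim by blast
        have "0 < p $ i * y" using p_range[of i] y v by simp
        then have "row k (if p $ i * y < v then H_mat P X J w a (p $ i * y) else f (p $ i * y)) $ j = K k (p $ i * y)" for k
          by (simp add: row_def K_def H_mat_eq)
        then have "D $ j / c $ i - (w + lam $ i) * f y $ i $ j + lam $ i * (\<Sum>k\<in>UNIV. Q $ i $ k * K k (p $ i * y)) = 0"
          using arg_cong[OF eq, of "\<lambda>u. u $ j"] by (simp add: row_def)
        then have Dj: "D $ j = L * f y $ i $ j - c $ i * lam $ i * (\<Sum>k\<in>UNIV. Q $ i $ k * K k (p $ i * y))"
          using c_pos[of i] by (simp add: L_def field_simps)
        have "((\<lambda>y. row i (f y) $ j) has_vector_derivative D $ j) (at y)"
          by (rule bounded_linear.has_vector_derivative[OF bounded_linear_vec_nth D])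
        then have "((\<lambda>y. f y $ i $ j) has_real_derivative D $ j) (at y)"
          by (simp add: row_def has_real_derivative_iff_has_vector_derivative)
        moreover have "(e has_real_derivative (- L * e y)) (at y)"
          unfolding e_def by (auto intro!: derivative_eq_intros)
        ultimately have "(\<phi> has_real_derivative (- L * e y) * f y $ i $ j + D $ j * e y) (at y)"
          unfolding \<phi>_def by (rule DERIV_mult[rotated])
        moreover have "(- L * e y) * f y $ i $ j + D $ j * e y = g y"
          unfolding Dj g_def by (simp add: algebra_simps)
        ultimately show "(\<phi> has_vector_derivative g y) (at y)"
          by (simp add: has_real_derivative_iff_has_vector_derivative)
      qed
    qed
  qed
  then obtain N where N: "negligible N" "\<And>y. y \<notin> N \<Longrightarrow> v < y \<and> y < v + a \<longrightarrow> (\<phi> has_vector_derivative g y) (at y)"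
    by (auto elim!: AE_E3 simp: negligible_iff_null_sets dest: null_sets_completionI)
  have "(g has_integral \<phi> (v + a) - \<phi> x) {x..v + a}"
    by (rule absolutely_continuous_has_integral[OF x(2) AC N(1)]) (use N(2) x in auto)
  moreover have "\<phi> x = f x $ i $ j" by (simp add: \<phi>_def e_def)
  moreover have "\<phi> (v + a) = exp (- (w + lam $ i) * d) * of_bool (i = j)"
  proof -
    have "f (v + a) = mat 1" using bvp by (simp add: solves_bvp_def)
    moreover have "- L * (v + a - x) = - (w + lam $ i) * d" by (simp add: L_def d_def algebra_simps)
    ultimately show ?thesis by (simp add: \<phi>_def e_def mat_def)
  qed
  ultimately have "(g has_integral exp (- (w + lam $ i) * d) * of_bool (i = j) - f x $ i $ j) (cbox x (v + a))" by simp
  from has_integral_affinity'[OF this, of "1 / c $ i" x] c_pos[of i]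
  have "((\<lambda>s. g (s / c $ i + x)) has_integral c $ i * (exp (- (w + lam $ i) * d) * of_bool (i = j) - f x $ i $ j)) {0..d}"
    by (simp add: d_def mult.commute)
  from has_integral_mult_right[OF this, of "- 1 / c $ i"] c_pos[of i]
  have "((\<lambda>s. - 1 / c $ i * g (s / c $ i + x)) has_integral f x $ i $ j - exp (- (w + lam $ i) * d) * of_bool (i = j)) {0..d}"
    by simp
  moreover have "- 1 / c $ i * g (s / c $ i + x) =
     lam $ i * exp (- (w + lam $ i) * s) * (\<Sum>k\<in>UNIV. Q $ i $ k * K k (p $ i * (x + s / c $ i)))" for s
    using c_pos[of i] by (simp add: g_def e_def L_def algebra_simps)
  ultimately show ?thesis by simp
qed

text \<open>The boundary terms cancel, and so do the contributions of post-jump levels below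
  \<open>v\<close>, where both kernels are \<open>G j k y y\<close>. The remaining weight
  \<open>lam $ i * exp (- (w + lam $ i) * s)\<close> has mass at most
  \<open>lam $ i / (w + lam $ i)\<close>.\<close>

lemma bvp_solution_contraction:
  fixes i j :: 'e
  assumes bvp: "solves_bvp c lam p Q w a (H_mat P X J w a) v f" and v: "0 < v" and x: "v \<le> x" "x \<le> v + a"
    and M: "\<And>k y. v \<le> y \<Longrightarrow> y \<le> v + a \<Longrightarrow> \<bar>f y $ k $ j - G j k y v\<bar> \<le> M"
  shows "\<bar>f x $ i $ j - G j i x v\<bar> \<le> lam $ i / (w + lam $ i) * M"
proof -
  define d where "d = c $ i * (v + a - x)"
  define y where "y s = p $ i * (x + s / c $ i)" for s
  define K where "K k y = (if y < v then G j k y y else f y $ k $ j)" for k y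
  let ?e = "\<lambda>s. lam $ i * exp (- (w + lam $ i) * s)"
  have M0: "0 \<le> M" using M[of v] a_pos by (meson abs_ge_zero less_add_same_cancel1 less_imp_le order_refl order_trans)
  have wl: "0 < w + lam $ i" using w_pos lam_pos[of i] by simp
  have d0: "0 \<le> d" using x c_pos[of i] by (simp add: d_def)
  have x0: "0 < x" using v x by simp
  note Geq = G_equation[where i = i and j = j, OF x0 x(2), folded d_def, folded y_def]
  have "((\<lambda>s. indicator {0..d} s * (?e s * (\<Sum>k\<in>UNIV. Q $ i $ k * G j k (y s) (min v (y s)))))
     has_integral G j i x v - exp (- (w + lam $ i) * d) * of_bool (i = j)) UNIV"
    using has_integral_integral_lborel[OF Geq(1)] Geq(2) by simp
  then have G: "((\<lambda>s. ?e s * (\<Sum>k\<in>UNIV. Q $ i $ k * G j k (y s) (min v (y s))))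
     has_integral G j i x v - exp (- (w + lam $ i) * d) * of_bool (i = j)) {0..d}"
    by (subst has_integral_restrict_UNIV[symmetric], elim has_integral_eq[rotated]) (simp add: indicator_def)
  have F: "((\<lambda>s. ?e s * (\<Sum>k\<in>UNIV. Q $ i $ k * K k (y s)))
    has_integral (f x $ i $ j - exp (- (w + lam $ i) * d) * of_bool (i = j))) {0..d}"
    using bvp_has_integral[where i = i and j = j, OF bvp v x] by (simp add: d_def K_def y_def)
  let ?D = "\<lambda>s. ?e s * (\<Sum>k\<in>UNIV. Q $ i $ k * K k (y s)) - ?e s * (\<Sum>k\<in>UNIV. Q $ i $ k * G j k (y s) (min v (y s)))"
  have D: "(?D has_integral f x $ i $ j - G j i x v) {0..d}"
    using has_integral_diff[OF F G] by simp
  have bound: "\<bar>?D s\<bar> \<le> ?e s * M" if s: "s \<in> {0..d}" for s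
  proof -
    have sc: "0 \<le> s / c $ i" "s / c $ i \<le> v + a - x"
      using s c_pos[of i] by (simp_all add: d_def pos_divide_le_eq mult.commute)
    then have "y s \<le> v + a" using order_trans[OF jump_le[of "x + s / c $ i" i], of "v + a"] x0 by (simp add: y_def)
    then have "\<bar>K k (y s) - G j k (y s) (min v (y s))\<bar> \<le> M" for k
      using M[of "y s" k] M0 by (auto simp: K_def min_def)
    then have "\<bar>\<Sum>k\<in>UNIV. Q $ i $ k * (K k (y s) - G j k (y s) (min v (y s)))\<bar> \<le> (\<Sum>k\<in>UNIV. Q $ i $ k * M)"
      by (intro order_trans[OF sum_abs] sum_mono) (simp add: abs_mult Q_nonneg mult_left_mono)
    also have "\<dots> = M" by (simp add: Q_sum flip: sum_distrib_right)
    finally have "\<bar>?e s * (\<Sum>k\<in>UNIV. Q $ i $ k * (K k (y s) - G j k (y s) (min v (y s))))\<bar> \<le> ?e s * M"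
      using lam_pos[of i] by (simp add: abs_mult mult_left_mono)
    then show ?thesis by (simp add: right_diff_distrib sum_subtractf)
  qed
  have E: "((\<lambda>s. ?e s * M) has_integral (lam $ i / (w + lam $ i) * M * (1 - exp (- (w + lam $ i) * d)))) {0..d}"
  proof -
    have "((\<lambda>s. ?e s * M) has_integral
        (- (lam $ i / (w + lam $ i) * M * exp (- (w + lam $ i) * d)) - - (lam $ i / (w + lam $ i) * M * exp (- (w + lam $ i) * 0)))) {0..d}"
    proof (rule fundamental_theorem_of_calculus[OF d0])
      fix s assume "s \<in> {0..d}"
      have "((\<lambda>s. - (b / l * M * exp (- l * s))) has_real_derivative b * exp (- l * s) * M) (at s within {0..d})"
        if "0 < l" for b l :: real
        using that by (auto intro!: derivative_eq_intros)
      from this[OF wl]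
      have "((\<lambda>s. - (lam $ i / (w + lam $ i) * M * exp (- (w + lam $ i) * s))) has_real_derivative ?e s * M) (at s within {0..d})" .
      then show "((\<lambda>s. - (lam $ i / (w + lam $ i) * M * exp (- (w + lam $ i) * s))) has_vector_derivative ?e s * M) (at s within {0..d})"
        by (simp add: has_real_derivative_iff_has_vector_derivative)
    qed
    then show ?thesis by (simp add: algebra_simps)
  qed
  have "f x $ i $ j - G j i x v \<le> lam $ i / (w + lam $ i) * M * (1 - exp (- (w + lam $ i) * d))"
    by (rule has_integral_le[OF D E]) (use bound in \<open>auto simp: abs_le_iff\<close>)
  moreover have "- (f x $ i $ j - G j i x v) \<le> lam $ i / (w + lam $ i) * M * (1 - exp (- (w + lam $ i) * d))"
    by (rule has_integral_le[OF has_integral_neg[OF D] E]) (use bound in \<open>auto simp: abs_le_iff\<close>)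
  moreover have "lam $ i / (w + lam $ i) * M * (1 - exp (- (w + lam $ i) * d)) \<le> lam $ i / (w + lam $ i) * M * 1"
    using M0 wl lam_pos[of i] by (intro mult_left_mono mult_nonneg_nonneg divide_nonneg_pos) auto
  ultimately show ?thesis by (simp add: abs_le_iff)
qed

text \<open>The contraction is iterated, starting from boundedness of the solution; in passing this
  shows that a bounded solution is unique on the interval.\<close>

lemma bvp_solution_eq_G:
  assumes bvp: "solves_bvp c lam p Q w a (H_mat P X J w a) v f" and v: "0 < v" and x: "v \<le> x" "x \<le> v + a"
  shows "f x $ i $ j = G j i x v"
proof -
  define \<rho> where "\<rho> = Max (range (\<lambda>i. lam $ i / (w + lam $ i)))"
  have \<rho>: "lam $ i / (w + lam $ i) \<le> \<rho>" for i
    unfolding \<rho>_def by (rule Max_ge) auto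
  have "\<rho> \<in> range (\<lambda>i. lam $ i / (w + lam $ i))"
    unfolding \<rho>_def by (rule Max_in) auto
  then have \<rho>1: "0 \<le> \<rho>" "\<rho> < 1" using lam_pos w_pos by (auto simp: less_imp_le add_pos_pos divide_simps)
  have "bounded (f ` {v..v+a})" using bvp by (simp add: solves_bvp_def)
  then obtain B where B: "\<forall>y\<in>{v..v+a}. norm (f y) \<le> B" by (auto simp: bounded_iff)
  \<comment> \<open>\<open>B + 1\<close> bounds the initial distance, because the entries of
    \<open>f\<close> are at most \<open>B\<close> in modulus and \<open>G\<close> lies in
    \<open>{0..1}\<close>.\<close>
  have "\<forall>i x. v \<le> x \<and> x \<le> v + a \<longrightarrow> \<bar>f x $ i $ j - G j i x v\<bar> \<le> \<rho> ^ n * (B + 1)" for n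
  proof (induction n)
    case 0
    show ?case
    proof (intro allI impI)
      fix i x assume x: "v \<le> x \<and> x \<le> v + a"
      have "\<bar>f x $ i $ j\<bar> \<le> B"
        using Finite_Cartesian_Product.norm_nth_le[of "f x" i] component_le_norm_cart[of "f x $ i" j] bspec[OF B, of x] x by simp
      moreover have "0 \<le> G j i x v" "G j i x v \<le> 1" using G_bounds[of x v j i] x v by auto
      ultimately show "\<bar>f x $ i $ j - G j i x v\<bar> \<le> \<rho> ^ 0 * (B + 1)" by (simp add: abs_le_iff)
    qed
  next
    case (Suc n)
    show ?case
    proof (intro allI impI)
      fix i x assume x: "v \<le> x \<and> x \<le> v + a"
      have M0: "0 \<le> \<rho> ^ n * (B + 1)" using Suc x by (meson abs_ge_zero order_trans)
      have "\<bar>f x $ i $ j - G j i x v\<bar> \<le> lam $ i / (w + lam $ i) * (\<rho> ^ n * (B + 1))"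
        by (rule bvp_solution_contraction[OF bvp v]) (use x Suc in auto)
      also have "\<dots> \<le> \<rho> * (\<rho> ^ n * (B + 1))" by (rule mult_right_mono[OF \<rho> M0])
      finally show "\<bar>f x $ i $ j - G j i x v\<bar> \<le> \<rho> ^ Suc n * (B + 1)" by (simp add: mult_ac)
    qed
  qed
  then have le: "\<bar>f x $ i $ j - G j i x v\<bar> \<le> \<rho> ^ n * (B + 1)" for n using x by blast
  have "(\<lambda>n. \<rho> ^ n * (B + 1)) \<longlonglongrightarrow> 0 * (B + 1)"
    using \<rho>1 by (intro tendsto_mult_right LIMSEQ_realpow_zero) auto
  from LIMSEQ_le_const[OF this, of "\<bar>f x $ i $ j - G j i x v\<bar>"] le show ?thesis by auto
qed

end

section \<open>The martingale property\<close>

text \<open>Generators of the completed natural filtration before the right limit is taken.\<close>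

definition augmented_events ::
  "'w measure \<Rightarrow> (real \<Rightarrow> 'w \<Rightarrow> real) \<Rightarrow> (real \<Rightarrow> 'w \<Rightarrow> 'e) \<Rightarrow> real \<Rightarrow> 'w set set" where
  "augmented_events M X J u =
     (\<Union>s\<in>{0..u}. sets (vimage_algebra (space M) (\<lambda>\<omega>. (X s \<omega>, J s \<omega>)) (borel \<Otimes>\<^sub>M count_space UNIV)))
       \<union> null_sets (completion M)"

lemma sets_vimage_pair:
  "sets (vimage_algebra (space M) (\<lambda>\<omega>. (X s \<omega>, J s \<omega>)) (borel \<Otimes>\<^sub>M count_space UNIV))
    = {(\<lambda>\<omega>. (X s \<omega>, J s \<omega>)) -` C \<inter> space M |C. C \<in> sets (borel \<Otimes>\<^sub>M count_space UNIV)}"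
  by (rule sets_vimage_algebra2) (simp add: space_pair_measure)

lemma augmented_events_mono: "u \<le> u' \<Longrightarrow> augmented_events M X J u \<subseteq> augmented_events M X J u'"
  unfolding augmented_events_def by (intro Un_mono UN_mono) auto

lemma augmented_events_Pow: "augmented_events M X J u \<subseteq> Pow (space M)"
  unfolding augmented_events_def sets_vimage_pair
  using sets.sets_into_space[of _ "completion M"] by (auto dest: null_setsD2)

lemma sets_augmented_filtration:
  "sets (augmented_filtration M X J t) = sigma_sets (space M) (\<Inter>u\<in>{t<..}. sigma_sets (space M) (augmented_events M X J u))"
proof -
  have "(\<Inter>u\<in>{t<..}. sigma_sets (space M) (augmented_events M X J u)) \<subseteq> Pow (space M)"
  proof
    fix A assume "A \<in> (\<Inter>u\<in>{t<..}. sigma_sets (space M) (augmented_events M X J u))"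
    then have "A \<in> sigma_sets (space M) (augmented_events M X J (t + 1))" by simp
    then show "A \<in> Pow (space M)" using sigma_sets_into_sp[OF augmented_events_Pow] by blast
  qed
  then show ?thesis
    unfolding augmented_filtration_def augmented_events_def[symmetric] by (rule sets_measure_of)
qed

lemma augmented_filtrationD:
  assumes "A \<in> sets (augmented_filtration M X J t)" "t < u"
  shows "A \<in> sigma_sets (space M) (augmented_events M X J u)"
proof -
  have "sigma_sets (space M) (\<Inter>u\<in>{t<..}. sigma_sets (space M) (augmented_events M X J u))
      \<subseteq> sigma_sets (space M) (sigma_sets (space M) (augmented_events M X J u))"
    using assms(2) by (intro sigma_sets_mono') auto
  then show ?thesis
    using assms(1) unfolding sets_augmented_filtration
    by (simp add: sigma_sets_sigma_sets_eq[OF augmented_events_Pow] subset_iff)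
qed

lemma sigma_augmented_events_subset:
  "sigma_sets (space M) (augmented_events M X J t) \<subseteq> sets (augmented_filtration M X J t)"
proof -
  have "sigma_sets (space M) (augmented_events M X J t) \<subseteq> (\<Inter>u\<in>{t<..}. sigma_sets (space M) (augmented_events M X J u))"
    by (intro INT_greatest sigma_sets_mono' augmented_events_mono) simp
  then show ?thesis unfolding sets_augmented_filtration by (auto intro: sigma_sets.Basic)
qed

lemma space_augmented_filtration: "space (augmented_filtration M X J t) = space M"
  by (simp add: augmented_filtration_def space_measure_of_conv)

lemma filtration_augmented: "filtration (space M) (augmented_filtration M X J)"
proof
  fix i j :: real assume "i \<le> j"
  then show "sets (augmented_filtration M X J i) \<subseteq> sets (augmented_filtration M X J j)"
    unfolding sets_augmented_filtration by (intro sigma_sets_mono' INT_anti_mono) auto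
qed (rule space_augmented_filtration)

lemma subalgebra_augmented:
  assumes X: "\<And>t. 0 \<le> t \<Longrightarrow> X t \<in> borel_measurable M"
    and J: "\<And>t. 0 \<le> t \<Longrightarrow> J t \<in> measurable M (count_space UNIV)"
  shows "subalgebra (completion M) (augmented_filtration M X J t)"
  unfolding subalgebra_def
proof (intro conjI)
  show "space (augmented_filtration M X J t) = space (completion M)"
    by (simp add: space_augmented_filtration)
  have "augmented_events M X J u \<subseteq> sets (completion M)" for u
  proof -
    have "(\<lambda>\<omega>. (X s \<omega>, J s \<omega>)) -` C \<inter> space M \<in> sets (completion M)"
      if "0 \<le> s" "C \<in> sets (borel \<Otimes>\<^sub>M count_space UNIV)" for s C
      using measurable_sets[OF measurable_Pair[OF X J] that(2)] that(1) by auto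
    then show ?thesis unfolding augmented_events_def sets_vimage_pair by auto
  qed
  then have "sigma_sets (space M) (augmented_events M X J (t + 1)) \<subseteq> sets (completion M)"
    using sets.sigma_sets_subset[of "augmented_events M X J (t + 1)" "completion M"] by simp
  then show "sets (augmented_filtration M X J t) \<subseteq> sets (completion M)"
    using augmented_filtrationD[of _ M X J t "t + 1"] by auto
qed

lemma Pair_measurable_augmented:
  assumes "0 \<le> s" "s \<le> t"
  shows "(\<lambda>\<omega>. (X s \<omega>, J s \<omega>)) \<in> measurable (sigma (space M) (augmented_events M X J t)) (borel \<Otimes>\<^sub>M count_space UNIV)"
proof (rule measurableI)
  fix C :: "(real \<times> 'b) set" assume C: "C \<in> sets (borel \<Otimes>\<^sub>M count_space UNIV)"
  then have "(\<lambda>\<omega>. (X s \<omega>, J s \<omega>)) -` C \<inter> space M \<in> augmented_events M X J t"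
    unfolding augmented_events_def sets_vimage_pair using assms by auto
  then show "(\<lambda>\<omega>. (X s \<omega>, J s \<omega>)) -` C \<inter> space (sigma (space M) (augmented_events M X J t))
      \<in> sets (sigma (space M) (augmented_events M X J t))"
    using augmented_events_Pow[of M X J t] by (auto simp: space_measure_of_conv)
qed (simp add: space_pair_measure)

text \<open>All subsets of null sets are events, so a change on a null set does not destroy
  adaptedness.\<close>

lemma measurable_augmented_AE:
  fixes f g :: "'w \<Rightarrow> 'b::topological_space"
  assumes g: "g \<in> borel_measurable (sigma (space M) (augmented_events M X J t))"
    and eq: "AE \<omega> in M. f \<omega> = g \<omega>"
  shows "f \<in> borel_measurable (sigma (space M) (augmented_events M X J t))" (is "_ \<in> borel_measurable ?S")
proof (rule measurableI)
  have sp: "space ?S = space M" by (simp add: space_measure_of_conv)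
  define N where "N = {\<omega> \<in> space M. \<not> f \<omega> = g \<omega>}"
  have N: "N \<in> null_sets (completion M)"
    using AE_completion[OF eq] unfolding completion.AE_iff_null_sets by (simp add: N_def)
  have null: "B \<in> sets ?S" if "B \<subseteq> N" for B
  proof -
    have "B \<in> augmented_events M X J t"
      unfolding augmented_events_def using null_sets_completion_subset[OF that N] by simp
    then show ?thesis using augmented_events_Pow[of M X J t] by auto
  qed
  fix A :: "'b set" assume "A \<in> sets borel"
  then have gA: "g -` A \<inter> space M \<in> sets ?S" using measurable_sets[OF g] sp by simp
  have "(g -` A \<inter> space M - N) \<union> (f -` A \<inter> N) \<in> sets ?S"
    by (rule sets.Un[OF sets.Diff[OF gA null[OF order_refl]] null]) simp
  moreover have "f -` A \<inter> space M = (g -` A \<inter> space M - N) \<union> (f -` A \<inter> N)"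
    by (auto simp: N_def)
  ultimately show "f -` A \<inter> space ?S \<in> sets ?S" by (simp add: sp)
qed simp

context drawup_model
begin

section \<open>Past events in terms of the jump chain\<close>

lemma history_cong:
  "history n B \<Longrightarrow> fst (\<omega> n) = fst (\<omega>' n) \<Longrightarrow> \<forall>k<n. \<omega> k = \<omega>' k \<Longrightarrow> \<omega> \<in> B \<longleftrightarrow> \<omega>' \<in> B"
  unfolding history_def by blast

lemma historyI:
  assumes "B \<in> sets seqM"
    and "\<And>\<omega> \<omega>'. fst (\<omega> n) = fst (\<omega>' n) \<Longrightarrow> \<forall>k<n. \<omega> k = \<omega>' k \<Longrightarrow> \<omega> \<in> B \<longleftrightarrow> \<omega>' \<in> B"
  shows "history n B"
  using assms unfolding history_def by blast

lemma history_sets: "history n B \<Longrightarrow> B \<in> sets seqM"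
  by (simp add: history_def)

lemma history_Compl:
  assumes "history n B"
  shows "history n (- B)"
proof (rule historyI)
  show "- B \<in> sets seqM"
    using sets.compl_sets[OF history_sets[OF assms]] by (simp add: Compl_eq_Diff_UNIV)
next
  fix \<omega> \<omega>' :: "nat \<Rightarrow> 'e \<times> real"
  assume "fst (\<omega> n) = fst (\<omega>' n)" "\<forall>k<n. \<omega> k = \<omega>' k"
  from history_cong[OF assms this] show "\<omega> \<in> - B \<longleftrightarrow> \<omega>' \<in> - B" by simp
qed

lemma history_UN:
  assumes "\<And>k::nat. history n (B k)"
  shows "history n (\<Union>k. B k)"
proof (rule historyI)
  show "(\<Union>k. B k) \<in> sets seqM" using history_sets[OF assms] by blast
next
  fix \<omega> \<omega>' :: "nat \<Rightarrow> 'e \<times> real"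
  assume "fst (\<omega> n) = fst (\<omega>' n)" "\<forall>k<n. \<omega> k = \<omega>' k"
  from history_cong[OF assms this] show "\<omega> \<in> (\<Union>k. B k) \<longleftrightarrow> \<omega>' \<in> (\<Union>k. B k)" by simp
qed

lemma history_INT:
  assumes "\<And>k::nat. history n (B k)"
  shows "history n (\<Inter>k. B k)"
  using history_Compl[OF history_UN[OF history_Compl[OF assms]]] by simp

text \<open>The segment \<open>m = n\<close> is left unbounded on the right, since the next jump
  time does not belong to the past. On the event of exactly \<open>n\<close> jumps by some later
  time this makes no difference.\<close>

lemma history_state:
  assumes C: "C \<in> sets (borel \<Otimes>\<^sub>M count_space UNIV)"
  shows "history n {\<omega>. \<exists>m\<le>n. jump_time \<omega> m \<le> s \<and> (m < n \<longrightarrow> s < jump_time \<omega> (Suc m)) \<and>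
     (lev x \<omega> m + (s - jump_time \<omega> m) / c $ fst (\<omega> m), fst (\<omega> m)) \<in> C}" (is "history n {\<omega>. \<exists>m\<le>n. ?P m \<omega>}")
  unfolding history_def
proof (intro conjI allI impI)
  have m: "(\<lambda>\<omega>. (lev x \<omega> m + (s - jump_time \<omega> m) / c $ fst (\<omega> m), fst (\<omega> m)))
      \<in> measurable seqM (borel \<Otimes>\<^sub>M count_space UNIV)" for m
    by measurable
  have "{\<omega> \<in> space seqM. (lev x \<omega> m + (s - jump_time \<omega> m) / c $ fst (\<omega> m), fst (\<omega> m)) \<in> C} \<in> sets seqM" for m
    using measurable_sets[OF m C] by (simp add: vimage_def)
  moreover have "{\<omega> \<in> space seqM. jump_time \<omega> m \<le> s} \<in> sets (seqM :: (nat \<Rightarrow> 'e \<times> real) measure)"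
    "{\<omega> \<in> space seqM. s < jump_time \<omega> (Suc m)} \<in> sets (seqM :: (nat \<Rightarrow> 'e \<times> real) measure)" for m
    by measurable
  ultimately have "{\<omega> \<in> space seqM. ?P m \<omega>} \<in> sets seqM" for m
    by (intro sets.sets_Collect_conj sets.sets_Collect_imp sets.sets_Collect_const)
  then have "{\<omega> \<in> space seqM. \<exists>m\<in>{..n}. ?P m \<omega>} \<in> sets seqM"
    by (intro sets.sets_Collect_countable_Ex') auto
  then show "{\<omega>. \<exists>m\<le>n. ?P m \<omega>} \<in> sets seqM" by (simp add: Bex_def)
  fix \<omega> \<omega>' :: "nat \<Rightarrow> 'e \<times> real"
  assume eq: "fst (\<omega> n) = fst (\<omega>' n)" "\<forall>k<n. \<omega> k = \<omega>' k"
  have J: "jump_time \<omega> m = jump_time \<omega>' m" if "m \<le> n" for m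
    using that eq(2) unfolding jump_time_def by (intro sum.cong) auto
  have L: "lev x \<omega> m = lev x \<omega>' m" if "m \<le> n" for m
    using that by (induction m) (use eq in \<open>auto simp: lev_Suc\<close>)
  have F: "fst (\<omega> m) = fst (\<omega>' m)" if "m \<le> n" for m
    using that eq by (cases "m = n") auto
  have "?P m \<omega> \<longleftrightarrow> ?P m \<omega>'" if "m \<le> n" for m
    using J[OF that] L[OF that] F[OF that] J[of "Suc m"] by auto
  then show "\<omega> \<in> {\<omega>. \<exists>m\<le>n. ?P m \<omega>} \<longleftrightarrow> \<omega>' \<in> {\<omega>. \<exists>m\<le>n. ?P m \<omega>}" by blast
qed

context
  fixes x v :: real and i :: 'e and W :: "'w \<Rightarrow> nat \<Rightarrow> 'e \<times> real"
  assumes v: "0 < v" "v \<le> x" "x < v + a"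
    and W: "W \<in> measurable (P x i) seqM" and distr_W: "distr (P x i) seqM W = mu i"
    and W_tracks: "AE \<eta> in P x i. tracks X J \<eta> x (W \<eta>)"
begin

abbreviation (input) M where "M \<equiv> P x i"

lemma process_measurable:
  shows "prob_space M" "0 \<le> t \<Longrightarrow> X t \<in> borel_measurable M"
    "0 \<le> t \<Longrightarrow> J t \<in> measurable M (count_space UNIV)"
  using process[of x i] v by (auto simp: level_phase_process_def)

text \<open>The events with such a representative form a sigma-algebra. State events are represented
  through \<open>history_state\<close>, null events by the empty set.\<close>

lemma events_history:
  assumes A: "A \<in> sigma_sets (space M) (augmented_events M X J u)"
  shows "\<exists>B. history n B \<and> (AE \<eta> in M. jump_time (W \<eta>) n \<le> u \<and> u < jump_time (W \<eta>) (Suc n) \<longrightarrow>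
      (\<eta> \<in> A \<longleftrightarrow> W \<eta> \<in> B))"
  using A
proof induction
  case (Basic A)
  then consider s C where "0 \<le> s" "s \<le> u" "C \<in> sets (borel \<Otimes>\<^sub>M count_space UNIV)"
      "A = (\<lambda>\<eta>. (X s \<eta>, J s \<eta>)) -` C \<inter> space M"
    | "A \<in> null_sets (completion M)"
    unfolding augmented_events_def sets_vimage_pair by auto
  then show ?case
  proof cases
    case 1
    let ?B = "{\<omega>. \<exists>m\<le>n. jump_time \<omega> m \<le> s \<and> (m < n \<longrightarrow> s < jump_time \<omega> (Suc m)) \<and>
       (lev x \<omega> m + (s - jump_time \<omega> m) / c $ fst (\<omega> m), fst (\<omega> m)) \<in> C}"
    have "AE \<eta> in M. jump_time (W \<eta>) n \<le> u \<and> u < jump_time (W \<eta>) (Suc n) \<longrightarrow> (\<eta> \<in> A \<longleftrightarrow> W \<eta> \<in> ?B)"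
      using W_tracks AE_space
    proof eventually_elim
      case (elim \<eta>)
      show ?case
      proof
        assume u: "jump_time (W \<eta>) n \<le> u \<and> u < jump_time (W \<eta>) (Suc n)"
        obtain m where m: "jump_time (W \<eta>) m \<le> s \<and> s < jump_time (W \<eta>) (Suc m)"
          using segment_ex[OF elim(1) v] 1 by blast
        have XJ: "X s \<eta> = lev x (W \<eta>) m + (s - jump_time (W \<eta>) m) / c $ fst (W \<eta> m)"
          "J s \<eta> = fst (W \<eta> m)"
          using segment_X[OF elim(1) v m] segment_J[OF elim(1) v m] by auto
        have mn: "m \<le> n"
          using jump_time_less[OF elim(1) v, of n m] u m 1 by (meson le_less_trans less_le_not_le linorder_not_le order_trans)
        have uniq: "m' = m" if "m' \<le> n" "jump_time (W \<eta>) m' \<le> s" "m' < n \<longrightarrow> s < jump_time (W \<eta>) (Suc m')" for m'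
        proof (rule segment_unique[OF elim(1) v])
          show "jump_time (W \<eta>) m' \<le> s \<and> s < jump_time (W \<eta>) (Suc m')"
            using that u 1 by (cases "m' = n") auto
        qed (rule m)
        have "W \<eta> \<in> ?B \<longleftrightarrow> (X s \<eta>, J s \<eta>) \<in> C"
          unfolding XJ using mn m uniq by blast
        then show "\<eta> \<in> A \<longleftrightarrow> W \<eta> \<in> ?B" using elim(2) 1 by auto
      qed
    qed
    with history_state[OF 1(3)] show ?thesis by blast
  next
    case 2
    then have "AE \<eta> in completion M. \<eta> \<notin> A" by (rule AE_not_in)
    then have "AE \<eta> in M. \<eta> \<notin> A" by (simp add: AE_completion_iff)
    moreover have "history n {}" by (simp add: history_def)
    ultimately show ?thesis by (intro exI[of _ "{}"]) auto
  qed
next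
  case Empty
  have "history n {}" by (simp add: history_def)
  then show ?case by (intro exI[of _ "{}"]) auto
next
  case (Compl A)
  then obtain B where B: "history n B" "AE \<eta> in M. jump_time (W \<eta>) n \<le> u \<and> u < jump_time (W \<eta>) (Suc n) \<longrightarrow> (\<eta> \<in> A \<longleftrightarrow> W \<eta> \<in> B)"
    by blast
  have "AE \<eta> in M. jump_time (W \<eta>) n \<le> u \<and> u < jump_time (W \<eta>) (Suc n) \<longrightarrow> (\<eta> \<in> space M - A \<longleftrightarrow> W \<eta> \<in> - B)"
    using B(2) AE_space by eventually_elim auto
  then show ?case using history_Compl[OF B(1)] by blast
next
  case (Union A)
  then have "\<forall>k. \<exists>B. history n B \<and> (AE \<eta> in M. jump_time (W \<eta>) n \<le> u \<and> u < jump_time (W \<eta>) (Suc n) \<longrightarrow> (\<eta> \<in> A k \<longleftrightarrow> W \<eta> \<in> B))"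
    by blast
  from choice[OF this] obtain B where B: "\<And>k. history n (B k)"
    "\<And>k. AE \<eta> in M. jump_time (W \<eta>) n \<le> u \<and> u < jump_time (W \<eta>) (Suc n) \<longrightarrow> (\<eta> \<in> A k \<longleftrightarrow> W \<eta> \<in> B k)"
    by blast
  have "AE \<eta> in M. \<forall>k. jump_time (W \<eta>) n \<le> u \<and> u < jump_time (W \<eta>) (Suc n) \<longrightarrow> (\<eta> \<in> A k \<longleftrightarrow> W \<eta> \<in> B k)"
    unfolding AE_all_countable by (intro allI B(2))
  then have "AE \<eta> in M. jump_time (W \<eta>) n \<le> u \<and> u < jump_time (W \<eta>) (Suc n) \<longrightarrow> (\<eta> \<in> (\<Union>k. A k) \<longleftrightarrow> W \<eta> \<in> (\<Union>k. B k))"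
    by eventually_elim auto
  with history_UN[OF B(1)] show ?case by (intro exI[of _ "\<Union>k. B k"] conjI)
qed

text \<open>The right limit in the filtration does no harm: a path that has made \<open>n\<close> jumps by time \<open>t\<close> has made
no further jump by time \<open>t + 1 / k\<close> for large \<open>k\<close>.\<close>

lemma filtration_history:
  assumes A: "A \<in> sets (augmented_filtration M X J t)"
  shows "\<exists>B. history n B \<and> (AE \<eta> in M. jump_time (W \<eta>) n \<le> t \<and> t < jump_time (W \<eta>) (Suc n) \<longrightarrow>
      (\<eta> \<in> A \<longleftrightarrow> W \<eta> \<in> B))"
proof -
  define u where "u k = t + 1 / real (Suc k)" for k
  have "A \<in> sigma_sets (space M) (augmented_events M X J (u k))" for k
    by (rule augmented_filtrationD[OF A]) (simp add: u_def)
  then have "\<forall>k. \<exists>B. history n B \<and> (AE \<eta> in M. jump_time (W \<eta>) n \<le> u k \<and> u k < jump_time (W \<eta>) (Suc n) \<longrightarrow> (\<eta> \<in> A \<longleftrightarrow> W \<eta> \<in> B))"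
    using events_history by blast
  from choice[OF this] obtain B where B: "\<And>k. history n (B k)"
    "\<And>k. AE \<eta> in M. jump_time (W \<eta>) n \<le> u k \<and> u k < jump_time (W \<eta>) (Suc n) \<longrightarrow> (\<eta> \<in> A \<longleftrightarrow> W \<eta> \<in> B k)"
    by blast
  have "AE \<eta> in M. \<forall>k. jump_time (W \<eta>) n \<le> u k \<and> u k < jump_time (W \<eta>) (Suc n) \<longrightarrow> (\<eta> \<in> A \<longleftrightarrow> W \<eta> \<in> B k)"
    using B(2) by (simp add: AE_all_countable)
  \<comment> \<open>An upper limit of the \<open>B k\<close> is formed because every
    \<open>B k\<close> with \<open>k\<close> beyond a path-dependent index \<open>K\<close> gives
    the same answer.\<close>
  then have "AE \<eta> in M. jump_time (W \<eta>) n \<le> t \<and> t < jump_time (W \<eta>) (Suc n) \<longrightarrow>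
      (\<eta> \<in> A \<longleftrightarrow> W \<eta> \<in> (\<Inter>K. \<Union>k. B (K + k)))"
  proof eventually_elim
    case (elim \<eta>)
    show ?case
    proof
      assume t: "jump_time (W \<eta>) n \<le> t \<and> t < jump_time (W \<eta>) (Suc n)"
      then obtain K where K: "1 / real (Suc K) < jump_time (W \<eta>) (Suc n) - t"
        using nat_approx_posE[of "jump_time (W \<eta>) (Suc n) - t"] by auto
      have "\<eta> \<in> A \<longleftrightarrow> W \<eta> \<in> B k" if "K \<le> k" for k
      proof (rule elim[rule_format], intro conjI)
        have "1 / real (Suc k) \<le> 1 / real (Suc K)" using that by (simp add: frac_le)
        with K show "u k < jump_time (W \<eta>) (Suc n)" by (simp add: u_def)
        have "0 \<le> 1 / real (Suc k)" by simp
        with t show "jump_time (W \<eta>) n \<le> u k" unfolding u_def by linarith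
      qed
      then show "\<eta> \<in> A \<longleftrightarrow> W \<eta> \<in> (\<Inter>K. \<Union>k. B (K + k))"
        by auto (metis le_add1 le_add2)+
    qed
  qed
  moreover have "history n (\<Inter>K. \<Union>k. B (K + k))"
    by (intro history_INT history_UN B)
  ultimately show ?thesis by (intro exI[of _ "\<Inter>K. \<Union>k. B (K + k)"] conjI)
qed

section \<open>The value process\<close>

context
  fixes V :: "real \<Rightarrow> 'w \<Rightarrow> real ^ 'e"
  assumes V: "AE \<eta> in M. \<forall>t n j. jump_time (W \<eta>) n \<le> t \<and> t < jump_time (W \<eta>) (Suc n) \<longrightarrow>
    V t \<eta> $ j = (if survive n x v t (W \<eta>) then Gstate j n x v t (W \<eta>) else xi j x v (W \<eta>))"
begin

text \<open>One null set serves all times at once, because the exceptional points are those where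
  the pathwise description fails.\<close>

lemma value_bounds: "AE \<eta> in M. \<forall>t\<ge>0. \<forall>j. 0 \<le> V t \<eta> $ j \<and> V t \<eta> $ j \<le> 1"
  using V W_tracks
proof eventually_elim
  case (elim \<eta>)
  note T = elim(2)
  note pos = holding_pos[OF T v]
  show ?case
  proof (intro allI impI)
    fix t :: real and j assume t: "0 \<le> t"
    obtain n where n: "jump_time (W \<eta>) n \<le> t \<and> t < jump_time (W \<eta>) (Suc n)"
      using segment_ex[OF T v t] by blast
    have x: "0 < x" "x \<le> v + a" using v by auto
    show "0 \<le> V t \<eta> $ j \<and> V t \<eta> $ j \<le> 1"
    proof (cases "survive n x v t (W \<eta>)")
      case True
      note st = survive_state[OF x pos True]
      have "exp (- w * t) \<le> 1" using w_pos t by simp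
      then have "0 \<le> Gstate j n x v t (W \<eta>) \<and> Gstate j n x v t (W \<eta>) \<le> 1"
        using G_bounds[OF st(1) less_imp_le[OF st(3)], of j "fst (W \<eta> n)"]
        by (simp add: Gstate_def mult_le_one)
      then show ?thesis using elim(1) n True by auto
    next
      case False
      then show ?thesis using elim(1) n xi_bounds[where \<omega> = "W \<eta>" and j = j, OF x pos] by auto
    qed
  qed
qed

text \<open>The running minimum and the drawup time are infima over uncountably many times. Almost
  surely the value agrees with an expression in countably many coordinates up to \<open>t\<close>,
  and completeness of the filtration absorbs the null set.\<close>

lemma value_adapted:
  assumes t: "0 \<le> t"
  shows "(\<lambda>\<eta>. V t \<eta> $ j) \<in> borel_measurable (augmented_filtration M X J t)"
proof -
  let ?S = "sigma (space M) (augmented_events M X J t)"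
  let ?D = "countable_times t"
  have D: "0 \<le> q" "q \<le> t" if "q \<in> ?D" for q using countable_times_bounds[OF t that] by auto
  have cD: "countable ?D" by (rule countable_countable_times)
  have tD: "t \<in> ?D" by (simp add: countable_times_def)
  have Xm: "X q \<in> borel_measurable ?S" and Jm: "J q \<in> measurable ?S (count_space UNIV)" if "q \<in> ?D" for q
    using measurable_compose[OF Pair_measurable_augmented[OF D[OF that]] measurable_fst]
      measurable_compose[OF Pair_measurable_augmented[OF D[OF that]] measurable_snd] by simp_all
  define r where "r q \<eta> = min v (INF r\<in>{r \<in> ?D. r \<le> q}. X r \<eta>)" for q \<eta>
  have rm: "r q \<in> borel_measurable ?S" for q
    unfolding r_def
    by (intro borel_measurable_min borel_measurable_const borel_measurable_cINF_real Xm)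
      (auto intro: countable_subset[OF _ cD])
  define h where "h q \<eta> \<longleftrightarrow> a \<le> X q \<eta> - r q \<eta>" for q \<eta>
  have hm: "Measurable.pred ?S (h q)" if "q \<in> ?D" for q
    unfolding h_def pred_def by (intro borel_measurable_le borel_measurable_const borel_measurable_diff Xm rm that)
  have Jp: "Measurable.pred ?S (\<lambda>\<eta>. J q \<eta> = j)" if "q \<in> ?D" for q
    using measurable_sets[OF Jm[OF that], of "{j}"] by (simp add: pred_def vimage_def Int_def conj_commute)
  have Ex: "Measurable.pred ?S (\<lambda>\<eta>. \<exists>q\<in>?D. R q \<eta>)" if "\<And>q. q \<in> ?D \<Longrightarrow> Measurable.pred ?S (R q)" for R
    using that cD unfolding pred_def by (intro sets.sets_Collect_countable_Ex')
  have All: "Measurable.pred ?S (\<lambda>\<eta>. \<forall>q\<in>?D. R q \<eta>)" if "\<And>q. q \<in> ?D \<Longrightarrow> Measurable.pred ?S (R q)" for R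
    using that cD unfolding pred_def by (intro sets.sets_Collect_countable_All')
  define g where "g \<eta> = (if \<exists>q\<in>?D. h q \<eta> then exp (- w * (INF q\<in>?D. if h q \<eta> then q else t)) *
          of_bool (\<exists>q\<in>?D. h q \<eta> \<and> J q \<eta> = j \<and> (\<forall>r\<in>?D. r \<le> q \<and> h r \<eta> \<longrightarrow> J r \<eta> = j))
       else exp (- w * t) * G j (J t \<eta>) (X t \<eta>) (r t \<eta>))" for \<eta>
  have "g \<in> borel_measurable ?S"
  proof -
    have [measurable]: "Measurable.pred ?S (\<lambda>\<eta>. \<exists>q\<in>?D. h q \<eta>)" by (rule Ex[OF hm])
    have [measurable]: "(\<lambda>\<eta>. INF q\<in>?D. if h q \<eta> then q else t) \<in> borel_measurable ?S"
    proof (rule borel_measurable_cINF_real[OF cD])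
      fix q assume "q \<in> ?D"
      note [measurable] = hm[OF this]
      show "(\<lambda>\<eta>. if h q \<eta> then q else t) \<in> borel_measurable ?S" by measurable
    qed
    have [measurable]: "Measurable.pred ?S (\<lambda>\<eta>. \<exists>q\<in>?D. h q \<eta> \<and> J q \<eta> = j \<and> (\<forall>r\<in>?D. r \<le> q \<and> h r \<eta> \<longrightarrow> J r \<eta> = j))"
      by (intro Ex pred_intros_logic All hm Jp) auto
    have "(\<lambda>\<eta>. G j (J t \<eta>) (X t \<eta>) (r t \<eta>)) \<in> borel_measurable ?S"
      by (rule measurable_compose_countable[OF _ Jm[OF tD]]) (intro measurable_G Xm rm tD)
    note [measurable] = this
    show ?thesis unfolding g_def[abs_def] by measurable
  qed
  moreover have "AE \<eta> in M. V t \<eta> $ j = g \<eta>"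
    using V W_tracks
  proof eventually_elim
    case (elim \<eta>)
    note T = elim(2)
    obtain n where n: "jump_time (W \<eta>) n \<le> t \<and> t < jump_time (W \<eta>) (Suc n)"
      using segment_ex[OF T v t] by blast
    have r: "run_min X v q \<eta> = r q \<eta>" if "q \<in> ?D" for q
      unfolding r_def by (rule countable_run_min_eq[OF T v t that])
    have h: "a \<le> X q \<eta> - run_min X v q \<eta> \<longleftrightarrow> h q \<eta>" if "q \<in> ?D" for q
      by (simp add: h_def r[OF that])
    have "V t \<eta> $ j = (if survive n x v t (W \<eta>) then Gstate j n x v t (W \<eta>) else xi j x v (W \<eta>))"
      using elim(1) n by blast
    also have "\<dots> = g \<eta>"
      unfolding martingale_value_countable[OF T v t n] g_def r[OF tD]
      by (simp add: h cong: bex_cong ball_cong INF_cong_simp)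
    finally show ?case .
  qed
  ultimately have "(\<lambda>\<eta>. V t \<eta> $ j) \<in> borel_measurable ?S"
    by (rule measurable_augmented_AE)
  moreover have "sets ?S \<subseteq> sets (augmented_filtration M X J t)" "space ?S = space (augmented_filtration M X J t)"
    using sigma_augmented_events_subset[of M X J t] augmented_events_Pow[of M X J t]
    by (auto simp: space_augmented_filtration space_measure_of_conv)
  ultimately show ?thesis
    unfolding measurable_def by auto
qed

lemma subalgebra_M: "subalgebra (completion M) (augmented_filtration M X J t)"
  by (rule subalgebra_augmented) (rule process_measurable(2,3); assumption)+

lemma value_measurable: "0 \<le> t \<Longrightarrow> (\<lambda>\<eta>. V t \<eta> $ j) \<in> borel_measurable (completion M)"
  using measurable_from_subalg[OF subalgebra_M value_adapted] .

lemma value_integrable: 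
  assumes t: "0 \<le> t"
  shows "integrable (completion M) (\<lambda>\<eta>. V t \<eta> $ j)"
proof -
  interpret prob_space "completion M" by (rule prob_space.prob_space_completion[OF process_measurable(1)])
  have "AE \<eta> in completion M. norm (V t \<eta> $ j) \<le> 1"
    using AE_completion[OF value_bounds] by eventually_elim (use t in auto)
  then show ?thesis by (rule integrable_const_bound[OF _ value_measurable[OF t]])
qed

text \<open>The integrals are decomposed by the number of jumps up to \<open>t\<close>. On each
  piece \<open>A\<close> is replaced by its representative \<open>B n\<close>, and the difference of
  the integrands becomes \<open>gap\<close>, whose integral over \<open>B n\<close> is zero.\<close>

lemma integral_value_eq_xi:
  assumes t: "0 \<le> t" and A: "A \<in> sets (augmented_filtration M X J t)"
  shows "(\<integral>\<eta>. indicator A \<eta> * V t \<eta> $ j \<partial>completion M) = (\<integral>\<eta>. indicator A \<eta> * xi j x v (W \<eta>) \<partial>completion M)"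
proof -
  let ?M = "completion M"
  interpret prob_space ?M by (rule prob_space.prob_space_completion[OF process_measurable(1)])
  have x: "0 < x" "x \<le> v + a" using v by auto
  have AM: "A \<in> sets ?M" using subalgebra_M A by (auto simp: subalgebra_def)
  have "\<forall>n. \<exists>B. history n B \<and> (AE \<eta> in M. jump_time (W \<eta>) n \<le> t \<and> t < jump_time (W \<eta>) (Suc n) \<longrightarrow> (\<eta> \<in> A \<longleftrightarrow> W \<eta> \<in> B))"
    using filtration_history[OF A] by blast
  from choice[OF this] obtain B where B: "\<And>n. history n (B n)"
    "\<And>n. AE \<eta> in M. jump_time (W \<eta>) n \<le> t \<and> t < jump_time (W \<eta>) (Suc n) \<longrightarrow> (\<eta> \<in> A \<longleftrightarrow> W \<eta> \<in> B n)"
    by blast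
  have [measurable]: "B n \<in> sets seqM" for n using B(1) by (simp add: history_def)
  have AEB: "AE \<eta> in M. \<forall>n. jump_time (W \<eta>) n \<le> t \<and> t < jump_time (W \<eta>) (Suc n) \<longrightarrow> (\<eta> \<in> A \<longleftrightarrow> W \<eta> \<in> B n)"
    using B(2) by (simp add: AE_all_countable)
  define s where "s n \<eta> = indicator (B n) (W \<eta>) * gap j n x v t (W \<eta>)" for n \<eta>
  have sm: "s n \<in> borel_measurable M" for n
  proof -
    have "(\<lambda>\<omega>. indicator (B n) \<omega> * gap j n x v t \<omega>) \<in> borel_measurable seqM" by measurable
    from measurable_compose[OF W this] show ?thesis by (simp add: s_def[abs_def])
  qed
  have s0: "(\<integral>\<eta>. s n \<eta> \<partial>?M) = 0" for n
  proof -
    have "(\<integral>\<eta>. s n \<eta> \<partial>?M) = (\<integral>\<eta>. indicator (B n) (W \<eta>) * gap j n x v t (W \<eta>) \<partial>M)"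
      unfolding integral_completion[OF sm] by (simp add: s_def[abs_def])
    also have "\<dots> = (\<integral>\<omega>. indicator (B n) \<omega> * gap j n x v t \<omega> \<partial>mu i)"
      unfolding distr_W[symmetric] by (rule integral_distr[OF W, symmetric]) measurable
    also have "\<dots> = 0" by (rule integral_history_gap[OF x B(1)])
    finally show ?thesis .
  qed
  let ?f = "\<lambda>\<eta>. indicator A \<eta> * (xi j x v (W \<eta>) - V t \<eta> $ j)"
  \<comment> \<open>Only the actual number of jumps contributes, so partial sums are bounded by 1
    and dominated convergence applies.\<close>
  have point: "AE \<eta> in M. \<exists>n. s n \<eta> = ?f \<eta> \<and> \<bar>s n \<eta>\<bar> \<le> 1 \<and> (\<forall>m. m \<noteq> n \<longrightarrow> s m \<eta> = 0)"
    using V W_tracks AEB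
  proof eventually_elim
    case (elim \<eta>)
    note T = elim(2)
    obtain n where n: "jump_time (W \<eta>) n \<le> t \<and> t < jump_time (W \<eta>) (Suc n)"
      using segment_ex[OF T v t] by blast
    have "s n \<eta> = ?f \<eta>"
      using elim n by (auto simp: s_def gap_def indicator_def)
    moreover have "\<bar>s n \<eta>\<bar> \<le> 1"
      using gap_bound[where \<omega> = "W \<eta>", OF x holding_pos[OF T v]] by (simp add: s_def indicator_def)
    moreover have "s m \<eta> = 0" if "m \<noteq> n" for m
    proof -
      have "\<not> survive m x v t (W \<eta>)"
        using segment_unique[OF T v _ n, of m] that by (auto simp: survive_def)
      then show ?thesis by (simp add: s_def gap_def)
    qed
    ultimately show ?case by blast
  qed
  have xim: "(\<lambda>\<eta>. xi j x v (W \<eta>)) \<in> borel_measurable ?M"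
    by (intro measurable_completion measurable_xi W) auto
  have xii: "integrable ?M (\<lambda>\<eta>. xi j x v (W \<eta>))"
  proof -
    have "AE \<eta> in ?M. norm (xi j x v (W \<eta>)) \<le> 1"
      using AE_completion[OF W_tracks]
    proof eventually_elim
      case (elim \<eta>)
      show ?case using xi_bounds[where \<omega> = "W \<eta>" and j = j, OF x holding_pos[OF elim v]] by simp
    qed
    then show ?thesis by (rule integrable_const_bound[OF _ xim])
  qed
  have lim: "(\<lambda>N. \<integral>\<eta>. (\<Sum>n<N. s n \<eta>) \<partial>?M) \<longlonglongrightarrow> (\<integral>\<eta>. ?f \<eta> \<partial>?M)"
  proof (rule integral_dominated_convergence[where w = "\<lambda>_. 1"])
    show "?f \<in> borel_measurable ?M"
      using AM by (intro borel_measurable_times borel_measurable_indicator borel_measurable_diff xim value_measurable t)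
    show "(\<lambda>\<eta>. \<Sum>n<N. s n \<eta>) \<in> borel_measurable ?M" for N
      by (intro borel_measurable_sum measurable_completion sm)
    show "AE \<eta> in ?M. (\<lambda>N. \<Sum>n<N. s n \<eta>) \<longlonglongrightarrow> ?f \<eta>"
      using AE_completion[OF point]
    proof eventually_elim
      case (elim \<eta>)
      then obtain n where n: "s n \<eta> = ?f \<eta>" "\<And>m. m \<noteq> n \<Longrightarrow> s m \<eta> = 0" by blast
      have "(\<lambda>m. s m \<eta>) sums (\<Sum>m\<in>{n}. s m \<eta>)"
        using n(2) by (intro sums_finite) auto
      then show ?case unfolding sums_def using n(1) by simp
    qed
    show "AE \<eta> in ?M. norm (\<Sum>n<N. s n \<eta>) \<le> 1" for N
      using AE_completion[OF point]
    proof eventually_elim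
      case (elim \<eta>)
      then obtain n where n: "\<bar>s n \<eta>\<bar> \<le> 1" "\<And>m. m \<noteq> n \<Longrightarrow> s m \<eta> = 0" by blast
      have "(\<Sum>m<N. s m \<eta>) = (\<Sum>m<N. if n = m then s n \<eta> else 0)"
        using n(2) by (intro sum.cong) auto
      then show ?case using n(1) by simp
    qed
  qed simp
  have zero: "(\<integral>\<eta>. (\<Sum>n<N. s n \<eta>) \<partial>?M) = 0" for N
  proof -
    have "integrable ?M (s n)" for n
    proof -
      have "AE \<eta> in ?M. norm (s n \<eta>) \<le> 1"
        using AE_completion[OF point]
      proof eventually_elim
        case (elim \<eta>)
        then obtain m where "\<bar>s m \<eta>\<bar> \<le> 1" "\<forall>k. k \<noteq> m \<longrightarrow> s k \<eta> = 0" by blast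
        then show ?case by (cases "n = m") auto
      qed
      then show ?thesis by (rule integrable_const_bound) (intro measurable_completion sm)
    qed
    then show ?thesis using s0 by (subst Bochner_Integration.integral_sum) auto
  qed
  have "(\<integral>\<eta>. ?f \<eta> \<partial>?M) = 0"
    using lim unfolding zero by (simp add: LIMSEQ_const_iff)
  moreover have "(\<integral>\<eta>. ?f \<eta> \<partial>?M) = (\<integral>\<eta>. indicator A \<eta> * xi j x v (W \<eta>) - indicator A \<eta> * V t \<eta> $ j \<partial>?M)"
    by (simp add: right_diff_distrib)
  moreover have "\<dots> = (\<integral>\<eta>. indicator A \<eta> * xi j x v (W \<eta>) \<partial>?M) - (\<integral>\<eta>. indicator A \<eta> * V t \<eta> $ j \<partial>?M)"
    using integrable_real_mult_indicator[OF AM xii] integrable_real_mult_indicator[OF AM value_integrable[OF t]]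
    by (intro Bochner_Integration.integral_diff) (simp_all add: mult.commute)
  ultimately show ?thesis by simp
qed

text \<open>Events at time \<open>s\<close> are also events at time \<open>t\<close>, so over each
  of them \<open>V s\<close> and \<open>V t\<close> both have the same integral as
  \<open>xi\<close>; this characterises the conditional expectation.\<close>

lemma value_martingale: "vector_martingale (completion M) (augmented_filtration M X J) V"
  unfolding vector_martingale_def
proof (intro conjI allI impI)
  show "filtration (space (completion M)) (augmented_filtration M X J)"
    using filtration_augmented[of M X J] by simp
  show "subalgebra (completion M) (augmented_filtration M X J t)" for t by (rule subalgebra_M)
  have vec: "f \<in> borel_measurable N" if "\<And>j. (\<lambda>\<eta>. f \<eta> $ j) \<in> borel_measurable N"
    for f :: "'w \<Rightarrow> real^'e" and N
  proof (subst borel_measurable_euclidean_space, intro ballI)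
    fix b :: "real^'e" assume "b \<in> Basis"
    then obtain k where b: "b = axis k 1" by (auto simp: Basis_vec_def)
    show "(\<lambda>\<eta>. f \<eta> \<bullet> b) \<in> borel_measurable N" using that[of k] by (simp add: b inner_axis)
  qed
  show "V t \<in> borel_measurable (augmented_filtration M X J t)" if "0 \<le> t" for t
    by (rule vec[OF value_adapted[OF that]])
  show "integrable (completion M) (V t)" if "0 \<le> t" for t
  proof -
    interpret prob_space "completion M" by (rule prob_space.prob_space_completion[OF process_measurable(1)])
    have "AE \<eta> in completion M. norm (V t \<eta>) \<le> real CARD('e)"
      using AE_completion[OF value_bounds]
    proof eventually_elim
      case (elim \<eta>)
      have "(\<Sum>j\<in>UNIV. \<bar>V t \<eta> $ j\<bar>) \<le> (\<Sum>j\<in>(UNIV :: 'e set). 1)"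
        using elim that by (intro sum_mono) auto
      then show ?case using norm_le_l1_cart[of "V t \<eta>"] by simp
    qed
    then show ?thesis by (rule integrable_const_bound[OF _ vec[OF value_measurable[OF that]]])
  qed
  fix s t :: real and j assume st: "0 \<le> s \<and> s \<le> t"
  interpret prob_space "completion M" by (rule prob_space.prob_space_completion[OF process_measurable(1)])
  interpret finite_measure_subalgebra "completion M" "augmented_filtration M X J s"
    by unfold_locales (rule subalgebra_M)
  show "AE \<eta> in completion M. real_cond_exp (completion M) (augmented_filtration M X J s) (\<lambda>\<eta>. V t \<eta> $ j) \<eta> = V s \<eta> $ j"
  proof (rule real_cond_exp_charact)
    fix A assume A: "A \<in> sets (augmented_filtration M X J s)"
    then have "A \<in> sets (augmented_filtration M X J t)"
      using filtration.sets_F_mono[OF filtration_augmented] st by blast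
    then show "(LINT \<eta>:A|completion M. V t \<eta> $ j) = (LINT \<eta>:A|completion M. V s \<eta> $ j)"
      using integral_value_eq_xi[of t A j] integral_value_eq_xi[of s A j] A st
      by (simp add: set_lebesgue_integral_def)
  qed (use st value_integrable value_adapted in auto)
qed

lemma value_norm_bound: "AE \<eta> in completion M. \<forall>t\<ge>0. norm (V t \<eta>) \<le> real CARD('e)"
  using AE_completion[OF value_bounds]
proof eventually_elim
  case (elim \<eta>)
  show ?case
  proof (intro allI impI)
    fix t :: real assume t: "0 \<le> t"
    have "(\<Sum>j\<in>UNIV. \<bar>V t \<eta> $ j\<bar>) \<le> (\<Sum>j\<in>(UNIV :: 'e set). 1)"
      using elim t by (intro sum_mono) auto
    then show "norm (V t \<eta>) \<le> real CARD('e)" using norm_le_l1_cart[of "V t \<eta>"] by simp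
  qed
qed

end

end

end

theorem proposition6p5:
  fixes c lam p :: "real^'e::finite"
    and Q :: "real^'e^'e"
    and P :: "real \<Rightarrow> 'e \<Rightarrow> 'w measure"
    and X :: "real \<Rightarrow> 'w \<Rightarrow> real"
    and J :: "real \<Rightarrow> 'w \<Rightarrow> 'e"
    and F :: "real \<Rightarrow> real \<Rightarrow> real^'e^'e"
    and w a v x :: real
    and i :: 'e
  assumes model: "level_phase_model c lam p Q P X J"
    and w_pos: "0 < w"
    and a_pos: "0 < a"
    and F_bvp: "\<And>u. 0 < u \<Longrightarrow>
                  solves_bvp c lam p Q w a (H_mat P X J w a) u (\<lambda>y. F y u)"
    and v_pos: "0 < v"
    and x_range: "v \<le> x" "x < v + a"
  defines "Mart \<equiv> (\<lambda>t \<omega>. let r = stopped_at X v a t \<omega> in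
             exp (- w * r) *\<^sub>R row (J r \<omega>) (F (X r \<omega>) (run_min X v r \<omega>)))"
  shows "vector_martingale (completion (P x i)) (augmented_filtration (P x i) X J) Mart
         \<and> (\<exists>C. AE \<omega> in completion (P x i). \<forall>t\<ge>0. norm (Mart t \<omega>) \<le> C)"
proof -
  interpret drawup_model c lam p Q P X J w a
    using model w_pos a_pos by (simp add: drawup_model_def drawup_model_axioms_def)
  have x0: "0 \<le> x" using v_pos x_range by simp
  obtain W where W: "W \<in> measurable (P x i) seqM" "distr (P x i) seqM W = mu i"
    "AE \<eta> in P x i. tracks X J \<eta> x (W \<eta>)"
    using coupling[OF x0] by blast
  \<comment> \<open>Every minimum \<open>u\<close> has to be covered and not only \<open>v\<close>,
    because the running minimum moves with the path.\<close>
  have FG: "F y u $ k $ j = G j k y u" if "0 < u" "u \<le> y" "y \<le> u + a" for u y k j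
    using bvp_solution_eq_G[OF F_bvp[OF that(1)] that] .
  have Fend: "F (u + a) u = mat 1" if "0 < u" for u
    using F_bvp[OF that] by (simp add: solves_bvp_def)
  have V: "AE \<eta> in P x i. \<forall>t n j. jump_time (W \<eta>) n \<le> t \<and> t < jump_time (W \<eta>) (Suc n) \<longrightarrow>
    Mart t \<eta> $ j = (if survive n x v t (W \<eta>) then Gstate j n x v t (W \<eta>) else xi j x v (W \<eta>))"
    using W(3)
  proof eventually_elim
    case (elim \<eta>)
    show ?case unfolding Mart_def
      using martingale_value[OF elim v_pos x_range FG Fend] by blast
  qed
  show ?thesis
    using value_martingale[OF v_pos x_range W V] value_norm_bound[OF v_pos x_range W V] by blast
qed

end
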